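(* Let $m\in\{1,\dots,l\}$ and let $D=\{x\in\mathfrak h:\alpha_m(x)=0\}$ (times the line with coordinate $x_{l+1}$). The determinant of the Gram matrix of the restricted Saito metric $\eta_D$ in the coordinates $\tilde x_i$ ($i\ne m$), $x_{l+1}$ on $D$ satisfies $$\det\eta_D\;\equiv\;J_m\big|_D\;\prod_{\beta\in\mathcal R_+\setminus\{\alpha_m\}}\mathsf e_{\beta|_D},$$ where $\equiv$ denotes equality up to multiplication by a unit.
   Context: **Root data.** $\mathcal R$ is the irreducible (reduced, crystallographic) root system of rank $l$ of a complex simple Lie algebra with Cartan subalgebra $\mathfrak h$; $(\cdot,\cdot)$ is the complexified Killing form (Bourbaki normalisation), used to identify $\mathfrak h\cong\mathfrak h^*$; $\alpha_1,\dots,\alpha_l$ are the simple roots, $\mathcal R_+$ the positive roots, $\mathcal W$ the Weyl group, $\omega_i$ the fundamental weights, $\omega_i^\vee$ the fundamental coweights ($(\omega_i^\vee,\alpha_j)=\delta_{ij}$), $\Lambda_w$ the weight lattice. The marked index $\bar k$ is: any element of $\{1,\dots,l\}$ for $A_l$; $l-1$ for $B_l$; $l$ for $C_l$; $l-2$ for $D_l$; the trivalent node for $E_6,E_7,E_8$; $2$ (Bourbaki labelling) for $F_4,G_2$. Put $d_i=(\omega_i,\omega_{\bar k})$. On $\mathfrak h\oplus\mathbb C$ use coordinates $\tilde x_i=(\omega_i^\vee,x)$ for $x\in\mathfrak h$ (so $\partial/\partial\tilde x_i=\partial_{\alpha_i}$, the directional derivative along $\alpha_i$) and $x_{l+1}$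 on $\mathbb C$. **Trigonometric notation.** $\beta(x)=(\beta,x)$, $\mathsf e_\beta=2\sinh(\tfrac12\beta(x))$; $\mathsf e_{\beta|_D}$ is the same for the restricted form. A unit is a non-zero constant multiple of $\mathrm e^{(\mu(x)+\nu x_{l+1})/m'}$ with $\mu\in\Lambda_w$, $\nu\in\mathbb Z$, $m'\in\mathbb Z_{>0}$ (or its restriction to $D$); Fourier polynomials are finite linear combinations of such exponentials. **Metric (Dubrovin–Zhang).** Let $Y_i=\sum_{w\in\mathcal W}\mathrm e^{(w\omega_i,x)}$, $y_i=\mathrm e^{d_ix_{l+1}}Y_i$ ($i\le l$), $y_{l+1}=x_{l+1}$. Let $\gamma$ be the constant form equal to $(\cdot,\cdot)$ on $\mathfrak h$ plus $\gamma(\partial_{x_{l+1}},\partial_{x_{l+1}})=-d_{\bar k}$. The Saito metric $\eta$ has contravariant form $\mathcal L_e\gamma^{-1}$, with $e$ a non-zero constant multiple of $\partial/\partial y_{\bar k}$. It is flat, with flat coordinates $t_1,\dots,t_l$ (polynomials in $y_1,\dots,y_l,\mathrm e^{x_{l+1}}$) and $t_{l+1}=x_{l+1}$, ordered and normalised so that $e=\partial_{t_1}$ and $\eta(\partial_{t_\alpha},\partial_{t_\beta})=\delta_{\alpha+\beta,l+2}$ up to an overall non-zero constant. **Jacobian minors.** $J=\det(\partial_{\alpha_j}t_i)_{1\le i,j\le l}$, and $J_m$ is the minor of the matrix $(\partial_{\alpha_j}t_i)_{1\le i,j\le l}$ obtained by deleting the first row (that of $t_1$) and the $m$-th column. *)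

theory Defs
  imports
    "HOL-Analysis.Analysis"
    "Jordan_Normal_Form.Determinant"
    "Jordan_Normal_Form.Gauss_Jordan_Elimination"
begin

text \<open>Both HOL-Analysis and the matrix library claim the infix dollar sign and the bullet; below
  the former is always the component of a Cartesian vector.\<close>

no_notation Matrix.vec_index (infixl "$" 100)
no_notation Matrix.scalar_prod (infix "\<bullet>" 70)

section \<open>Root systems\<close>

text \<open>The real span of the roots is \<open>real ^ 'n\<close> with its standard inner product, so that the rank
  is \<open>CARD('n)\<close>; the Cartan subalgebra is its complexification \<open>complex ^ 'n\<close>, and it
  is identified with its dual by the complex bilinear extension of the inner product.\<close>

definition cartan_int :: "real ^ 'n \<Rightarrow> real ^ 'n \<Rightarrow> real" where
  "cartan_int v \<beta> = 2 * inner v \<beta> / inner \<beta> \<beta>"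

definition root_reflection :: "real ^ 'n \<Rightarrow> real ^ 'n \<Rightarrow> real ^ 'n" where
  "root_reflection \<beta> v = v - cartan_int v \<beta> *\<^sub>R \<beta>"

definition root_system :: "(real ^ 'n) set \<Rightarrow> bool" where
  "root_system R \<longleftrightarrow>
     finite R \<and> span R = UNIV \<and> 0 \<notin> R \<and>
     (\<forall>\<beta>\<in>R. root_reflection \<beta> ` R = R) \<and>
     (\<forall>\<beta>\<in>R. \<forall>\<delta>\<in>R. cartan_int \<delta> \<beta> \<in> \<int>) \<and>
     (\<forall>\<beta>\<in>R. \<forall>a. a *\<^sub>R \<beta> \<in> R \<longrightarrow> a = 1 \<or> a = -1)"

definition irreducible_roots :: "(real ^ 'n) set \<Rightarrow> bool" where
  "irreducible_roots R \<longleftrightarrow>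
     R \<noteq> {} \<and>
     \<not> (\<exists>S T. S \<noteq> {} \<and> T \<noteq> {} \<and> S \<union> T = R \<and> S \<inter> T = {} \<and>
            (\<forall>\<beta>\<in>S. \<forall>\<delta>\<in>T. inner \<beta> \<delta> = 0))"

text \<open>Simple roots are numbered \<open>\<alpha> 1, \<dots>, \<alpha> l\<close> with \<open>l = CARD('n)\<close>; other values of \<open>\<alpha>\<close> are
  irrelevant.\<close>

definition positive_roots :: "(real ^ 'n) set \<Rightarrow> (nat \<Rightarrow> real ^ 'n) \<Rightarrow> (real ^ 'n) set" where
  "positive_roots R \<alpha> =
     {\<beta> \<in> R. \<exists>a :: nat \<Rightarrow> nat. \<beta> = (\<Sum>i=1..CARD('n). real (a i) *\<^sub>R \<alpha> i)}"

definition simple_roots :: "(real ^ 'n) set \<Rightarrow> (nat \<Rightarrow> real ^ 'n) \<Rightarrow> bool" where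
  "simple_roots R \<alpha> \<longleftrightarrow>
     \<alpha> ` {1..CARD('n)} \<subseteq> R \<and> inj_on \<alpha> {1..CARD('n)} \<and> independent (\<alpha> ` {1..CARD('n)}) \<and>
     (\<forall>\<beta>\<in>R. \<beta> \<in> positive_roots R \<alpha> \<or> - \<beta> \<in> positive_roots R \<alpha>)"

inductive_set weyl_group :: "(real ^ 'n) set \<Rightarrow> (real ^ 'n \<Rightarrow> real ^ 'n) set"
  for R :: "(real ^ 'n) set" where
  weyl_id: "id \<in> weyl_group R"
| weyl_step: "w \<in> weyl_group R \<Longrightarrow> \<beta> \<in> R \<Longrightarrow> root_reflection \<beta> \<circ> w \<in> weyl_group R"

definition fund_weight :: "(nat \<Rightarrow> real ^ 'n) \<Rightarrow> nat \<Rightarrow> real ^ 'n" where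
  "fund_weight \<alpha> i = (THE v. \<forall>j\<in>{1..CARD('n)}. cartan_int v (\<alpha> j) = of_bool (i = j))"

definition fund_coweight :: "(nat \<Rightarrow> real ^ 'n) \<Rightarrow> nat \<Rightarrow> real ^ 'n" where
  "fund_coweight \<alpha> i = (THE v. \<forall>j\<in>{1..CARD('n)}. inner v (\<alpha> j) = of_bool (i = j))"

definition weight_lattice :: "(real ^ 'n) set \<Rightarrow> (real ^ 'n) set" where
  "weight_lattice R = {\<mu>. \<forall>\<beta>\<in>R. cartan_int \<mu> \<beta> \<in> \<int>}"

section \<open>Bourbaki labelling, normalisation and the marked index\<close>

datatype cartan_type =
  TypeA nat | TypeB nat | TypeC nat | TypeD nat | TypeE nat | TypeF4 | TypeG2

fun cartan_rank :: "cartan_type \<Rightarrow> nat" where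
  "cartan_rank (TypeA l) = l"
| "cartan_rank (TypeB l) = l"
| "cartan_rank (TypeC l) = l"
| "cartan_rank (TypeD l) = l"
| "cartan_rank (TypeE l) = l"
| "cartan_rank TypeF4 = 4"
| "cartan_rank TypeG2 = 2"

fun valid_cartan_type :: "cartan_type \<Rightarrow> bool" where
  "valid_cartan_type (TypeA l) \<longleftrightarrow> 1 \<le> l"
| "valid_cartan_type (TypeB l) \<longleftrightarrow> 2 \<le> l"
| "valid_cartan_type (TypeC l) \<longleftrightarrow> 2 \<le> l"
| "valid_cartan_type (TypeD l) \<longleftrightarrow> 4 \<le> l"
| "valid_cartan_type (TypeE l) \<longleftrightarrow> l \<in> {6, 7, 8}"
| "valid_cartan_type TypeF4 \<longleftrightarrow> True"
| "valid_cartan_type TypeG2 \<longleftrightarrow> True"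

text \<open>Edges \<open>i\<close> -- \<open>j\<close> with \<open>i < j\<close> of the Dynkin diagram, regardless of multiplicity.\<close>

fun dynkin_edge :: "cartan_type \<Rightarrow> nat \<Rightarrow> nat \<Rightarrow> bool" where
  "dynkin_edge (TypeD l) i j \<longleftrightarrow> (j = i + 1 \<and> j < l) \<or> (i + 2 = l \<and> j = l)"
| "dynkin_edge (TypeE l) i j \<longleftrightarrow> (i = 1 \<and> j = 3) \<or> (i = 2 \<and> j = 4) \<or> (3 \<le> i \<and> j = i + 1)"
| "dynkin_edge _ i j \<longleftrightarrow> j = i + 1"

text \<open>Squared length of the \<open>i\<close>-th simple root in Bourbaki's coordinates.\<close>

fun bourbaki_norm :: "cartan_type \<Rightarrow> nat \<Rightarrow> real" where
  "bourbaki_norm (TypeB l) i = (if i = l then 1 else 2)"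
| "bourbaki_norm (TypeC l) i = (if i = l then 4 else 2)"
| "bourbaki_norm TypeF4 i = (if i \<le> 2 then 2 else 1)"
| "bourbaki_norm TypeG2 i = (if i = 1 then 2 else 6)"
| "bourbaki_norm _ i = 2"

text \<open>For adjacent nodes the Cartan integer with respect to the longer root is \<open>-1\<close>, which
  determines the inner product from the two lengths.\<close>

definition bourbaki_gram :: "cartan_type \<Rightarrow> nat \<Rightarrow> nat \<Rightarrow> real" where
  "bourbaki_gram X i j =
     (if i = j then bourbaki_norm X i
      else if dynkin_edge X i j \<or> dynkin_edge X j i
      then - max (bourbaki_norm X i) (bourbaki_norm X j) / 2
      else 0)"

definition bourbaki_simple_roots :: "cartan_type \<Rightarrow> (nat \<Rightarrow> real ^ 'n) \<Rightarrow> bool" where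
  "bourbaki_simple_roots X \<alpha> \<longleftrightarrow>
     valid_cartan_type X \<and> cartan_rank X = CARD('n) \<and>
     (\<forall>i\<in>{1..CARD('n)}. \<forall>j\<in>{1..CARD('n)}. inner (\<alpha> i) (\<alpha> j) = bourbaki_gram X i j)"

fun marked_index :: "cartan_type \<Rightarrow> nat \<Rightarrow> bool" where
  "marked_index (TypeA l) k \<longleftrightarrow> k \<in> {1..l}"
| "marked_index (TypeB l) k \<longleftrightarrow> k = l - 1"
| "marked_index (TypeC l) k \<longleftrightarrow> k = l"
| "marked_index (TypeD l) k \<longleftrightarrow> k = l - 2"
| "marked_index (TypeE l) k \<longleftrightarrow> k = 4"
| "marked_index TypeF4 k \<longleftrightarrow> k = 2"
| "marked_index TypeG2 k \<longleftrightarrow> k = 2"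

section \<open>The extended Cartan subalgebra\<close>

type_synonym 'n ext = "(complex ^ 'n) \<times> complex"

definition cdot :: "complex ^ 'n \<Rightarrow> complex ^ 'n \<Rightarrow> complex" where
  "cdot x y = (\<Sum>i\<in>UNIV. x $ i * y $ i)"

definition cvec :: "real ^ 'n \<Rightarrow> complex ^ 'n" where
  "cvec v = (\<chi> i. complex_of_real (v $ i))"

text \<open>Coordinates on \<open>'n ext\<close> are numbered from \<open>1\<close> to \<open>CARD('n) + 1\<close>: the first ones are the
  pairings with the fundamental coweights, the last one is the coordinate of the line.\<close>

definition ext_coord :: "(nat \<Rightarrow> real ^ 'n) \<Rightarrow> nat \<Rightarrow> 'n ext \<Rightarrow> complex" where
  "ext_coord \<alpha> i p = (if i \<le> CARD('n) then cdot (cvec (fund_coweight \<alpha> i)) (fst p) else snd p)"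

text \<open>The coordinate vectors dual to \<open>ext_coord\<close>.\<close>

definition ext_frame :: "(nat \<Rightarrow> real ^ 'n) \<Rightarrow> nat \<Rightarrow> 'n ext" where
  "ext_frame \<alpha> i = (if i \<le> CARD('n) then (cvec (\<alpha> i), 0) else (0, 1))"

definition dir_deriv :: "('n::finite) ext \<Rightarrow> ('n ext \<Rightarrow> complex) \<Rightarrow> 'n ext \<Rightarrow> complex" where
  "dir_deriv v f p = deriv (\<lambda>z. f (fst p + z *s fst v, snd p + z * snd v)) 0"

abbreviation coord_deriv ::
    "(nat \<Rightarrow> real ^ 'n) \<Rightarrow> nat \<Rightarrow> ('n ext \<Rightarrow> complex) \<Rightarrow> 'n ext \<Rightarrow> complex" where
  "coord_deriv \<alpha> j \<equiv> dir_deriv (ext_frame \<alpha> j)"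

text \<open>Matrices have 0-based indices, everything else here is 1-based.\<close>

definition inv_mat :: "complex mat \<Rightarrow> complex mat" where
  "inv_mat A = the (mat_inverse A)"

definition jacobian ::
    "(nat \<Rightarrow> real ^ 'n) \<Rightarrow> (nat \<Rightarrow> 'n ext \<Rightarrow> complex) \<Rightarrow> 'n ext \<Rightarrow> complex mat" where
  "jacobian \<alpha> f p =
     Matrix.mat (CARD('n) + 1) (CARD('n) + 1) (\<lambda>(i, j). coord_deriv \<alpha> (j + 1) (f (i + 1)) p)"

text \<open>\<open>coord_field \<alpha> f i j\<close> is the component along \<open>ext_frame \<alpha> j\<close> of the vector field
  \<open>\<partial>/\<partial>f\<^sub>i\<close> of the local coordinate system \<open>f\<^sub>1, \<dots>, f\<^sub>l\<^sub>+\<^sub>1\<close>. Vector fields and tensors are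
  throughout given by their components in the coordinates \<open>ext_coord\<close>.\<close>

definition coord_field ::
    "(nat \<Rightarrow> real ^ 'n) \<Rightarrow> (nat \<Rightarrow> 'n ext \<Rightarrow> complex) \<Rightarrow> nat \<Rightarrow> nat \<Rightarrow> 'n ext \<Rightarrow> complex" where
  "coord_field \<alpha> f i j p = inv_mat (jacobian \<alpha> f p) $$ (j - 1, i - 1)"

definition lie_contravariant ::
    "(nat \<Rightarrow> real ^ 'n) \<Rightarrow> (nat \<Rightarrow> 'n ext \<Rightarrow> complex) \<Rightarrow> (nat \<Rightarrow> nat \<Rightarrow> 'n ext \<Rightarrow> complex)
      \<Rightarrow> nat \<Rightarrow> nat \<Rightarrow> 'n ext \<Rightarrow> complex" where
  "lie_contravariant \<alpha> e g i j p =
     (\<Sum>s=1..CARD('n) + 1.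
        e s p * coord_deriv \<alpha> s (g i j) p
        - g s j p * coord_deriv \<alpha> s (e i) p
        - g i s p * coord_deriv \<alpha> s (e j) p)"

section \<open>The Saito metric of Dubrovin and Zhang\<close>

definition dz_degree :: "(nat \<Rightarrow> real ^ 'n) \<Rightarrow> nat \<Rightarrow> nat \<Rightarrow> real" where
  "dz_degree \<alpha> k i = inner (fund_weight \<alpha> i) (fund_weight \<alpha> k)"

definition orbit_sum :: "(real ^ 'n) set \<Rightarrow> (nat \<Rightarrow> real ^ 'n) \<Rightarrow> nat \<Rightarrow> complex ^ 'n \<Rightarrow> complex" where
  "orbit_sum R \<alpha> i x = (\<Sum>w\<in>weyl_group R. exp (cdot (cvec (w (fund_weight \<alpha> i))) x))"

definition dz_coord ::
    "(real ^ 'n) set \<Rightarrow> (nat \<Rightarrow> real ^ 'n) \<Rightarrow> nat \<Rightarrow> nat \<Rightarrow> 'n ext \<Rightarrow> complex" where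
  "dz_coord R \<alpha> k i p =
     (if i \<le> CARD('n)
      then exp (complex_of_real (dz_degree \<alpha> k i) * snd p) * orbit_sum R \<alpha> i (fst p)
      else snd p)"

definition gamma_form :: "(nat \<Rightarrow> real ^ 'n) \<Rightarrow> nat \<Rightarrow> 'n ext \<Rightarrow> 'n ext \<Rightarrow> complex" where
  "gamma_form \<alpha> k u v =
     cdot (fst u) (fst v) - complex_of_real (dz_degree \<alpha> k k) * snd u * snd v"

definition gamma_contravariant ::
    "(nat \<Rightarrow> real ^ 'n) \<Rightarrow> nat \<Rightarrow> nat \<Rightarrow> nat \<Rightarrow> 'n ext \<Rightarrow> complex" where
  "gamma_contravariant \<alpha> k i j p =
     inv_mat (Matrix.mat (CARD('n) + 1) (CARD('n) + 1)
       (\<lambda>(a, b). gamma_form \<alpha> k (ext_frame \<alpha> (a + 1)) (ext_frame \<alpha> (b + 1)))) $$ (i - 1, j - 1)"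

text \<open>The set where \<open>y\<^sub>1, \<dots>, y\<^sub>l\<^sub>+\<^sub>1\<close> are local coordinates, i.e. the complement of the discriminant;
  the parameter \<open>c\<close> below is the constant in \<open>e = c \<partial>/\<partial>y\<^sub>k\<close>.\<close>

definition dz_regular :: "(real ^ 'n) set \<Rightarrow> (nat \<Rightarrow> real ^ 'n) \<Rightarrow> nat \<Rightarrow> ('n ext) set" where
  "dz_regular R \<alpha> k = {p. Determinant.det (jacobian \<alpha> (dz_coord R \<alpha> k) p) \<noteq> 0}"

definition saito_unit_field ::
    "(real ^ 'n) set \<Rightarrow> (nat \<Rightarrow> real ^ 'n) \<Rightarrow> nat \<Rightarrow> complex \<Rightarrow> nat \<Rightarrow> 'n ext \<Rightarrow> complex" where
  "saito_unit_field R \<alpha> k c j p = c * coord_field \<alpha> (dz_coord R \<alpha> k) k j p"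

definition saito_contravariant ::
    "(real ^ 'n) set \<Rightarrow> (nat \<Rightarrow> real ^ 'n) \<Rightarrow> nat \<Rightarrow> complex
      \<Rightarrow> nat \<Rightarrow> nat \<Rightarrow> 'n ext \<Rightarrow> complex" where
  "saito_contravariant R \<alpha> k c =
     lie_contravariant \<alpha> (saito_unit_field R \<alpha> k c) (gamma_contravariant \<alpha> k)"

definition saito_contravariant_mat ::
    "(real ^ 'n) set \<Rightarrow> (nat \<Rightarrow> real ^ 'n) \<Rightarrow> nat \<Rightarrow> complex \<Rightarrow> 'n ext \<Rightarrow> complex mat" where
  "saito_contravariant_mat R \<alpha> k c p =
     Matrix.mat (CARD('n) + 1) (CARD('n) + 1)
       (\<lambda>(a, b). saito_contravariant R \<alpha> k c (a + 1) (b + 1) p)"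

definition saito_covariant ::
    "(real ^ 'n) set \<Rightarrow> (nat \<Rightarrow> real ^ 'n) \<Rightarrow> nat \<Rightarrow> complex
      \<Rightarrow> nat \<Rightarrow> nat \<Rightarrow> 'n ext \<Rightarrow> complex" where
  "saito_covariant R \<alpha> k c i j p = inv_mat (saito_contravariant_mat R \<alpha> k c p) $$ (i - 1, j - 1)"

text \<open>The field \<open>e\<close> has poles on the mirrors, but the covariant metric extends
  continuously to them; the restriction to a mirror is that of the extension.\<close>

definition saito_metric ::
    "(real ^ 'n) set \<Rightarrow> (nat \<Rightarrow> real ^ 'n) \<Rightarrow> nat \<Rightarrow> complex
      \<Rightarrow> nat \<Rightarrow> nat \<Rightarrow> 'n ext \<Rightarrow> complex" where
  "saito_metric R \<alpha> k c i j p =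
     (if p \<in> dz_regular R \<alpha> k then saito_covariant R \<alpha> k c i j p
      else Lim (at p within dz_regular R \<alpha> k) (saito_covariant R \<alpha> k c i j))"

text \<open>The value of the metric on two tangent vectors at \<open>p\<close> given by their components.\<close>

definition saito_form ::
    "(real ^ 'n) set \<Rightarrow> (nat \<Rightarrow> real ^ 'n) \<Rightarrow> nat \<Rightarrow> complex \<Rightarrow> 'n ext
      \<Rightarrow> (nat \<Rightarrow> complex) \<Rightarrow> (nat \<Rightarrow> complex) \<Rightarrow> complex" where
  "saito_form R \<alpha> k c p u v =
     (\<Sum>i=1..CARD('n) + 1. \<Sum>j=1..CARD('n) + 1. saito_metric R \<alpha> k c i j p * u i * v j)"

text \<open>Polynomials in \<open>y\<^sub>1, \<dots>, y\<^sub>l\<close> and the exponential of the last coordinate.\<close>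

inductive_set dz_polynomials ::
    "(real ^ 'n) set \<Rightarrow> (nat \<Rightarrow> real ^ 'n) \<Rightarrow> nat \<Rightarrow> ('n ext \<Rightarrow> complex) set"
  for R :: "(real ^ 'n) set" and \<alpha> :: "nat \<Rightarrow> real ^ 'n" and k :: nat where
  dz_const: "(\<lambda>p. a) \<in> dz_polynomials R \<alpha> k"
| dz_y: "i \<in> {1..CARD('n)} \<Longrightarrow> dz_coord R \<alpha> k i \<in> dz_polynomials R \<alpha> k"
| dz_exp: "(\<lambda>p. exp (snd p)) \<in> dz_polynomials R \<alpha> k"
| dz_add: "f \<in> dz_polynomials R \<alpha> k \<Longrightarrow> g \<in> dz_polynomials R \<alpha> k
    \<Longrightarrow> (\<lambda>p. f p + g p) \<in> dz_polynomials R \<alpha> k"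
| dz_mult: "f \<in> dz_polynomials R \<alpha> k \<Longrightarrow> g \<in> dz_polynomials R \<alpha> k
    \<Longrightarrow> (\<lambda>p. f p * g p) \<in> dz_polynomials R \<alpha> k"

text \<open>Ordered and normalised flat coordinates of the Saito metric, which in particular is
  nondegenerate off the discriminant: \<open>e = \<partial>/\<partial>t\<^sub>1\<close>, and the Gram matrix in these
  coordinates is a constant multiple of the antidiagonal unit matrix.\<close>

definition saito_flat_coords ::
    "(real ^ 'n) set \<Rightarrow> (nat \<Rightarrow> real ^ 'n) \<Rightarrow> nat \<Rightarrow> complex
      \<Rightarrow> (nat \<Rightarrow> 'n ext \<Rightarrow> complex) \<Rightarrow> bool" where
  "saito_flat_coords R \<alpha> k c t \<longleftrightarrow>
     (\<forall>i\<in>{1..CARD('n)}. t i \<in> dz_polynomials R \<alpha> k) \<and>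
     t (CARD('n) + 1) = snd \<and>
     (\<forall>p\<in>dz_regular R \<alpha> k. Determinant.det (saito_contravariant_mat R \<alpha> k c p) \<noteq> 0) \<and>
     (\<forall>p\<in>dz_regular R \<alpha> k. Determinant.det (jacobian \<alpha> t p) \<noteq> 0) \<and>
     (\<forall>p\<in>dz_regular R \<alpha> k. \<forall>j\<in>{1..CARD('n) + 1}.
        saito_unit_field R \<alpha> k c j p = coord_field \<alpha> t 1 j p) \<and>
     (\<exists>\<kappa>. \<kappa> \<noteq> 0 \<and>
        (\<forall>p\<in>dz_regular R \<alpha> k. \<forall>a\<in>{1..CARD('n) + 1}. \<forall>b\<in>{1..CARD('n) + 1}.
           saito_form R \<alpha> k c p (\<lambda>j. coord_field \<alpha> t a j p) (\<lambda>j. coord_field \<alpha> t b j p) =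
             (if a + b = CARD('n) + 2 then \<kappa> else 0)))"

section \<open>Restriction to a mirror\<close>

definition mirror :: "(nat \<Rightarrow> real ^ 'n) \<Rightarrow> nat \<Rightarrow> ('n ext) set" where
  "mirror \<alpha> m = {p. cdot (cvec (\<alpha> m)) (fst p) = 0}"

text \<open>The coordinate vectors of the coordinates \<open>ext_coord \<alpha> i\<close>, \<open>i \<noteq> m\<close>, on the
  mirror. They are tangent to the mirror, hence in general different from \<open>ext_frame \<alpha> i\<close>.\<close>

definition mirror_frame :: "(nat \<Rightarrow> real ^ 'n) \<Rightarrow> nat \<Rightarrow> nat \<Rightarrow> 'n ext" where
  "mirror_frame \<alpha> m i =
     (THE v. v \<in> mirror \<alpha> m \<and> (\<forall>j\<in>{1..CARD('n) + 1} - {m}. ext_coord \<alpha> j v = of_bool (i = j)))"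

text \<open>Deleting row and column \<open>m\<close> leaves the Gram matrix of the restricted metric, of size
  \<open>CARD('n)\<close>; the deleted entries play no role.\<close>

definition saito_gram_mirror ::
    "(real ^ 'n) set \<Rightarrow> (nat \<Rightarrow> real ^ 'n) \<Rightarrow> nat \<Rightarrow> complex \<Rightarrow> nat \<Rightarrow> 'n ext \<Rightarrow> complex mat" where
  "saito_gram_mirror R \<alpha> k c m p =
     mat_delete
       (Matrix.mat (CARD('n) + 1) (CARD('n) + 1)
         (\<lambda>(a, b). saito_form R \<alpha> k c p
            (\<lambda>j. ext_coord \<alpha> j (mirror_frame \<alpha> m (a + 1)))
            (\<lambda>j. ext_coord \<alpha> j (mirror_frame \<alpha> m (b + 1)))))
       (m - 1) (m - 1)"

definition jacobian_minor ::
    "(nat \<Rightarrow> real ^ 'n) \<Rightarrow> (nat \<Rightarrow> 'n ext \<Rightarrow> complex) \<Rightarrow> nat \<Rightarrow> 'n ext \<Rightarrow> complex" where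
  "jacobian_minor \<alpha> t m p =
     Determinant.det (mat_delete
       (Matrix.mat CARD('n) CARD('n) (\<lambda>(i, j). coord_deriv \<alpha> (j + 1) (t (i + 1)) p))
       0 (m - 1))"

definition sinh_root :: "real ^ 'n \<Rightarrow> 'n ext \<Rightarrow> complex" where
  "sinh_root \<beta> p = 2 * sinh (cdot (cvec \<beta>) (fst p) / 2)"

definition trig_unit :: "(real ^ 'n) set \<Rightarrow> ('n ext \<Rightarrow> complex) \<Rightarrow> bool" where
  "trig_unit R u \<longleftrightarrow>
     (\<exists>a \<mu> (\<nu>::int) (m'::nat). a \<noteq> 0 \<and> \<mu> \<in> weight_lattice R \<and> m' > 0 \<and>
        u = (\<lambda>p. a * exp ((cdot (cvec \<mu>) (fst p) + of_int \<nu> * snd p) / of_nat m')))"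

definition eq_up_to_unit_on ::
    "('n ext) set \<Rightarrow> (real ^ 'n) set \<Rightarrow> ('n ext \<Rightarrow> complex) \<Rightarrow> ('n ext \<Rightarrow> complex) \<Rightarrow> bool" where
  "eq_up_to_unit_on S R f g \<longleftrightarrow> (\<exists>u. trig_unit R u \<and> (\<forall>p\<in>S. f p = u p * g p))"

end

theory Submission
  imports Defs "HOL-Real_Asymp.Real_Asymp"
begin

text \<open>Write \<open>l\<close> for the rank, \<open>T\<close> for the Jacobian matrix of \<open>t\<^sub>1, \<dots>, t\<^sub>l\<^sub>+\<^sub>1\<close> and \<open>Y\<close> for that of
  \<open>y\<^sub>1, \<dots>, y\<^sub>l\<^sub>+\<^sub>1\<close>, both in the linear coordinates, and let \<open>J = det T\<close>.

  The covariant metric is \<open>T\<^sup>t P T\<close> with a constant invertible matrix \<open>P\<close>. Its entries are exponential sums,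
  hence entire, so this formula also describes the extension to a mirror \<open>D = {\<alpha>\<^sub>m = 0}\<close>. The functions
  \<open>t\<^sub>i\<close> are invariant under the Weyl group, so their derivatives along \<open>\<alpha>\<^sub>m\<close> vanish on \<open>D\<close>: row and column
  \<open>m\<close> of the Gram matrix vanish there. The tangent frame of \<open>D\<close> differs from the frame of the ambient
  coordinates by multiples of \<open>\<alpha>\<^sub>m\<close> only, and therefore \<open>det \<eta>\<^sub>D\<close> is just the minor of \<open>T\<^sup>t P T\<close> without row
  and column \<open>m\<close> (\<open>gram_mirror\<close>).

  Off the mirrors this minor is \<open>det (T\<^sup>t P T)\<close> times the entry \<open>\<eta>\<^sup>m\<^sup>m\<close> of the contravariant metric. The form
  \<open>\<gamma>\<close> is constant, so the Lie derivative gives \<open>\<eta>\<^sup>m\<^sup>m = - 2 \<Sum>\<^sub>s \<gamma>\<^sup>m\<^sup>s \<partial>\<^sub>s e\<^sup>m\<close>; as \<open>e = \<partial>/\<partial>t\<^sub>1\<close>, Cramer's rule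
  gives \<open>e\<^sup>m = \<plusminus> J\<^sub>m / J\<close>. Hence the minor is a constant times \<open>\<Sum>\<^sub>s \<gamma>\<^sup>m\<^sup>s (J\<^sub>m \<partial>\<^sub>s J - J \<partial>\<^sub>s J\<^sub>m)\<close>, an identity of entire
  functions that persists on the mirrors by density. On \<open>D\<close> one has \<open>J = 0\<close>, which leaves
  \<open>det \<eta>\<^sub>D \<equiv> J\<^sub>m \<Sum>\<^sub>s \<gamma>\<^sup>m\<^sup>s \<partial>\<^sub>s J\<close> (\<open>det_gram_mirror\<close>). If \<open>J\<close> is a unit times the product of all factors
  \<open>2 sinh (\<beta>/2)\<close> over the positive roots, then on \<open>D\<close> only the factor of \<open>\<alpha>\<^sub>m\<close> needs to be differentiated,
  and the claim follows because \<open>\<Sum>\<^sub>s \<gamma>\<^sup>m\<^sup>s (\<alpha>\<^sub>m, \<alpha>\<^sub>s) = 1\<close> (\<open>det_T_mirror\<close>).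

  It remains to factor \<open>J\<close> (\<open>det_T\<close>). By the chain rule \<open>J = G det Y\<close>, where \<open>G\<close> is a polynomial in
  the \<open>y\<^sub>i\<close> and the exponential of the last coordinate. The determinant of the Jacobian of the orbit sums is
  antisymmetric under the Weyl group and all its exponents lie below \<open>\<rho>\<close> in the dominance order. Up to a
  factor there is only one such exponential sum, so it is proportional to the Weyl denominator
  (\<open>antisymmetric_multiple\<close>, \<open>det_orbit_jacobian\<close>). To see that \<open>G\<close> is a unit, express the contravariant
  metric in the coordinates \<open>y\<close>: its components are \<open>e (\<gamma>\<^sup>-\<^sup>1(dy\<^sub>i, dy\<^sub>j))\<close> (\<open>lie_derivative_pairing\<close>). By
  Chevalley's theorem (\<open>weyl_sum_in_ring\<close>) the invariant functions \<open>\<gamma>\<^sup>-\<^sup>1(dy\<^sub>i, dy\<^sub>j)\<close> are polynomials in the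
  \<open>y\<^sub>i\<close> with coefficients that are exponentials of the last coordinate, and \<open>e\<close>, being a multiple of
  \<open>\<partial>/\<partial>y\<^sub>k\<close>, maps such polynomials to such polynomials. So the determinant \<open>H\<close> of the metric in the coordinates
  \<open>y\<close> is an exponential sum. On the other hand \<open>H\<close> is \<open>(det Y)\<^sup>2\<close> divided by a constant multiple of \<open>J\<^sup>2\<close>,
  that is, a constant divided by \<open>G\<^sup>2\<close>. An exponential sum whose inverse is an exponential sum is a single
  exponential (\<open>exp_sums_unit\<close>). The exponents that occur are rational multiples of weights, because the
  root lattice has finite index in the weight lattice.\<close>

section \<open>Positive roots and simple reflections\<close>

locale based_root_system =
  fixes R :: "(real ^ 'n) set" and \<alpha> :: "nat \<Rightarrow> real ^ 'n"
  assumes root_system: "root_system R" and simple_roots: "simple_roots R \<alpha>"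
begin

abbreviation pos_roots :: "(real ^ 'n) set" where "pos_roots \<equiv> positive_roots R \<alpha>"
abbreviation omega_check :: "nat \<Rightarrow> real ^ 'n" where "omega_check \<equiv> fund_coweight \<alpha>"
abbreviation omega :: "nat \<Rightarrow> real ^ 'n" where "omega \<equiv> fund_weight \<alpha>"
abbreviation srefl :: "nat \<Rightarrow> real ^ 'n \<Rightarrow> real ^ 'n" where "srefl i \<equiv> root_reflection (\<alpha> i)"

lemma finite_roots: "finite R"
  and roots_nonzero: "\<beta> \<in> R \<Longrightarrow> \<beta> \<noteq> 0"
  and span_roots: "span R = UNIV"
  and reflection_roots: "\<beta> \<in> R \<Longrightarrow> root_reflection \<beta> ` R = R"
  and cartan_int_Ints: "\<beta> \<in> R \<Longrightarrow> \<delta> \<in> R \<Longrightarrow> cartan_int \<delta> \<beta> \<in> \<int>"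
  and roots_reduced: "\<beta> \<in> R \<Longrightarrow> a *\<^sub>R \<beta> \<in> R \<Longrightarrow> a = 1 \<or> a = -1"
  using root_system unfolding root_system_def by blast+

lemma reflection_root: "\<beta> \<in> R \<Longrightarrow> \<gamma> \<in> R \<Longrightarrow> root_reflection \<beta> \<gamma> \<in> R"
  using reflection_roots by blast

lemma simple_root_in: "i \<in> {1..CARD('n)} \<Longrightarrow> \<alpha> i \<in> R"
  and simple_inj: "inj_on \<alpha> {1..CARD('n)}"
  and simple_independent: "independent (\<alpha> ` {1..CARD('n)})"
  and pos_or_neg: "\<beta> \<in> R \<Longrightarrow> \<beta> \<in> pos_roots \<or> - \<beta> \<in> pos_roots"
  using simple_roots unfolding simple_roots_def by blast+

lemma simple_nonzero: "i \<in> {1..CARD('n)} \<Longrightarrow> \<alpha> i \<noteq> 0"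
  using simple_root_in roots_nonzero by blast

lemma simple_norm_pos: "i \<in> {1..CARD('n)} \<Longrightarrow> \<alpha> i \<bullet> \<alpha> i > 0"
  using simple_nonzero by simp

lemma span_simple: "span (\<alpha> ` {1..CARD('n)}) = UNIV"
proof -
  have "card (\<alpha> ` {1..CARD('n)}) = CARD('n)" using simple_inj by (simp add: card_image)
  then show ?thesis
    using card_ge_dim_independent[of "\<alpha> ` {1..CARD('n)}" UNIV] simple_independent by auto
qed

lemma eq_zero_if_orthogonal:
  assumes "\<And>i. i \<in> {1..CARD('n)} \<Longrightarrow> v \<bullet> \<alpha> i = 0" shows "v = 0"
proof -
  have "v \<bullet> x = 0" for x
  proof -
    have "real_inner_class.orthogonal v x"
      by (rule orthogonal_to_span[of x "\<alpha> ` {1..CARD('n)}"])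
        (use span_simple assms in \<open>auto simp: real_inner_class.orthogonal_def\<close>)
    then show ?thesis by (simp add: real_inner_class.orthogonal_def)
  qed
  then show ?thesis by (metis inner_eq_zero_iff)
qed

lemma eq_if_inner_simple:
  assumes "\<And>i. i \<in> {1..CARD('n)} \<Longrightarrow> v \<bullet> \<alpha> i = w \<bullet> \<alpha> i" shows "v = w"
  using eq_zero_if_orthogonal[of "v - w"] assms by (auto simp: inner_diff_left)

lemma coweight_simple:
  assumes i: "i \<in> {1..CARD('n)}" and j: "j \<in> {1..CARD('n)}"
  shows "omega_check i \<bullet> \<alpha> j = of_bool (i = j)"
proof -
  have "\<exists>g :: real ^ 'n \<Rightarrow> real. linear g \<and>
      (\<forall>x\<in>\<alpha> ` {1..CARD('n)}. g x = (\<lambda>x. of_bool (x = \<alpha> i)) x)"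
    by (rule linear_independent_extend[OF simple_independent])
  then obtain g :: "real ^ 'n \<Rightarrow> real"
    where g: "linear g" "\<forall>x\<in>\<alpha> ` {1..CARD('n)}. g x = of_bool (x = \<alpha> i)" by blast
  define v where "v = adjoint g 1"
  have v: "v \<bullet> x = g x" for x
    using adjoint_works[OF g(1), of x 1] unfolding v_def by (simp add: inner_commute)
  have ex: "\<forall>j\<in>{1..CARD('n)}. v \<bullet> \<alpha> j = of_bool (i = j)"
    using g(2) v simple_inj i by (auto simp: inj_on_eq_iff)
  have "\<forall>j\<in>{1..CARD('n)}. omega_check i \<bullet> \<alpha> j = of_bool (i = j)"
    unfolding fund_coweight_def
  proof (rule theI2[where a = v])
    show "\<forall>j\<in>{1..CARD('n)}. v \<bullet> \<alpha> j = of_bool (i = j)" by (fact ex)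
    show "x = v" if "\<forall>j\<in>{1..CARD('n)}. x \<bullet> \<alpha> j = of_bool (i = j)" for x
      using that ex by (intro eq_if_inner_simple) auto
  qed auto
  then show ?thesis using j by blast
qed

lemma simple_coweight:
  assumes i: "i \<in> {1..CARD('n)}" and j: "j \<in> {1..CARD('n)}"
  shows "\<alpha> j \<bullet> omega_check i = of_bool (i = j)"
  using coweight_simple[OF assms] by (simp add: inner_commute)

lemma coweight_expansion: "v = (\<Sum>i=1..CARD('n). (v \<bullet> \<alpha> i) *\<^sub>R omega_check i)"
  by (rule eq_if_inner_simple) (simp add: inner_sum_left coweight_simple if_distrib cong: if_cong)

lemma inner_expansion: "v \<bullet> w = (\<Sum>i=1..CARD('n). (v \<bullet> \<alpha> i) * (w \<bullet> omega_check i))"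
proof -
  have "v \<bullet> w = (\<Sum>i=1..CARD('n). (v \<bullet> \<alpha> i) *\<^sub>R omega_check i) \<bullet> w"
    using coweight_expansion[of v] by (rule arg_cong)
  then show ?thesis by (simp add: inner_sum_left inner_commute[of "omega_check _" w])
qed

lemma simple_expansion: "v = (\<Sum>i=1..CARD('n). (v \<bullet> omega_check i) *\<^sub>R \<alpha> i)"
proof -
  have "(v - (\<Sum>i=1..CARD('n). (v \<bullet> omega_check i) *\<^sub>R \<alpha> i)) \<bullet> w = 0" for w
    using inner_expansion[of w v]
    by (simp add: inner_diff_left inner_sum_left inner_commute[of "\<alpha> _" w] inner_commute[of v w] mult.commute)
  from this[of "v - (\<Sum>i=1..CARD('n). (v \<bullet> omega_check i) *\<^sub>R \<alpha> i)"]
  have "v - (\<Sum>i=1..CARD('n). (v \<bullet> omega_check i) *\<^sub>R \<alpha> i) = 0"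
    by (simp only: inner_eq_zero_iff)
  then show ?thesis by (simp only: right_minus_eq)
qed

lemma cartan_int_simple_weight:
  assumes i: "i \<in> {1..CARD('n)}" and j: "j \<in> {1..CARD('n)}"
  shows "cartan_int (omega i) (\<alpha> j) = of_bool (i = j)"
proof -
  define v where "v = ((\<alpha> i \<bullet> \<alpha> i) / 2) *\<^sub>R omega_check i"
  have ex: "\<forall>j\<in>{1..CARD('n)}. cartan_int v (\<alpha> j) = of_bool (i = j)"
    using i simple_nonzero by (auto simp: v_def cartan_int_def coweight_simple)
  have "\<forall>j\<in>{1..CARD('n)}. cartan_int (omega i) (\<alpha> j) = of_bool (i = j)"
    unfolding fund_weight_def
  proof (rule theI2[where a = v])
    show "x = v" if "\<forall>j\<in>{1..CARD('n)}. cartan_int x (\<alpha> j) = of_bool (i = j)" for x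
    proof (rule eq_if_inner_simple)
      fix j assume j: "j \<in> {1..CARD('n)}"
      then have "cartan_int x (\<alpha> j) = cartan_int v (\<alpha> j)" using that ex by metis
      then show "x \<bullet> \<alpha> j = v \<bullet> \<alpha> j"
        using simple_norm_pos[OF j] by (simp add: cartan_int_def)
    qed
  qed (use ex in auto)
  then show ?thesis using j by blast
qed

lemma weight_simple:
  assumes i: "i \<in> {1..CARD('n)}" and j: "j \<in> {1..CARD('n)}"
  shows "omega i \<bullet> \<alpha> j = of_bool (i = j) * (\<alpha> i \<bullet> \<alpha> i) / 2"
  using cartan_int_simple_weight[OF assms] simple_norm_pos[OF j]
  by (auto simp: cartan_int_def field_simps split: if_splits)

lemma linear_reflection: "linear (root_reflection \<beta>)"
  unfolding root_reflection_def cartan_int_def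
  by (intro linearI) (auto simp: algebra_simps inner_simps add_divide_distrib)

lemma reflection_inner: "root_reflection \<beta> v \<bullet> root_reflection \<beta> w = v \<bullet> w"
  by (cases "\<beta> = 0")
     (auto simp: root_reflection_def cartan_int_def inner_simps inner_commute)

lemma reflection_invol: "root_reflection \<beta> (root_reflection \<beta> v) = v"
  by (cases "\<beta> = 0")
     (auto simp: root_reflection_def cartan_int_def inner_simps algebra_simps)

lemma reflection_adjoint: "root_reflection \<beta> v \<bullet> w = v \<bullet> root_reflection \<beta> w"
  by (metis reflection_inner reflection_invol)

lemma reflection_self: "\<beta> \<noteq> 0 \<Longrightarrow> root_reflection \<beta> \<beta> = - \<beta>"
  by (simp add: root_reflection_def cartan_int_def scaleR_2)

lemma neg_root: "\<beta> \<in> R \<Longrightarrow> - \<beta> \<in> R"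
  using reflection_root[of \<beta> \<beta>] reflection_self[of \<beta>] roots_nonzero[of \<beta>] by simp

text \<open>The closed cone spanned by the simple roots, described by the coefficients; \<open>nonneg (v - w)\<close> is
  the dominance order.\<close>

definition nonneg :: "real ^ 'n \<Rightarrow> bool" where
  "nonneg v \<longleftrightarrow> (\<forall>i\<in>{1..CARD('n)}. v \<bullet> omega_check i \<ge> 0)"

definition dominant :: "real ^ 'n \<Rightarrow> bool" where
  "dominant v \<longleftrightarrow> (\<forall>i\<in>{1..CARD('n)}. v \<bullet> \<alpha> i \<ge> 0)"

text \<open>Stated with the simple coroots, which makes the fundamental weights integral at once;
  \<open>integral_all_roots\<close> extends integrality to all coroots, so that the integral vectors are the
  weights.\<close>

definition integral :: "real ^ 'n \<Rightarrow> bool" where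
  "integral v \<longleftrightarrow> (\<forall>i\<in>{1..CARD('n)}. cartan_int v (\<alpha> i) \<in> \<int>)"

lemma nonneg_add: "nonneg v \<Longrightarrow> nonneg w \<Longrightarrow> nonneg (v + w)"
  by (simp add: nonneg_def inner_add_left)

lemma nonneg_scale: "nonneg v \<Longrightarrow> a \<ge> 0 \<Longrightarrow> nonneg (a *\<^sub>R v)"
  by (simp add: nonneg_def)

lemma nonneg_sum: "(\<And>i. i \<in> A \<Longrightarrow> nonneg (f i)) \<Longrightarrow> nonneg (sum f A)"
  by (simp add: nonneg_def inner_sum_left sum_nonneg)

lemma nonneg_antisym: "nonneg v \<Longrightarrow> nonneg (- v) \<Longrightarrow> v = 0"
  by (subst simple_expansion[of v]) (force simp: nonneg_def intro!: sum.neutral)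

lemma dominant_nonneg_inner: "dominant v \<Longrightarrow> nonneg w \<Longrightarrow> v \<bullet> w \<ge> 0"
  by (subst inner_expansion) (auto simp: dominant_def nonneg_def intro!: sum_nonneg)

lemma pos_root_in: "\<beta> \<in> pos_roots \<Longrightarrow> \<beta> \<in> R" by (simp add: positive_roots_def)

lemma pos_root_coeff:
  assumes "\<beta> \<in> pos_roots" "i \<in> {1..CARD('n)}" shows "\<beta> \<bullet> omega_check i \<in> \<nat>"
proof -
  obtain a :: "nat \<Rightarrow> nat" where "\<beta> = (\<Sum>i=1..CARD('n). real (a i) *\<^sub>R \<alpha> i)"
    using assms(1) unfolding positive_roots_def by blast
  then have "\<beta> \<bullet> omega_check i = real (a i)"
    using assms(2) by (simp add: inner_sum_left simple_coweight if_distrib cong: if_cong)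
  then show ?thesis by simp
qed

lemma pos_root_nonneg: "\<beta> \<in> pos_roots \<Longrightarrow> nonneg \<beta>"
  unfolding nonneg_def using pos_root_coeff Nats_cases by (metis of_nat_0_le_iff)

lemma not_pos_and_neg: "\<beta> \<in> pos_roots \<Longrightarrow> - \<beta> \<notin> pos_roots"
  using pos_root_nonneg nonneg_antisym pos_root_in roots_nonzero by blast

lemma pos_root_iff: "\<beta> \<in> R \<Longrightarrow> \<beta> \<in> pos_roots \<longleftrightarrow> nonneg \<beta>"
  using pos_root_nonneg pos_or_neg nonneg_antisym roots_nonzero by blast

lemma neg_pos_root_iff: "\<beta> \<in> R \<Longrightarrow> - \<beta> \<in> pos_roots \<longleftrightarrow> \<beta> \<notin> pos_roots"
  using pos_or_neg not_pos_and_neg by blast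

lemma simple_root_pos: "i \<in> {1..CARD('n)} \<Longrightarrow> \<alpha> i \<in> pos_roots"
  by (subst pos_root_iff) (auto simp: nonneg_def simple_root_in simple_coweight)

lemma finite_pos_roots: "finite pos_roots"
  using finite_roots pos_root_in by (meson finite_subset subsetI)

lemma pos_root_if_coeff:
  assumes "\<beta> \<in> R" "i \<in> {1..CARD('n)}" "\<beta> \<bullet> omega_check i > 0" shows "\<beta> \<in> pos_roots"
  using pos_or_neg[OF assms(1)] assms pos_root_nonneg[of "-\<beta>"] by (force simp: nonneg_def)

lemma srefl_coeff:
  assumes "i \<in> {1..CARD('n)}" "j \<in> {1..CARD('n)}" "i \<noteq> j"
  shows "srefl i v \<bullet> omega_check j = v \<bullet> omega_check j"
  using assms by (simp add: root_reflection_def inner_diff_left simple_coweight)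

text \<open>A positive root other than \<open>\<alpha> i\<close> has a positive coefficient at some other simple root,
  because the root system is reduced. The reflection leaves that coefficient unchanged, and one positive
  coefficient makes a root positive.\<close>

lemma srefl_pos_root:
  assumes i: "i \<in> {1..CARD('n)}" and b: "\<beta> \<in> pos_roots" "\<beta> \<noteq> \<alpha> i"
  shows "srefl i \<beta> \<in> pos_roots - {\<alpha> i}"
proof -
  have "\<exists>j\<in>{1..CARD('n)}. j \<noteq> i \<and> \<beta> \<bullet> omega_check j > 0"
  proof (rule ccontr)
    assume "\<not> ?thesis"
    then have z: "\<beta> \<bullet> omega_check j = 0" if "j \<in> {1..CARD('n)}" "j \<noteq> i" for j
      using pos_root_nonneg[OF b(1)] that unfolding nonneg_def by force
    have "\<beta> = (\<Sum>j\<in>{i}. (\<beta> \<bullet> omega_check j) *\<^sub>R \<alpha> j)"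
      by (subst simple_expansion, rule sum.mono_neutral_right) (use i z in auto)
    then have e: "\<beta> = (\<beta> \<bullet> omega_check i) *\<^sub>R \<alpha> i" by simp
    then have "\<beta> \<bullet> omega_check i = 1 \<or> \<beta> \<bullet> omega_check i = -1"
      using roots_reduced[of "\<alpha> i" "\<beta> \<bullet> omega_check i"] simple_root_in[OF i] pos_root_in[OF b(1)] by simp
    then show False using e b(2) pos_root_nonneg[OF b(1)] i unfolding nonneg_def by fastforce
  qed
  then obtain j where j: "j \<in> {1..CARD('n)}" "j \<noteq> i" "\<beta> \<bullet> omega_check j > 0" by blast
  then have c: "srefl i \<beta> \<bullet> omega_check j > 0" using i by (simp add: srefl_coeff)
  then have "srefl i \<beta> \<in> pos_roots"
    using pos_root_if_coeff j(1) reflection_root simple_root_in[OF i] pos_root_in[OF b(1)] by blast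
  moreover have "srefl i \<beta> \<noteq> \<alpha> i" using c j i by (auto simp: simple_coweight)
  ultimately show ?thesis by blast
qed

lemma srefl_simple: "i \<in> {1..CARD('n)} \<Longrightarrow> srefl i (\<alpha> i) = - \<alpha> i"
  by (simp add: reflection_self simple_nonzero)

lemma bij_srefl_pos_roots:
  assumes i: "i \<in> {1..CARD('n)}"
  shows "bij_betw (srefl i) (pos_roots - {\<alpha> i}) (pos_roots - {\<alpha> i})"
  by (rule bij_betwI[where g = "srefl i"]) (use srefl_pos_root[OF i] reflection_invol in auto)

text \<open>A positive root that is not simple has positive inner product with some simple root, as otherwise its norm
  would not be positive. The reflection in that simple root keeps it positive and lowers the sum of its
  coefficients.\<close>

lemma positive_root_induct [consumes 1, case_names simple reflect]:
  assumes b: "\<beta> \<in> pos_roots"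
    and base: "\<And>i. i \<in> {1..CARD('n)} \<Longrightarrow> P (\<alpha> i)"
    and step: "\<And>i \<beta>. i \<in> {1..CARD('n)} \<Longrightarrow> \<beta> \<in> pos_roots \<Longrightarrow> P \<beta> \<Longrightarrow> P (srefl i \<beta>)"
  shows "P \<beta>"
proof -
  define height where "height \<beta> = (\<Sum>j=1..CARD('n). nat \<lfloor>\<beta> \<bullet> omega_check j\<rfloor>)" for \<beta>
  have "\<beta> \<in> pos_roots \<Longrightarrow> P \<beta>" for \<beta>
  proof (induction "height \<beta>" arbitrary: \<beta> rule: less_induct)
    case less
    show ?case
    proof (cases "\<exists>i\<in>{1..CARD('n)}. \<beta> = \<alpha> i")
      case True then show ?thesis using base by blast
    next
      case False
      have "\<exists>i\<in>{1..CARD('n)}. \<beta> \<bullet> \<alpha> i > 0"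
      proof (rule ccontr)
        assume "\<not> ?thesis"
        then have "dominant (- \<beta>)" by (auto simp: dominant_def not_less)
        then have "\<beta> \<bullet> \<beta> \<le> 0"
          using dominant_nonneg_inner[of "-\<beta>" \<beta>] pos_root_nonneg[OF less.prems] by simp
        then show False using roots_nonzero pos_root_in[OF less.prems]
          by (metis inner_gt_zero_iff not_less)
      qed
      then obtain i where i: "i \<in> {1..CARD('n)}" "\<beta> \<bullet> \<alpha> i > 0" by blast
      have pos: "srefl i \<beta> \<in> pos_roots" using srefl_pos_root i less.prems False by blast
      have lt: "srefl i \<beta> \<bullet> omega_check i < \<beta> \<bullet> omega_check i"
        using i simple_norm_pos[OF i(1)]
        by (simp add: root_reflection_def cartan_int_def inner_diff_left simple_coweight)
      have "nat \<lfloor>srefl i \<beta> \<bullet> omega_check i\<rfloor> < nat \<lfloor>\<beta> \<bullet> omega_check i\<rfloor>"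
        using lt pos_root_coeff[OF pos i(1)] pos_root_coeff[OF less.prems i(1)]
        by (auto elim!: Nats_cases)
      then have "height (srefl i \<beta>) < height \<beta>"
        unfolding height_def
      proof (intro sum_strict_mono_ex1 ballI bexI[OF _ i(1)])
        fix j assume "j \<in> {1..CARD('n)}"
        then show "nat \<lfloor>srefl i \<beta> \<bullet> omega_check j\<rfloor> \<le> nat \<lfloor>\<beta> \<bullet> omega_check j\<rfloor>"
          using \<open>nat \<lfloor>srefl i \<beta> \<bullet> omega_check i\<rfloor> < nat \<lfloor>\<beta> \<bullet> omega_check i\<rfloor>\<close> i(1)
          by (cases "i = j") (simp_all add: srefl_coeff nat_mono)
      qed simp_all
      then have "P (srefl i \<beta>)" using less.hyps pos by blast
      then have "P (srefl i (srefl i \<beta>))" using step i pos by blast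
      then show ?thesis by (simp add: reflection_invol)
    qed
  qed
  then show ?thesis using b by blast
qed

end

section \<open>The Weyl group and the dominance order\<close>

context based_root_system begin

text \<open>Products of simple reflections are represented by lists because the exchange argument inducts on the length of
  an expression.\<close>

primrec word :: "nat list \<Rightarrow> real ^ 'n \<Rightarrow> real ^ 'n" where
  "word [] = id"
| "word (i # is) = srefl i \<circ> word is"

lemma word_append: "word (is @ js) = word is \<circ> word js"
  by (induction "is") (simp_all add: comp_assoc)

lemma linear_word: "linear (word is)"
  by (induction "is") (simp_all only: word.simps linear_id linear_compose linear_reflection)

lemma word_inner: "word is v \<bullet> word is w = v \<bullet> w"
  by (induction "is") (simp_all add: reflection_inner)

lemma word_rev: "word (rev is) (word is v) = v"
  by (induction "is") (simp_all add: word_append reflection_invol)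

lemma word_root: "set is \<subseteq> {1..CARD('n)} \<Longrightarrow> \<beta> \<in> R \<Longrightarrow> word is \<beta> \<in> R"
  by (induction "is") (auto intro!: reflection_root simple_root_in)

lemma reflection_conjugate:
  "root_reflection (root_reflection \<gamma> \<beta>) = root_reflection \<gamma> \<circ> root_reflection \<beta> \<circ> root_reflection \<gamma>"
proof
  fix v
  have "(root_reflection \<gamma> \<circ> root_reflection \<beta> \<circ> root_reflection \<gamma>) v
      = root_reflection \<gamma> (root_reflection \<gamma> v - cartan_int (root_reflection \<gamma> v) \<beta> *\<^sub>R \<beta>)"
    by (simp add: root_reflection_def[of \<beta>])
  also have "\<dots> = v - cartan_int (root_reflection \<gamma> v) \<beta> *\<^sub>R root_reflection \<gamma> \<beta>"
    by (simp add: linear_diff[OF linear_reflection] linear_scale[OF linear_reflection] reflection_invol)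
  also have "cartan_int (root_reflection \<gamma> v) \<beta> = cartan_int v (root_reflection \<gamma> \<beta>)"
    using reflection_inner[of \<gamma> \<beta> \<beta>] reflection_adjoint[of \<gamma> v \<beta>] by (simp add: cartan_int_def)
  finally show "root_reflection (root_reflection \<gamma> \<beta>) v
      = (root_reflection \<gamma> \<circ> root_reflection \<beta> \<circ> root_reflection \<gamma>) v"
    by (simp add: root_reflection_def[of "root_reflection \<gamma> \<beta>"])
qed

text \<open>Reflecting a root conjugates its reflection (\<open>reflection_conjugate\<close>), so that
  \<open>positive_root_induct\<close> applies.\<close>

lemma reflection_is_word:
  assumes "\<beta> \<in> R" shows "\<exists>is. set is \<subseteq> {1..CARD('n)} \<and> root_reflection \<beta> = word is"
proof -
  have pos: "\<exists>is. set is \<subseteq> {1..CARD('n)} \<and> root_reflection \<beta> = word is" if "\<beta> \<in> pos_roots" for \<beta>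
    using that
  proof (induction rule: positive_root_induct)
    case (simple i)
    then show ?case by (intro exI[of _ "[i]"]) simp
  next
    case (reflect i \<beta>)
    then obtain js where "set js \<subseteq> {1..CARD('n)}" "root_reflection \<beta> = word js" by blast
    then show ?case using reflect(1)
      by (intro exI[of _ "i # js @ [i]"]) (simp add: word_append reflection_conjugate comp_assoc)
  qed
  have "root_reflection (- \<beta>) = root_reflection \<beta>"
    by (simp add: root_reflection_def cartan_int_def fun_eq_iff)
  then show ?thesis using pos pos_or_neg[OF assms] by metis
qed

abbreviation W :: "(real ^ 'n \<Rightarrow> real ^ 'n) set" where "W \<equiv> weyl_group R"

lemma weyl_eq_words: "W = word ` {is. set is \<subseteq> {1..CARD('n)}}"
proof (intro equalityI subsetI)
  fix w assume "w \<in> W"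
  then show "w \<in> word ` {is. set is \<subseteq> {1..CARD('n)}}"
  proof (induction rule: weyl_group.induct)
    case weyl_id
    show ?case by (rule image_eqI[of _ _ "[]"]) auto
  next
    case (weyl_step w \<beta>)
    then obtain js where "w = word js" "set js \<subseteq> {1..CARD('n)}" by blast
    moreover obtain ks where "root_reflection \<beta> = word ks" "set ks \<subseteq> {1..CARD('n)}"
      using reflection_is_word weyl_step by blast
    ultimately show ?case by (intro image_eqI[of _ _ "ks @ js"]) (auto simp: word_append)
  qed
next
  fix w assume "w \<in> word ` {is. set is \<subseteq> {1..CARD('n)}}"
  then obtain js where js: "w = word js" "set js \<subseteq> {1..CARD('n)}" by blast
  have "set js \<subseteq> {1..CARD('n)} \<Longrightarrow> word js \<in> W"
  proof (induction js)
    case Nil show ?case unfolding word.simps by (rule weyl_id)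
  next
    case (Cons i js) then show ?case unfolding word.simps
      by (intro weyl_step simple_root_in) auto
  qed
  then show "w \<in> W" using js by blast
qed

lemma weyl_wordE:
  assumes "w \<in> W" obtains "is" where "w = word is" "set is \<subseteq> {1..CARD('n)}"
  using assms weyl_eq_words by auto

lemma weyl_comp: "u \<in> W \<Longrightarrow> w \<in> W \<Longrightarrow> u \<circ> w \<in> W"
  unfolding weyl_eq_words by (auto simp: word_append[symmetric] intro!: imageI)

lemma id_weyl: "id \<in> W" by (rule weyl_id)

lemma srefl_weyl: "i \<in> {1..CARD('n)} \<Longrightarrow> srefl i \<in> W"
  using weyl_step[OF id_weyl simple_root_in] by simp

lemma weyl_linear: "w \<in> W \<Longrightarrow> linear w"
  and weyl_inner: "w \<in> W \<Longrightarrow> w v \<bullet> w v' = v \<bullet> v'"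
  and weyl_root: "w \<in> W \<Longrightarrow> \<beta> \<in> R \<Longrightarrow> w \<beta> \<in> R"
  by (auto elim!: weyl_wordE simp: linear_word word_inner word_root)

lemma weyl_inverse:
  assumes "w \<in> W" obtains u where "u \<in> W" "u \<circ> w = id" "w \<circ> u = id"
proof -
  obtain js where js: "w = word js" "set js \<subseteq> {1..CARD('n)}" using assms by (rule weyl_wordE)
  show ?thesis
  proof (rule that[of "word (rev js)"])
    show "word (rev js) \<in> W" using js weyl_eq_words by auto
    show "word (rev js) \<circ> w = id" using js word_rev by auto
    show "w \<circ> word (rev js) = id" using js word_rev[of "rev js"] by auto
  qed
qed

text \<open>Elements of the group are linear, hence determined by their restrictions to the finite spanning set of roots.\<close>

lemma finite_weyl: "finite W"
proof (rule inj_on_finite)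
  show "inj_on (\<lambda>w. restrict w R) W"
  proof (rule inj_onI)
    fix u w assume uw: "u \<in> W" "w \<in> W" "restrict u R = restrict w R"
    have "u v = w v" for v
    proof (rule linear_eq_on[of u w v R])
      show "linear u" "linear w" using uw weyl_linear by auto
      show "v \<in> span R" by (simp add: span_roots)
      show "u x = w x" if "x \<in> R" for x using uw(3) that by (metis restrict_apply')
    qed
    then show "u = w" by blast
  qed
  show "(\<lambda>w. restrict w R) ` W \<subseteq> R \<rightarrow>\<^sub>E R" using weyl_root by auto
  show "finite (R \<rightarrow>\<^sub>E R)" using finite_roots by (simp add: finite_PiE)
qed

lemma bij_left: assumes u: "u \<in> W" shows "bij_betw (\<lambda>w. u \<circ> w) W W"
proof -
  obtain u' where u': "u' \<in> W" "u' \<circ> u = id" "u \<circ> u' = id" using weyl_inverse[OF u] .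
  show ?thesis
    by (rule bij_betwI[where g = "\<lambda>w. u' \<circ> w"])
      (use u u' weyl_comp in \<open>auto simp: comp_assoc[symmetric]\<close>)
qed

lemma bij_right: assumes u: "u \<in> W" shows "bij_betw (\<lambda>w. w \<circ> u) W W"
proof -
  obtain u' where u': "u' \<in> W" "u' \<circ> u = id" "u \<circ> u' = id" using weyl_inverse[OF u] .
  show ?thesis
    by (rule bij_betwI[where g = "\<lambda>w. w \<circ> u'"])
      (use u u' weyl_comp in \<open>auto simp: comp_assoc\<close>)
qed

lemma sum_weyl_left: "u \<in> W \<Longrightarrow> (\<Sum>w\<in>W. f (u \<circ> w)) = (\<Sum>w\<in>W. f w)"
  using sum.reindex_bij_betw[OF bij_left] by blast

lemma sum_weyl_right: "u \<in> W \<Longrightarrow> (\<Sum>w\<in>W. f (w \<circ> u)) = (\<Sum>w\<in>W. f w)"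
  using sum.reindex_bij_betw[OF bij_right] by blast

subsection \<open>Weights\<close>

lemma cartan_int_diff: "cartan_int (v - a *\<^sub>R w) \<beta> = cartan_int v \<beta> - a * cartan_int w \<beta>"
  by (simp add: cartan_int_def inner_diff_left diff_divide_distrib right_diff_distrib)

lemma cartan_int_add: "cartan_int (v + w) \<beta> = cartan_int v \<beta> + cartan_int w \<beta>"
  by (simp add: cartan_int_def inner_add_left add_divide_distrib distrib_left)

lemma integral_add: "integral v \<Longrightarrow> integral w \<Longrightarrow> integral (v + w)"
  by (auto simp: integral_def cartan_int_add)

lemma integral_zero: "integral 0" by (simp add: integral_def cartan_int_def)

lemma integral_minus: "integral v \<Longrightarrow> integral (- v)"
  using cartan_int_diff[of 0 1 v] by (auto simp: integral_def cartan_int_def)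

lemma integral_sum: "(\<And>i. i \<in> A \<Longrightarrow> integral (f i)) \<Longrightarrow> integral (sum f A)"
  by (induction A rule: infinite_finite_induct) (auto simp: integral_zero integral_add)

lemma integral_root: "\<beta> \<in> R \<Longrightarrow> integral \<beta>"
  by (simp add: integral_def cartan_int_Ints simple_root_in)

lemma integral_omega: "i \<in> {1..CARD('n)} \<Longrightarrow> integral (omega i)"
  by (simp add: integral_def cartan_int_simple_weight)

lemma integral_srefl: "i \<in> {1..CARD('n)} \<Longrightarrow> integral v \<Longrightarrow> integral (srefl i v)"
  unfolding integral_def root_reflection_def cartan_int_diff
  using cartan_int_Ints simple_root_in by (metis Ints_diff Ints_mult)

lemma integral_weyl: assumes "w \<in> W" "integral v" shows "integral (w v)"
proof -
  obtain js where js: "w = word js" "set js \<subseteq> {1..CARD('n)}" using assms(1) by (rule weyl_wordE)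
  have "set js \<subseteq> {1..CARD('n)} \<Longrightarrow> integral (word js v)"
    by (induction js) (auto simp: assms(2) integral_srefl)
  then show ?thesis using js by blast
qed

text \<open>The pairing with the coroot of a reflected root is the pairing of the reflected weight with the original
  coroot; hence the statement for all weights at once passes along \<open>positive_root_induct\<close>.\<close>

lemma integral_all_roots:
  assumes v: "integral v" and b: "\<beta> \<in> R" shows "cartan_int v \<beta> \<in> \<int>"
proof -
  have pos: "\<beta> \<in> pos_roots \<Longrightarrow> \<forall>v. integral v \<longrightarrow> cartan_int v \<beta> \<in> \<int>" for \<beta>
  proof (induction rule: positive_root_induct)
    case (reflect i \<beta>)
    have "cartan_int v (srefl i \<beta>) = cartan_int (srefl i v) \<beta>" for v
      using reflection_inner[of "\<alpha> i" \<beta> \<beta>] reflection_adjoint[of "\<alpha> i" v \<beta>] by (simp add: cartan_int_def)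
    then show ?case using reflect integral_srefl by auto
  qed (auto simp: integral_def)
  have "cartan_int v (- \<beta>) = - cartan_int v \<beta>" by (simp add: cartan_int_def)
  then show ?thesis using pos pos_or_neg[OF b] v minus_in_Ints_iff by metis
qed

lemma weight_lattice_eq: "weight_lattice R = {v. integral v}"
  unfolding weight_lattice_def using integral_all_roots integral_def simple_root_in by blast

subsection \<open>Dominance order\<close>

text \<open>The exchange condition. Applied from right to left, the word turns the positive root \<open>\<alpha> j\<close>
  into a negative one. The reflection \<open>srefl i\<close> at which the sign changes must meet the root
  \<open>\<alpha> i\<close>, so it is the conjugate of \<open>srefl j\<close> by the letters in between and the
  two cancel.\<close>

lemma exchange:
  assumes "set is \<subseteq> {1..CARD('n)}" and j: "j \<in> {1..CARD('n)}" and "- word is (\<alpha> j) \<in> pos_roots"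
  shows "\<exists>js. set js \<subseteq> {1..CARD('n)} \<and> word is \<circ> srefl j = word js \<and> length is = Suc (length js)"
  using assms(1,3)
proof (induction "is")
  case Nil
  then show ?case using not_pos_and_neg simple_root_pos[OF j] by auto
next
  case (Cons i "is")
  have i: "i \<in> {1..CARD('n)}" and is_sub: "set is \<subseteq> {1..CARD('n)}" using Cons.prems by auto
  show ?case
  proof (cases "- word is (\<alpha> j) \<in> pos_roots")
    case True
    then obtain js where "set js \<subseteq> {1..CARD('n)}" "word is \<circ> srefl j = word js"
        "length is = Suc (length js)" using Cons.IH is_sub by blast
    moreover from this have "word (i # is) \<circ> srefl j = word (i # js)"
      by (simp only: word.simps comp_assoc)
    ultimately show ?thesis using i
      by (intro exI[of _ "i # js"] conjI) (simp_all del: word.simps)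
  next
    case False
    have root: "word is (\<alpha> j) \<in> R" using word_root is_sub simple_root_in j by blast
    then have pos: "word is (\<alpha> j) \<in> pos_roots" using False neg_pos_root_iff by blast
    have eq: "word is (\<alpha> j) = \<alpha> i"
    proof (rule ccontr)
      assume "word is (\<alpha> j) \<noteq> \<alpha> i"
      then have "srefl i (word is (\<alpha> j)) \<in> pos_roots" using srefl_pos_root[OF i pos] by blast
      then show False using Cons.prems(2) not_pos_and_neg by auto
    qed
    have "word (i # is) (srefl j v) = word is v" for v
    proof -
      have "word is (srefl j v) = word is v - cartan_int v (\<alpha> j) *\<^sub>R \<alpha> i"
        by (simp add: root_reflection_def linear_diff[OF linear_word] linear_scale[OF linear_word] eq)
      also have "cartan_int v (\<alpha> j) = cartan_int (word is v) (\<alpha> i)"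
        by (simp add: cartan_int_def eq[symmetric] word_inner)
      finally have "word is (srefl j v) = srefl i (word is v)" by (simp add: root_reflection_def)
      then show ?thesis by (simp add: reflection_invol)
    qed
    then show ?thesis using is_sub by (intro exI[of _ "is"]) auto
  qed
qed

text \<open>Split off the last letter \<open>j\<close>. If the remaining word keeps \<open>\<alpha> j\<close> positive,
  the letter adds a nonnegative multiple of a positive root to the difference; otherwise \<open>exchange\<close>
  provides a shorter word for the same group element.\<close>

lemma dominant_word:
  assumes "dominant v" "set is \<subseteq> {1..CARD('n)}" shows "nonneg (v - word is v)"
  using assms(2)
proof (induction "length is" arbitrary: "is" rule: less_induct)
  case less
  show ?case
  proof (cases "is" rule: rev_cases)
    case Nil then show ?thesis by (simp add: nonneg_def)
  next
    case (snoc ks j)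
    have ks: "set ks \<subseteq> {1..CARD('n)}" and j: "j \<in> {1..CARD('n)}" using snoc less.prems by auto
    have root: "word ks (\<alpha> j) \<in> R" using word_root ks simple_root_in j by blast
    show ?thesis
    proof (cases "word ks (\<alpha> j) \<in> pos_roots")
      case True
      have "v - word is v = (v - word ks v) + cartan_int v (\<alpha> j) *\<^sub>R word ks (\<alpha> j)"
        by (simp add: snoc word_append root_reflection_def linear_diff[OF linear_word]
            linear_scale[OF linear_word])
      moreover have "cartan_int v (\<alpha> j) \<ge> 0"
        using assms(1) j by (auto simp: cartan_int_def dominant_def)
      moreover have "nonneg (v - word ks v)" using less.hyps[of ks] ks snoc by simp
      ultimately show ?thesis using pos_root_nonneg[OF True] by (simp only: nonneg_add nonneg_scale)
    next
      case False
      then obtain js where "set js \<subseteq> {1..CARD('n)}" "word ks \<circ> srefl j = word js"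
          "length ks = Suc (length js)" using exchange[OF ks j] neg_pos_root_iff[OF root] by blast
      then show ?thesis using less.hyps[of js] snoc by (simp add: word_append)
    qed
  qed
qed

lemma dominant_weyl: "dominant v \<Longrightarrow> w \<in> W \<Longrightarrow> nonneg (v - w v)"
  using dominant_word by (metis weyl_wordE)

definition rho :: "real ^ 'n" where "rho = (\<Sum>i=1..CARD('n). omega i)"

lemma rho_simple: "i \<in> {1..CARD('n)} \<Longrightarrow> rho \<bullet> \<alpha> i = (\<alpha> i \<bullet> \<alpha> i) / 2"
proof -
  assume i: "i \<in> {1..CARD('n)}"
  have "rho \<bullet> \<alpha> i = (\<Sum>j=1..CARD('n). if j = i then (\<alpha> i \<bullet> \<alpha> i) / 2 else 0)"
    unfolding rho_def inner_sum_left by (intro sum.cong) (use i in \<open>auto simp: weight_simple\<close>)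
  then show ?thesis using i by simp
qed

lemma cartan_int_rho: "i \<in> {1..CARD('n)} \<Longrightarrow> cartan_int rho (\<alpha> i) = 1"
  using simple_norm_pos by (simp add: cartan_int_def rho_simple)

lemma integral_rho: "integral rho" by (simp add: integral_def cartan_int_rho)

text \<open>A simple reflection permutes the positive roots other than its own root, so both sides have the same inner
  products with the simple roots.\<close>

lemma sum_pos_roots: "(\<Sum>\<beta>\<in>pos_roots. \<beta>) = 2 *\<^sub>R rho"
proof (rule eq_if_inner_simple)
  fix i assume i: "i \<in> {1..CARD('n)}"
  define S where "S = (\<Sum>\<beta>\<in>pos_roots - {\<alpha> i}. \<beta>)"
  have S: "(\<Sum>\<beta>\<in>pos_roots. \<beta>) = \<alpha> i + S"
    unfolding S_def by (rule sum.remove) (use finite_pos_roots simple_root_pos[OF i] in auto)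
  have "srefl i S = (\<Sum>\<beta>\<in>pos_roots - {\<alpha> i}. srefl i \<beta>)"
    unfolding S_def by (simp add: linear_sum[OF linear_reflection])
  also have "\<dots> = S" unfolding S_def by (rule sum.reindex_bij_betw[OF bij_srefl_pos_roots[OF i]])
  finally have "srefl i S = S" .
  then have "cartan_int S (\<alpha> i) = 0" using simple_nonzero[OF i] by (simp add: root_reflection_def)
  then have "S \<bullet> \<alpha> i = 0" using simple_norm_pos[OF i] by (simp add: cartan_int_def)
  then show "(\<Sum>\<beta>\<in>pos_roots. \<beta>) \<bullet> \<alpha> i = (2 *\<^sub>R rho) \<bullet> \<alpha> i"
    by (simp add: S inner_add_left rho_simple[OF i])
qed

lemma rho_nonneg_pos: assumes "nonneg v" "v \<noteq> 0" shows "rho \<bullet> v > 0"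
proof -
  have "\<exists>i\<in>{1..CARD('n)}. v \<bullet> omega_check i \<noteq> 0"
    using assms(2) simple_expansion[of v] by (metis (no_types, lifting) scale_zero_left sum.neutral)
  then obtain i where i: "i \<in> {1..CARD('n)}" "v \<bullet> omega_check i \<noteq> 0" by blast
  show ?thesis unfolding inner_expansion[of rho v]
  proof (rule sum_pos2[OF _ i(1)])
    show "0 < rho \<bullet> \<alpha> i * (v \<bullet> omega_check i)"
      using i assms(1) simple_norm_pos[OF i(1)] by (simp add: rho_simple nonneg_def order_less_le)
    show "0 \<le> rho \<bullet> \<alpha> j * (v \<bullet> omega_check j)" if "j \<in> {1..CARD('n)}" for j
      using that assms(1) simple_norm_pos[OF that] by (simp add: rho_simple nonneg_def)
  qed simp
qed

lemma rho_pos_root: "\<beta> \<in> pos_roots \<Longrightarrow> rho \<bullet> \<beta> > 0"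
  using rho_nonneg_pos pos_root_nonneg pos_root_in roots_nonzero by blast

lemma dominant_omega: "i \<in> {1..CARD('n)} \<Longrightarrow> dominant (omega i)"
  by (auto simp: dominant_def weight_simple)

lemma dominant_weyl_strict:
  assumes "dominant v" "w \<in> W" "w v \<noteq> v" shows "rho \<bullet> w v < rho \<bullet> v"
  using rho_nonneg_pos[OF dominant_weyl[OF assms(1,2)]] assms(3) by (simp add: inner_diff_right)

text \<open>A point of the orbit that maximises the inner product with \<open>rho\<close> is dominant, since reflecting it
  in a simple root cannot increase that inner product.\<close>

lemma dominant_representative: obtains u where "u \<in> W" "dominant (u v)"
proof -
  obtain u where u: "u \<in> W" "\<And>w. w \<in> W \<Longrightarrow> rho \<bullet> w v \<le> rho \<bullet> u v"
  proof -
    have fin: "finite ((\<lambda>w. rho \<bullet> w v) ` W)" "(\<lambda>w. rho \<bullet> w v) ` W \<noteq> {}"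
      using finite_weyl id_weyl by auto
    obtain u where "u \<in> W" "rho \<bullet> u v = Max ((\<lambda>w. rho \<bullet> w v) ` W)"
      using Max_in[OF fin] by auto
    then show ?thesis using that Max_ge[OF fin(1)] by simp
  qed
  have "dominant (u v)" unfolding dominant_def
  proof
    fix i assume i: "i \<in> {1..CARD('n)}"
    have "rho \<bullet> (srefl i \<circ> u) v \<le> rho \<bullet> u v" using u weyl_comp[OF srefl_weyl[OF i] u(1)] by blast
    then have "cartan_int (u v) (\<alpha> i) * (rho \<bullet> \<alpha> i) \<ge> 0"
      by (simp add: root_reflection_def inner_diff_right)
    then show "0 \<le> u v \<bullet> \<alpha> i" using simple_norm_pos[OF i]
      by (simp add: rho_simple[OF i] cartan_int_def zero_le_mult_iff zero_le_divide_iff)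
  qed
  then show ?thesis using that u(1) by blast
qed

text \<open>Integrality makes all Cartan integers of \<open>v\<close> at least \<open>1\<close>, so \<open>v - rho\<close>
  is dominant; its inner product with \<open>rho - v\<close> is then both nonnegative and minus a square.\<close>

lemma regular_below_rho:
  assumes "integral v" "dominant v" "\<And>i. i \<in> {1..CARD('n)} \<Longrightarrow> v \<bullet> \<alpha> i \<noteq> 0" "nonneg (rho - v)"
  shows "v = rho"
proof -
  have "dominant (v - rho)" unfolding dominant_def
  proof
    fix i assume i: "i \<in> {1..CARD('n)}"
    have "cartan_int v (\<alpha> i) > 0" using assms(2,3)[unfolded dominant_def] i simple_norm_pos[OF i]
      by (force simp: cartan_int_def)
    moreover have "cartan_int v (\<alpha> i) \<in> \<int>" using assms(1) i by (simp add: integral_def)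
    ultimately have "cartan_int v (\<alpha> i) \<ge> 1" by (auto elim!: Ints_cases)
    then show "0 \<le> (v - rho) \<bullet> \<alpha> i" using simple_norm_pos[OF i]
      by (simp add: cartan_int_def inner_diff_left rho_simple[OF i] field_simps)
  qed
  then have "(v - rho) \<bullet> (rho - v) \<ge> 0" using dominant_nonneg_inner assms(4) by blast
  then have "(v - rho) \<bullet> (v - rho) \<le> 0" by (simp add: inner_diff_right inner_diff_left)
  then show ?thesis by (metis eq_iff_diff_eq_0 inner_gt_zero_iff not_less)
qed

subsection \<open>The sign of a Weyl group element\<close>

text \<open>The parity of the number of positive roots that become negative, which is the determinant of \<open>w\<close>.\<close>

definition weyl_sign :: "(real ^ 'n \<Rightarrow> real ^ 'n) \<Rightarrow> complex" where
  "weyl_sign w = (\<Prod>\<beta>\<in>pos_roots. if w \<beta> \<in> pos_roots then 1 else - 1)"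

lemma weyl_sign_id: "weyl_sign id = 1" by (simp add: weyl_sign_def)

lemma weyl_sign_srefl:
  assumes w: "w \<in> W" and i: "i \<in> {1..CARD('n)}"
  shows "weyl_sign (w \<circ> srefl i) = - weyl_sign w"
proof -
  define c :: "real ^ 'n \<Rightarrow> complex" where "c \<beta> = (if w \<beta> \<in> pos_roots then 1 else - 1)" for \<beta>
  have wa: "w (\<alpha> i) \<in> R" using weyl_root w simple_root_in i by blast
  have "c (- \<alpha> i) = - c (\<alpha> i)"
    using neg_pos_root_iff[OF wa] by (simp add: c_def linear_neg[OF weyl_linear[OF w]])
  moreover have "(\<Prod>\<beta>\<in>pos_roots - {\<alpha> i}. c (srefl i \<beta>)) = (\<Prod>\<beta>\<in>pos_roots - {\<alpha> i}. c \<beta>)"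
    by (rule prod.reindex_bij_betw[OF bij_srefl_pos_roots[OF i]])
  ultimately have "(\<Prod>\<beta>\<in>pos_roots. c (srefl i \<beta>)) = - (\<Prod>\<beta>\<in>pos_roots. c \<beta>)"
    using finite_pos_roots simple_root_pos[OF i] srefl_simple[OF i]
    by (simp add: prod.remove[of pos_roots "\<alpha> i"])
  then show ?thesis by (simp add: weyl_sign_def c_def)
qed

subsection \<open>Rationality of weights\<close>

lemma srefl_weyl_sum:
  assumes i: "i \<in> {1..CARD('n)}" shows "(\<Sum>w\<in>W. w v) \<bullet> \<alpha> i = 0"
proof -
  have "srefl i (\<Sum>w\<in>W. w v) = (\<Sum>w\<in>W. (srefl i \<circ> w) v)"
    by (simp add: linear_sum[OF linear_reflection])
  also have "\<dots> = (\<Sum>w\<in>W. w v)" by (rule sum_weyl_left[OF srefl_weyl[OF i]])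
  finally have "cartan_int (\<Sum>w\<in>W. w v) (\<alpha> i) = 0"
    using simple_nonzero[OF i] by (simp add: root_reflection_def)
  then show ?thesis using simple_norm_pos[OF i] by (simp add: cartan_int_def)
qed

text \<open>Subtracting from a weight its images under the group gives elements of the root lattice, and the sum of all
  images is fixed by every reflection, hence zero. So \<open>card W\<close> times the weight is in the root
  lattice.\<close>

lemma weight_coeff_rational:
  assumes v: "integral v" and j: "j \<in> {1..CARD('n)}" shows "v \<bullet> omega_check j \<in> \<rat>"
proof -
  have "(v - word is v) \<bullet> omega_check j \<in> \<int>" if "set is \<subseteq> {1..CARD('n)}" for "is"
    using that
  proof (induction "is")
    case (Cons i "is")
    have i: "i \<in> {1..CARD('n)}" using Cons.prems by auto
    have "word is v \<in> (\<lambda>w. w v) ` W" using Cons.prems weyl_eq_words by auto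
    then have "cartan_int (word is v) (\<alpha> i) \<in> \<int>" using integral_weyl v i unfolding integral_def by auto
    then have "cartan_int (word is v) (\<alpha> i) * (\<alpha> i \<bullet> omega_check j) \<in> \<int>"
      using i j simple_coweight by auto
    moreover have "(v - word (i # is) v) \<bullet> omega_check j
        = (v - word is v) \<bullet> omega_check j + cartan_int (word is v) (\<alpha> i) * (\<alpha> i \<bullet> omega_check j)"
      by (simp add: root_reflection_def inner_diff_left)
    ultimately show ?case using Cons by simp
  qed simp
  then have "(v - w v) \<bullet> omega_check j \<in> \<int>" if "w \<in> W" for w using that by (metis weyl_wordE)
  then have "(\<Sum>w\<in>W. (v - w v) \<bullet> omega_check j) \<in> \<int>" by (rule Ints_sum)
  moreover have "(\<Sum>w\<in>W. w v) = 0" using eq_zero_if_orthogonal srefl_weyl_sum by blast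
  then have "(\<Sum>w\<in>W. (v - w v) \<bullet> omega_check j) = card W * (v \<bullet> omega_check j)"
    by (simp add: inner_diff_left sum_subtractf inner_sum_left[symmetric])
  ultimately have "real (card W) * (v \<bullet> omega_check j) \<in> \<rat>" using Ints_subset_Rats by auto
  moreover have "real (card W) \<noteq> 0" using finite_weyl id_weyl by auto
  ultimately have "real (card W) * (v \<bullet> omega_check j) / real (card W) \<in> \<rat>" by (intro Rats_divide) auto
  then show ?thesis using \<open>real (card W) \<noteq> 0\<close> by simp
qed

end

section \<open>Exponential sums\<close>

text \<open>The sets of functions below that are closed under the ring operations are also closed under forming
  determinants and cofactors of matrices.\<close>

definition function_ring :: "('a \<Rightarrow> complex) set \<Rightarrow> bool" where
  "function_ring Q \<longleftrightarrow> (\<forall>c. (\<lambda>x. c) \<in> Q) \<and>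
     (\<forall>f\<in>Q. \<forall>g\<in>Q. (\<lambda>x. f x + g x) \<in> Q \<and> (\<lambda>x. f x * g x) \<in> Q)"

lemma function_ring_const: "function_ring Q \<Longrightarrow> (\<lambda>x. c) \<in> Q"
  and function_ring_add: "function_ring Q \<Longrightarrow> f \<in> Q \<Longrightarrow> g \<in> Q \<Longrightarrow> (\<lambda>x. f x + g x) \<in> Q"
  and function_ring_mult: "function_ring Q \<Longrightarrow> f \<in> Q \<Longrightarrow> g \<in> Q \<Longrightarrow> (\<lambda>x. f x * g x) \<in> Q"
  unfolding function_ring_def by blast+

lemma function_ring_sum:
  assumes "function_ring Q" "\<And>i. i \<in> A \<Longrightarrow> f i \<in> Q"
  shows "(\<lambda>x. \<Sum>i\<in>A. f i x) \<in> Q"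
  using assms(2)
  by (induction A rule: infinite_finite_induct)
    (auto intro: function_ring_const[OF assms(1)] function_ring_add[OF assms(1)])

lemma function_ring_prod:
  assumes "function_ring Q" "\<And>i. i \<in> A \<Longrightarrow> f i \<in> Q"
  shows "(\<lambda>x. \<Prod>i\<in>A. f i x) \<in> Q"
  using assms(2)
  by (induction A rule: infinite_finite_induct)
    (auto intro: function_ring_const[OF assms(1)] function_ring_mult[OF assms(1)])

lemma function_ring_det:
  assumes Q: "function_ring Q"
    and f: "\<And>i j. i < n \<Longrightarrow> j < n \<Longrightarrow> (\<lambda>x. A x $$ (i, j)) \<in> Q"
    and A: "\<And>x. A x \<in> carrier_mat n n"
  shows "(\<lambda>x. Determinant.det (A x)) \<in> Q"
proof -
  have "(\<lambda>x. \<Sum>\<pi> | \<pi> permutes {0..<n}. signof \<pi> * (\<Prod>i=0..<n. A x $$ (i, \<pi> i))) \<in> Q"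
    by (intro function_ring_sum function_ring_mult function_ring_const function_ring_prod Q f)
      (auto dest: permutes_in_image)
  then show ?thesis using det_def'[OF A] by simp
qed

lemma cdot_add_left: "cdot (x + y) z = cdot x z + cdot y z"
  by (simp add: cdot_def distrib_right sum.distrib)

lemma cdot_add_right: "cdot z (x + y) = cdot z x + cdot z y"
  by (simp add: cdot_def distrib_left sum.distrib)

lemma cdot_scale_right: "cdot z (a *s x) = a * cdot z x"
  by (simp add: cdot_def sum_distrib_left mult_ac)

lemma cdot_scale_left: "cdot (a *s x) z = a * cdot x z"
  by (simp add: cdot_def sum_distrib_left mult_ac)

lemma cdot_commute: "cdot x y = cdot y x"
  by (simp add: cdot_def mult.commute)

lemma cvec_add: "cvec (v + w) = cvec v + cvec w"
  by (simp add: cvec_def Finite_Cartesian_Product.vec_eq_iff)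

lemma cvec_scale: "cvec (a *\<^sub>R v) = complex_of_real a *s cvec v"
  by (simp add: cvec_def Finite_Cartesian_Product.vec_eq_iff)

lemma cvec_0: "cvec 0 = 0"
  by (simp add: cvec_def Finite_Cartesian_Product.vec_eq_iff)

lemma cdot_cvec: "cdot (cvec v) (cvec w) = complex_of_real (v \<bullet> w)"
  by (simp add: cdot_def cvec_def inner_vec_def)

text \<open>The pairing of \<open>(\<mu>, \<nu>)\<close> with a point, which is the exponent of the exponentials
  \<open>\<mu>(x) + \<nu> x\<^sub>l\<^sub>+\<^sub>1\<close>.\<close>

definition ext_pair :: "(real ^ 'n) \<times> real \<Rightarrow> 'n ext \<Rightarrow> complex" where
  "ext_pair a p = cdot (cvec (fst a)) (fst p) + complex_of_real (snd a) * snd p"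

definition pexp :: "(real ^ 'n) \<times> real \<Rightarrow> 'n ext \<Rightarrow> complex" where
  "pexp a p = exp (ext_pair a p)"

definition ext_line :: "'n ext \<Rightarrow> 'n ext \<Rightarrow> complex \<Rightarrow> ('n::finite) ext" where
  "ext_line p v z = (fst p + z *s fst v, snd p + z * snd v)"

lemma ext_line_0: "ext_line p v 0 = p"
  by (simp add: ext_line_def)

lemma ext_pair_add: "ext_pair (a + b) p = ext_pair a p + ext_pair b p"
  by (simp add: ext_pair_def cvec_add cdot_add_left distrib_right)

lemma pexp_add: "pexp (a + b) p = pexp a p * pexp b p"
  by (simp add: pexp_def ext_pair_add exp_add)

lemma pexp_0: "pexp 0 p = 1"
  by (simp add: pexp_def ext_pair_def cvec_0 cdot_def)

lemma pexp_nonzero: "pexp a p \<noteq> 0"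
  by (simp add: pexp_def)

lemma ext_pair_line: "ext_pair a (ext_line p v z) = ext_pair a p + z * ext_pair a v"
  by (simp add: ext_pair_def ext_line_def cdot_add_right cdot_scale_right algebra_simps)

lemma continuous_cdot: "continuous_on UNIV (\<lambda>x. cdot c x)"
  unfolding cdot_def by (intro continuous_intros)

lemma continuous_ext_pair: "continuous_on UNIV (ext_pair a)"
proof -
  have "continuous_on UNIV (\<lambda>p :: 'a ext. cdot (cvec (fst a)) (fst p))"
    using continuous_on_compose2[OF continuous_cdot continuous_on_fst[OF continuous_on_id]] by auto
  then show ?thesis unfolding ext_pair_def by (intro continuous_intros)
qed

lemma continuous_ext_line: "continuous_on UNIV (ext_line p v)"
  unfolding ext_line_def vector_scalar_mult_def
  by (intro continuous_intros)

text \<open>\<open>dir_deriv\<close> is total and says nothing about differentiability; sums, products and quotients have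
  to be differentiated with the relation.\<close>

definition has_dir_deriv :: "('n::finite ext \<Rightarrow> complex) \<Rightarrow> complex \<Rightarrow> 'n ext \<Rightarrow> 'n ext \<Rightarrow> bool" where
  "has_dir_deriv f D v p \<longleftrightarrow> ((\<lambda>z. f (ext_line p v z)) has_field_derivative D) (at 0)"

lemma dir_deriv_eq: "has_dir_deriv f D v p \<Longrightarrow> dir_deriv v f p = D"
  unfolding has_dir_deriv_def dir_deriv_def ext_line_def by (rule DERIV_imp_deriv)

lemma has_dir_deriv_const: "has_dir_deriv (\<lambda>p. c) 0 v p"
  unfolding has_dir_deriv_def by simp

lemma has_dir_deriv_add:
  "has_dir_deriv f D v p \<Longrightarrow> has_dir_deriv g E v p \<Longrightarrow> has_dir_deriv (\<lambda>p. f p + g p) (D + E) v p"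
  unfolding has_dir_deriv_def by (rule DERIV_add)

lemma has_dir_deriv_mult:
  "has_dir_deriv f D v p \<Longrightarrow> has_dir_deriv g E v p
    \<Longrightarrow> has_dir_deriv (\<lambda>p. f p * g p) (D * g p + E * f p) v p"
  unfolding has_dir_deriv_def using DERIV_mult by (fastforce simp: ext_line_0)

lemma has_dir_deriv_divide:
  assumes "has_dir_deriv f D v p" "has_dir_deriv g E v p" "g p \<noteq> 0"
  shows "has_dir_deriv (\<lambda>p. f p / g p) ((D * g p - f p * E) / (g p * g p)) v p"
  using assms DERIV_divide[of "\<lambda>z. f (ext_line p v z)" D 0 UNIV "\<lambda>z. g (ext_line p v z)" E]
  unfolding has_dir_deriv_def by (simp add: ext_line_0)

lemma has_dir_deriv_sum:
  "(\<And>i. i \<in> A \<Longrightarrow> has_dir_deriv (f i) (D i) v p)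
    \<Longrightarrow> has_dir_deriv (\<lambda>p. \<Sum>i\<in>A. f i p) (\<Sum>i\<in>A. D i) v p"
  unfolding has_dir_deriv_def by (rule DERIV_sum) 

lemma has_dir_deriv_snd: "has_dir_deriv snd (snd v) v p"
  unfolding has_dir_deriv_def ext_line_def by (auto intro!: derivative_eq_intros)

lemma has_dir_deriv_pexp: "has_dir_deriv (pexp a) (ext_pair a v * pexp a p) v p"
  unfolding has_dir_deriv_def pexp_def ext_pair_line
  by (auto intro!: derivative_eq_intros simp: mult.commute)

text \<open>Needed for the vector field \<open>e\<close>, whose components are quotients of exponential sums only off the
  mirrors.\<close>

lemma has_dir_deriv_cong_open:
  assumes f: "has_dir_deriv f D v p" and U: "open U" "p \<in> U" and eq: "\<And>q. q \<in> U \<Longrightarrow> f q = g q"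
  shows "has_dir_deriv g D v p"
  unfolding has_dir_deriv_def
proof (rule has_field_derivative_transform_within_open)
  show "((\<lambda>z. f (ext_line p v z)) has_field_derivative D) (at 0)"
    using f by (simp add: has_dir_deriv_def)
  show "open (ext_line p v -` U)" by (rule open_vimage[OF U(1) continuous_ext_line])
qed (use U eq in \<open>auto simp: ext_line_0\<close>)

inductive_set exp_sums :: "((real ^ 'n) \<times> real) set \<Rightarrow> (('n::finite) ext \<Rightarrow> complex) set"
  for L :: "((real ^ 'n) \<times> real) set" where
  exp_sums_exp: "a \<in> L \<Longrightarrow> (\<lambda>p. c * pexp a p) \<in> exp_sums L"
| exp_sums_add: "f \<in> exp_sums L \<Longrightarrow> g \<in> exp_sums L \<Longrightarrow> (\<lambda>p. f p + g p) \<in> exp_sums L"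

definition exponent_monoid :: "((real ^ 'n) \<times> real) set \<Rightarrow> bool" where
  "exponent_monoid L \<longleftrightarrow> 0 \<in> L \<and> (\<forall>a\<in>L. \<forall>b\<in>L. a + b \<in> L)"

lemma exp_sums_const: "exponent_monoid L \<Longrightarrow> (\<lambda>p. c) \<in> exp_sums L"
  using exp_sums_exp[of 0 L c] by (simp add: pexp_0 exponent_monoid_def)

lemma exp_sums_mult:
  assumes L: "exponent_monoid L" and f: "f \<in> exp_sums L" and g: "g \<in> exp_sums L"
  shows "(\<lambda>p. f p * g p) \<in> exp_sums L"
  using f
proof (induction rule: exp_sums.induct)
  case (exp_sums_exp a c)
  show ?case using g
  proof (induction rule: exp_sums.induct)
    case (exp_sums_exp b d)
    have "(\<lambda>p. (c * d) * pexp (a + b) p) \<in> exp_sums L"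
      using L \<open>a \<in> L\<close> exp_sums_exp by (intro exp_sums.exp_sums_exp) (simp add: exponent_monoid_def)
    then show ?case by (simp add: pexp_add mult_ac)
  next
    case (exp_sums_add f g)
    show ?case using exp_sums.exp_sums_add[OF exp_sums_add.IH] by (simp add: distrib_left)
  qed
next
  case (exp_sums_add f1 f2)
  show ?case using exp_sums.exp_sums_add[OF exp_sums_add.IH] by (simp add: distrib_right)
qed

lemma function_ring_exp_sums: "exponent_monoid L \<Longrightarrow> function_ring (exp_sums L)"
  unfolding function_ring_def using exp_sums_const exp_sums_mult exp_sums_add by blast

lemma exp_sums_deriv_ex:
  assumes L: "exponent_monoid L" and f: "f \<in> exp_sums L"
  shows "\<exists>f'\<in>exp_sums L. \<forall>p. has_dir_deriv f (f' p) v p"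
  using f
proof (induction rule: exp_sums.induct)
  case (exp_sums_exp a c)
  have "has_dir_deriv (\<lambda>p. c * pexp a p) (0 * pexp a p + ext_pair a v * pexp a p * c) v p" for p
    by (intro has_dir_deriv_mult has_dir_deriv_const has_dir_deriv_pexp)
  then show ?case using exp_sums.exp_sums_exp[OF exp_sums_exp, of "ext_pair a v * c"]
    by (intro bexI[of _ "\<lambda>p. ext_pair a v * c * pexp a p"]) (auto simp: mult_ac)
next
  case (exp_sums_add f g)
  then obtain f' g' where "f' \<in> exp_sums L" "\<forall>p. has_dir_deriv f (f' p) v p"
      "g' \<in> exp_sums L" "\<forall>p. has_dir_deriv g (g' p) v p" by blast
  then show ?case
    by (intro bexI[of _ "\<lambda>p. f' p + g' p"]) (auto intro: has_dir_deriv_add exp_sums.exp_sums_add)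
qed

lemma exp_sums_has_deriv:
  assumes L: "exponent_monoid L" and f: "f \<in> exp_sums L"
  shows "has_dir_deriv f (dir_deriv v f p) v p"
  using exp_sums_deriv_ex[OF L f, of v] dir_deriv_eq by metis

lemma exp_sums_deriv:
  assumes L: "exponent_monoid L" and f: "f \<in> exp_sums L"
  shows "dir_deriv v f \<in> exp_sums L"
proof -
  obtain f' where f': "f' \<in> exp_sums L" "\<forall>p. has_dir_deriv f (f' p) v p"
    using exp_sums_deriv_ex[OF L f] by blast
  then have "dir_deriv v f = f'" using dir_deriv_eq by blast
  then show ?thesis using f' by simp
qed

lemma dir_deriv_exp: "dir_deriv v (\<lambda>p. c * pexp a p) = (\<lambda>p. c * ext_pair a v * pexp a p)"
proof
  fix p
  have "has_dir_deriv (\<lambda>p. c * pexp a p) (0 * pexp a p + ext_pair a v * pexp a p * c) v p"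
    by (intro has_dir_deriv_mult has_dir_deriv_const has_dir_deriv_pexp)
  then show "dir_deriv v (\<lambda>p. c * pexp a p) p = c * ext_pair a v * pexp a p"
    by (simp add: dir_deriv_eq mult_ac)
qed

lemma exp_sums_dir_deriv_add:
  assumes L: "exponent_monoid L" and f: "f \<in> exp_sums L" and g: "g \<in> exp_sums L"
  shows "dir_deriv v (\<lambda>p. f p + g p) = (\<lambda>p. dir_deriv v f p + dir_deriv v g p)"
  by (rule ext) (intro dir_deriv_eq has_dir_deriv_add exp_sums_has_deriv[OF L] f g)

lemma dir_deriv_commute:
  assumes L: "exponent_monoid L" and f: "f \<in> exp_sums L"
  shows "dir_deriv v (dir_deriv w f) = dir_deriv w (dir_deriv v f)"
  using f
proof (induction rule: exp_sums.induct)
  case (exp_sums_exp a c)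
  show ?case by (simp only: dir_deriv_exp) (simp add: mult_ac)
next
  case (exp_sums_add f g)
  then show ?case by (simp add: exp_sums_dir_deriv_add[OF L] exp_sums_deriv[OF L])
qed

lemma exp_sums_continuous: "f \<in> exp_sums L \<Longrightarrow> continuous_on UNIV f"
proof (induction rule: exp_sums.induct)
  case (exp_sums_exp a c)
  show ?case unfolding pexp_def by (intro continuous_intros continuous_ext_pair)
qed (intro continuous_intros)

lemma exp_sums_representation:
  assumes "f \<in> exp_sums L"
  obtains S c where "finite S" "S \<subseteq> L" "\<And>a. a \<in> S \<Longrightarrow> c a \<noteq> 0"
    "\<And>p. f p = (\<Sum>a\<in>S. c a * pexp a p)"
proof -
  have "\<exists>S c. finite S \<and> S \<subseteq> L \<and> (\<forall>p. f p = (\<Sum>a\<in>S. c a * pexp a p))"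
    using assms
  proof (induction rule: exp_sums.induct)
    case (exp_sums_exp a c)
    then show ?case by (intro exI[of _ "{a}"] exI[of _ "\<lambda>_. c"]) simp
  next
    case (exp_sums_add f g)
    obtain S c where S: "finite S" "S \<subseteq> L" "\<forall>p. f p = (\<Sum>a\<in>S. c a * pexp a p)"
      using exp_sums_add.IH(1) by blast
    obtain T d where T: "finite T" "T \<subseteq> L" "\<forall>p. g p = (\<Sum>a\<in>T. d a * pexp a p)"
      using exp_sums_add.IH(2) by blast
    define h where "h a = (if a \<in> S then c a else 0) + (if a \<in> T then d a else 0)" for a
    have "f p + g p = (\<Sum>a\<in>S \<union> T. h a * pexp a p)" for p
    proof -
      have "f p = (\<Sum>a\<in>S \<union> T. (if a \<in> S then c a else 0) * pexp a p)"
        unfolding S(3)[rule_format] using S(1,2) T(1) by (auto intro!: sum.mono_neutral_cong_left)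
      moreover have "g p = (\<Sum>a\<in>S \<union> T. (if a \<in> T then d a else 0) * pexp a p)"
        unfolding T(3)[rule_format] using S(1) T(1,2) by (auto intro!: sum.mono_neutral_cong_left)
      ultimately show ?thesis by (simp add: h_def distrib_right sum.distrib)
    qed
    then show ?case using S T by (intro exI[of _ "S \<union> T"] exI[of _ h]) auto
  qed
  then obtain S c where S: "finite S" "S \<subseteq> L" "\<forall>p. f p = (\<Sum>a\<in>S. c a * pexp a p)" by blast
  show ?thesis
  proof (rule that[of "{a\<in>S. c a \<noteq> 0}" c])
    show "f p = (\<Sum>a\<in>{a\<in>S. c a \<noteq> 0}. c a * pexp a p)" for p
      unfolding S(3)[rule_format] using S(1) by (auto intro!: sum.mono_neutral_right)
  qed (use S in auto)
qed

subsection \<open>Invertible exponential sums\<close>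

text \<open>Finitely many hyperplanes do not cover the space, because they are null sets.\<close>

lemma generic_direction:
  fixes D :: "'a :: euclidean_space set"
  assumes "finite D" "0 \<notin> D"
  obtains v where "\<And>a. a \<in> D \<Longrightarrow> v \<bullet> a \<noteq> 0"
proof -
  have "negligible (\<Union>a\<in>D. {v. a \<bullet> v = 0})"
  proof (rule negligible_Union)
    fix N assume "N \<in> (\<lambda>a. {v. a \<bullet> v = 0}) ` D"
    then obtain a where "a \<in> D" "N = {v. a \<bullet> v = 0}" by blast
    then show "negligible N" using negligible_hyperplane[of a 0] assms(2) by metis
  qed (use assms in simp)
  then have "(\<Union>a\<in>D. {v. a \<bullet> v = 0}) \<noteq> UNIV" using non_negligible_UNIV by metis
  then obtain v where "v \<notin> (\<Union>a\<in>D. {v. a \<bullet> v = 0})" by blast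
  then show ?thesis using that[of v] by (auto simp: inner_commute)
qed

definition real_point :: "(real ^ 'n) \<times> real \<Rightarrow> ('n::finite) ext" where
  "real_point v = (cvec (fst v), complex_of_real (snd v))"

lemma pexp_real_point: "pexp a (real_point v) = exp (complex_of_real (v \<bullet> a))"
  by (simp add: pexp_def ext_pair_def real_point_def cdot_cvec inner_prod_def inner_commute mult.commute)

text \<open>Along a real ray on which the exponents in \<open>S\<close> take a unique maximum at \<open>m\<close>, the
  term of \<open>m\<close> dominates.\<close>

lemma leading_term:
  fixes S :: "((real ^ 'n) \<times> real) set"
  assumes S: "finite S" "m \<in> S" and m: "\<And>a. a \<in> S - {m} \<Longrightarrow> v \<bullet> a < v \<bullet> m"
  shows "((\<lambda>s. exp (complex_of_real (- s * (v \<bullet> m))) * (\<Sum>a\<in>S. c a * pexp a (real_point (s *\<^sub>R v))))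
    \<longlongrightarrow> c m) at_top"
proof -
  have "((\<lambda>s. \<Sum>a\<in>S. c a * complex_of_real (exp (- s * (v \<bullet> m - v \<bullet> a)))) \<longlongrightarrow>
      (\<Sum>a\<in>S. c a * complex_of_real (if a = m then 1 else 0))) at_top"
  proof (intro tendsto_sum tendsto_mult tendsto_const tendsto_of_real)
    fix a assume a: "a \<in> S"
    show "((\<lambda>s. exp (- s * (v \<bullet> m - v \<bullet> a))) \<longlongrightarrow> (if a = m then 1 else 0)) at_top"
    proof (cases "a = m")
      case False
      then have "v \<bullet> m - v \<bullet> a > 0" using m a by auto
      then show ?thesis using False by simp real_asymp
    qed simp
  qed
  also have "(\<Sum>a\<in>S. c a * complex_of_real (if a = m then 1 else 0)) = c m"
    using S by (simp add: if_distrib cong: if_cong)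
  also have "(\<lambda>s. \<Sum>a\<in>S. c a * complex_of_real (exp (- s * (v \<bullet> m - v \<bullet> a))))
    = (\<lambda>s. exp (complex_of_real (- s * (v \<bullet> m))) * (\<Sum>a\<in>S. c a * pexp a (real_point (s *\<^sub>R v))))"
  proof
    fix s
    have "exp (- s * (v \<bullet> m - v \<bullet> a)) = exp (- s * (v \<bullet> m)) * exp (s * (v \<bullet> a))" for a
      by (simp add: exp_add[symmetric] algebra_simps)
    then show "(\<Sum>a\<in>S. c a * complex_of_real (exp (- s * (v \<bullet> m - v \<bullet> a))))
      = exp (complex_of_real (- s * (v \<bullet> m))) * (\<Sum>a\<in>S. c a * pexp a (real_point (s *\<^sub>R v)))"
      unfolding sum_distrib_left pexp_real_point inner_scaleR_left exp_of_real
      by (intro sum.cong refl) (simp add: mult_ac)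
  qed
  finally show ?thesis .
qed

lemma exp_limit_zero_exponent:
  assumes lim: "((\<lambda>s. exp (complex_of_real (- s * K)) * C) \<longlongrightarrow> l) at_top" and "l \<noteq> 0" "C \<noteq> 0"
  shows "K = 0"
proof (rule ccontr)
  assume "K \<noteq> 0"
  then consider "K > 0" | "K < 0" by linarith
  then show False
  proof cases
    case 1
    then have "((\<lambda>s. exp (- s * K)) \<longlongrightarrow> 0) at_top" by real_asymp
    then have "((\<lambda>s. complex_of_real (exp (- s * K)) * C) \<longlongrightarrow> of_real 0 * C) at_top"
      by (intro tendsto_intros)
    then have "((\<lambda>s. exp (complex_of_real (- s * K)) * C) \<longlongrightarrow> 0) at_top"
      unfolding exp_of_real by simp
    then show False using tendsto_unique[OF _ _ lim] assms(2) by (metis trivial_limit_at_top_linorder)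
  next
    case 2
    then have "((\<lambda>s. exp (s * K)) \<longlongrightarrow> 0) at_top" by real_asymp
    then have "((\<lambda>s. complex_of_real (exp (s * K)) * (exp (complex_of_real (- s * K)) * C))
        \<longlongrightarrow> of_real 0 * l) at_top"
      by (intro tendsto_intros lim)
    moreover have "complex_of_real (exp (s * K)) * (exp (complex_of_real (- s * K)) * C) = C" for s
      by (simp add: exp_of_real[symmetric] exp_minus)
    ultimately have "((\<lambda>s::real. C) \<longlongrightarrow> of_real 0 * l) at_top" by (simp only:)
    then show False using assms(3) by (simp add: tendsto_const_iff)
  qed
qed

text \<open>Choose a real direction that separates all exponents of \<open>f\<close> and \<open>g\<close>. Leading terms
  multiply, so the maximal exponents of \<open>f\<close> and \<open>g\<close> in this direction add up to
  \<open>0\<close>. The same holds in the opposite direction, that is, for the minimal exponents. Hence maximum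
  and minimum coincide and \<open>f\<close> has one term only.\<close>

lemma exp_sums_unit:
  fixes f g :: "('n::finite) ext \<Rightarrow> complex"
  assumes f: "f \<in> exp_sums L" and g: "g \<in> exp_sums L" and fg: "\<And>p. f p * g p = C" and C: "C \<noteq> 0"
  obtains c a where "c \<noteq> 0" "a \<in> L" "f = (\<lambda>p. c * pexp a p)"
proof -
  obtain S c where S: "finite S" "S \<subseteq> L" "\<And>a. a \<in> S \<Longrightarrow> c a \<noteq> 0"
    "\<And>p. f p = (\<Sum>a\<in>S. c a * pexp a p)" using exp_sums_representation[OF f] by metis
  obtain T d where T: "finite T" "T \<subseteq> L" "\<And>a. a \<in> T \<Longrightarrow> d a \<noteq> 0"
    "\<And>p. g p = (\<Sum>a\<in>T. d a * pexp a p)" using exp_sums_representation[OF g] by metis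
  have "S \<noteq> {}" "T \<noteq> {}" using S(4) T(4) fg C by force+
  \<comment> \<open>a direction in which no two exponents agree\<close>
  obtain v :: "(real ^ 'n) \<times> real"
    where v: "\<And>a. a \<in> (\<lambda>(a, b). a - b) ` ((S \<union> T) \<times> (S \<union> T)) - {0} \<Longrightarrow> v \<bullet> a \<noteq> 0"
    by (rule generic_direction[of "(\<lambda>(a, b). a - b) ` ((S \<union> T) \<times> (S \<union> T)) - {0}"])
      (use S(1) T(1) in auto)
  have inj: "a = b" if "a \<in> S \<union> T" "b \<in> S \<union> T" "v \<bullet> a = v \<bullet> b" for a b
    using v[of "a - b"] that by (force simp: inner_diff_right)
  \<comment> \<open>leading terms multiply, hence the extremal exponents cancel\<close>
  have opposite: "Max ((\<lambda>a. x \<bullet> a) ` S) + Max ((\<lambda>a. x \<bullet> a) ` T) = 0" if x: "x = v \<or> x = - v" for x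
  proof -
    have xinj: "a = b" if "a \<in> S \<union> T" "b \<in> S \<union> T" "x \<bullet> a = x \<bullet> b" for a b
      using inj[of a b] that x by auto
    have mx: "\<exists>m\<in>U. Max ((\<lambda>a. x \<bullet> a) ` U) = x \<bullet> m \<and> (\<forall>a\<in>U - {m}. x \<bullet> a < x \<bullet> m)"
      if U: "U \<subseteq> S \<union> T" "finite U" "U \<noteq> {}" for U
    proof -
      have "Max ((\<lambda>a. x \<bullet> a) ` U) \<in> (\<lambda>a. x \<bullet> a) ` U" using U by (intro Max_in) auto
      then obtain m where m: "m \<in> U" "Max ((\<lambda>a. x \<bullet> a) ` U) = x \<bullet> m" by auto
      have "x \<bullet> a < x \<bullet> m" if a: "a \<in> U - {m}" for a
      proof -
        have "x \<bullet> a \<le> x \<bullet> m" using Max_ge[of "(\<lambda>a. x \<bullet> a) ` U" "x \<bullet> a"] U(2) a m(2) by simp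
        moreover have "x \<bullet> a \<noteq> x \<bullet> m" using xinj a m(1) U(1) by blast
        ultimately show ?thesis by simp
      qed
      then show ?thesis using m by blast
    qed
    obtain m where m: "m \<in> S" "Max ((\<lambda>a. x \<bullet> a) ` S) = x \<bullet> m" "\<And>a. a \<in> S - {m} \<Longrightarrow> x \<bullet> a < x \<bullet> m"
      using mx[of S] S(1) \<open>S \<noteq> {}\<close> by blast
    obtain n where n: "n \<in> T" "Max ((\<lambda>a. x \<bullet> a) ` T) = x \<bullet> n" "\<And>a. a \<in> T - {n} \<Longrightarrow> x \<bullet> a < x \<bullet> n"
      using mx[of T] T(1) \<open>T \<noteq> {}\<close> by blast
    have "((\<lambda>s. (exp (complex_of_real (- s * (x \<bullet> m))) * (\<Sum>a\<in>S. c a * pexp a (real_point (s *\<^sub>R x))))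
      * (exp (complex_of_real (- s * (x \<bullet> n))) * (\<Sum>a\<in>T. d a * pexp a (real_point (s *\<^sub>R x)))))
      \<longlongrightarrow> c m * d n) at_top"
      by (intro tendsto_mult leading_term S(1) T(1) m n) auto
    moreover have "(exp (complex_of_real (- s * (x \<bullet> m))) * (\<Sum>a\<in>S. c a * pexp a (real_point (s *\<^sub>R x))))
      * (exp (complex_of_real (- s * (x \<bullet> n))) * (\<Sum>a\<in>T. d a * pexp a (real_point (s *\<^sub>R x))))
      = exp (complex_of_real (- s * (x \<bullet> m + x \<bullet> n))) * C" for s
    proof -
      have "exp (complex_of_real (- s * (x \<bullet> m + x \<bullet> n)))
        = exp (complex_of_real (- s * (x \<bullet> m))) * exp (complex_of_real (- s * (x \<bullet> n)))"
        by (simp add: exp_add[symmetric] algebra_simps)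
      then show ?thesis using fg[of "real_point (s *\<^sub>R x)"] S(4) T(4) by (simp add: mult_ac)
    qed
    ultimately have "((\<lambda>s. exp (complex_of_real (- s * (x \<bullet> m + x \<bullet> n))) * C) \<longlongrightarrow> c m * d n) at_top"
      by simp
    then have "x \<bullet> m + x \<bullet> n = 0"
      by (rule exp_limit_zero_exponent) (use S(3) T(3) m n C in auto)
    then show ?thesis using m n by simp
  qed
  have bound: "x \<bullet> a + x \<bullet> b \<le> 0" if "x = v \<or> x = - v" "a \<in> S" "b \<in> T" for x a b
  proof -
    have "x \<bullet> a \<le> Max ((\<lambda>a. x \<bullet> a) ` S)" "x \<bullet> b \<le> Max ((\<lambda>a. x \<bullet> a) ` T)"
      using S(1) T(1) that by auto
    then show ?thesis using opposite[OF that(1)] by linarith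
  qed
  obtain b where b: "b \<in> T" using \<open>T \<noteq> {}\<close> by blast
  have "v \<bullet> a = - (v \<bullet> b)" if "a \<in> S" for a
    using bound[of v a b] bound[of "- v" a b] that b by simp
  then have single: "a = a'" if "a \<in> S" "a' \<in> S" for a a' using inj that by simp
  obtain a where a: "a \<in> S" using \<open>S \<noteq> {}\<close> by blast
  then have "S = {a}" using single by blast
  then have "f = (\<lambda>p. c a * pexp a p)" using S(4) by auto
  then show ?thesis using that a S by blast
qed

section \<open>The Weyl denominator\<close>

definition wexp :: "real ^ 'n \<Rightarrow> complex ^ 'n \<Rightarrow> complex" where
  "wexp v x = exp (cdot (cvec v) x)"

lemma wexp_add: "wexp (v + w) x = wexp v x * wexp w x"
  by (simp add: wexp_def cvec_add cdot_add_left exp_add)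

lemma wexp_0: "wexp 0 x = 1"
  by (simp add: wexp_def cvec_0 cdot_def)

lemma wexp_sum: "wexp (sum f A) x = (\<Prod>a\<in>A. wexp (f a) x)"
  by (induction A rule: infinite_finite_induct) (simp_all add: wexp_0 wexp_add)

lemma wexp_cvec: "wexp v (cvec w) = complex_of_real (exp (v \<bullet> w))"
  by (simp add: wexp_def cdot_cvec exp_of_real)

lemma cdot_diff_left: "cdot (x - y) z = cdot x z - cdot y z"
  using cdot_add_left[of x "(-1) *s y" z] cdot_scale_left[of "-1" y z] by simp

lemma cdot_diff_right: "cdot z (x - y) = cdot z x - cdot z y"
  by (simp add: cdot_commute[of z] cdot_diff_left)

lemma cvec_diff: "cvec (v - w) = cvec v - cvec w"
  by (simp add: cvec_def Finite_Cartesian_Product.vec_eq_iff)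

lemma cvec_minus: "cvec (- w) = - cvec w"
  by (simp add: cvec_def Finite_Cartesian_Product.vec_eq_iff)

lemma cdot_minus_left: "cdot (- x) z = - cdot x z"
  using cdot_diff_left[of 0 x z] by (simp add: cdot_def)

lemma exp_decay: "k > 0 \<Longrightarrow> ((\<lambda>s :: real. exp (- s * k)) \<longlongrightarrow> 0) at_top"
  by real_asymp

context based_root_system begin

text \<open>The complex bilinear extension of \<open>srefl i\<close>.\<close>

definition crefl :: "nat \<Rightarrow> complex ^ 'n \<Rightarrow> complex ^ 'n" where
  "crefl i x = x - (2 * cdot (cvec (\<alpha> i)) x / complex_of_real (\<alpha> i \<bullet> \<alpha> i)) *s cvec (\<alpha> i)"

lemma cdot_srefl: "cdot (cvec (srefl i v)) x = cdot (cvec v) (crefl i x)"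
  by (simp add: root_reflection_def cartan_int_def crefl_def cvec_diff cvec_scale cdot_diff_left
      cdot_diff_right cdot_scale_left cdot_scale_right cdot_cvec)

lemma wexp_srefl: "wexp (srefl i v) x = wexp v (crefl i x)"
  by (simp add: wexp_def cdot_srefl)

text \<open>A group element acting on the exponents amounts to a substitution in the argument that does not depend on the
  exponent; so an identity between exponential sums may be transformed by the group.\<close>

lemma weyl_point:
  assumes "w \<in> W" obtains g where "\<And>v x. wexp (w v) x = wexp v (g x)"
proof -
  obtain js where js: "w = word js" using assms by (rule weyl_wordE)
  have "\<exists>g. \<forall>v x. wexp (word js v) x = wexp v (g x)"
  proof (induction js)
    case Nil then show ?case by (intro exI[of _ id]) simp
  next
    case (Cons i js)
    then obtain g where "\<forall>v x. wexp (word js v) x = wexp v (g x)" by blast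
    then show ?case by (intro exI[of _ "\<lambda>x. g (crefl i x)"]) (simp add: wexp_srefl)
  qed
  then show ?thesis using that js by blast
qed

definition alternating_sum :: "real ^ 'n \<Rightarrow> complex ^ 'n \<Rightarrow> complex" where
  "alternating_sum v x = (\<Sum>w\<in>W. weyl_sign w * wexp (w v) x)"

lemma alternating_sum_srefl:
  assumes i: "i \<in> {1..CARD('n)}"
  shows "alternating_sum (srefl i v) x = - alternating_sum v x"
proof -
  have "alternating_sum v x = (\<Sum>w\<in>W. weyl_sign (w \<circ> srefl i) * wexp ((w \<circ> srefl i) v) x)"
    unfolding alternating_sum_def by (rule sum_weyl_right[OF srefl_weyl[OF i], symmetric])
  also have "\<dots> = - alternating_sum (srefl i v) x"
    unfolding alternating_sum_def sum_negf[symmetric]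
    by (intro sum.cong refl) (simp add: weyl_sign_srefl[OF _ i])
  finally show ?thesis by simp
qed

lemma alternating_sum_weyl:
  assumes "w \<in> W" obtains c where "\<And>x. alternating_sum (w v) x = c * alternating_sum v x"
proof -
  obtain js where js: "w = word js" "set js \<subseteq> {1..CARD('n)}" using assms by (rule weyl_wordE)
  have "set js \<subseteq> {1..CARD('n)} \<Longrightarrow> \<exists>c. \<forall>x. alternating_sum (word js v) x = c * alternating_sum v x"
  proof (induction js)
    case Nil then show ?case by (intro exI[of _ 1]) simp
  next
    case (Cons i js)
    then obtain c where "\<forall>x. alternating_sum (word js v) x = c * alternating_sum v x" by auto
    then show ?case using Cons.prems by (intro exI[of _ "- c"]) (simp add: alternating_sum_srefl)
  qed
  then show ?thesis using that js by blast
qed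

text \<open>The dominant representative of \<open>v\<close> either lies on the wall of a simple root, and then the
  alternating sum equals its negative, or it is \<open>rho\<close> by \<open>regular_below_rho\<close>.\<close>

lemma alternating_sum_below_rho:
  assumes v: "integral v" and below: "\<And>w. w \<in> W \<Longrightarrow> nonneg (rho - w v)"
  shows "\<exists>c. \<forall>x. alternating_sum v x = c * alternating_sum rho x"
proof -
  obtain u where u: "u \<in> W" "dominant (u v)" by (rule dominant_representative)
  obtain u' where u': "u' \<in> W" "u' \<circ> u = id" using weyl_inverse[OF u(1)] by blast
  obtain c where c: "\<And>x. alternating_sum (u' (u v)) x = c * alternating_sum (u v) x"
    using alternating_sum_weyl[OF u'(1)] by metis
  have "u' (u v) = v" using u'(2) by (metis comp_apply id_apply)
  then have vc: "alternating_sum v x = c * alternating_sum (u v) x" for x using c by simp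
  show ?thesis
  proof (cases "\<exists>i\<in>{1..CARD('n)}. u v \<bullet> \<alpha> i = 0")
    case True
    then obtain i where i: "i \<in> {1..CARD('n)}" "u v \<bullet> \<alpha> i = 0" by blast
    then have "srefl i (u v) = u v" by (simp add: root_reflection_def cartan_int_def)
    then have "alternating_sum (u v) x = 0" for x
      using alternating_sum_srefl[OF i(1), of "u v" x] by simp
    then show ?thesis using vc by auto
  next
    case False
    then have "u v = rho"
      using regular_below_rho[of "u v"] u v integral_weyl below by blast
    then show ?thesis using vc by auto
  qed
qed

lemma weyl_sign_square: "weyl_sign w * weyl_sign w = 1"
  unfolding weyl_sign_def prod.distrib[symmetric] by (intro prod.neutral) auto

text \<open>Antisymmetry allows replacing \<open>F\<close> by the signed average of its transforms, which turns each term
  into an alternating sum; by \<open>alternating_sum_below_rho\<close> these are all proportional to that of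
  \<open>rho\<close>.\<close>

lemma antisymmetric_multiple:
  fixes c :: "'i \<Rightarrow> complex" and \<mu> :: "'i \<Rightarrow> real ^ 'n"
  assumes F: "\<And>x. F x = (\<Sum>a\<in>I. c a * wexp (\<mu> a) x)"
    and anti: "\<And>i x. i \<in> {1..CARD('n)} \<Longrightarrow> F (crefl i x) = - F x"
    and int: "\<And>a. a \<in> I \<Longrightarrow> integral (\<mu> a)"
    and below: "\<And>a w. a \<in> I \<Longrightarrow> w \<in> W \<Longrightarrow> nonneg (rho - w (\<mu> a))"
  shows "\<exists>C. \<forall>x. F x = C * alternating_sum rho x"
proof -
  \<comment> \<open>transforming all exponents by \<open>w\<close> multiplies \<open>F\<close> by the sign of \<open>w\<close>\<close>
  have twist: "(\<Sum>a\<in>I. c a * wexp (w (\<mu> a)) x) = weyl_sign w * F x" if w: "w \<in> W" for w x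
  proof -
    obtain js where js: "w = word js" "set js \<subseteq> {1..CARD('n)}" using w by (rule weyl_wordE)
    have "set js \<subseteq> {1..CARD('n)} \<Longrightarrow>
        \<forall>x. (\<Sum>a\<in>I. c a * wexp (word js (\<mu> a)) x) = weyl_sign (word js) * F x"
    proof (induction js rule: rev_induct)
      case Nil then show ?case by (simp add: weyl_sign_id[unfolded id_def] F)
    next
      case (snoc i js)
      have i: "i \<in> {1..CARD('n)}" and js: "set js \<subseteq> {1..CARD('n)}" using snoc.prems by auto
      have jsW: "word js \<in> W" using js weyl_eq_words by auto
      obtain g where g: "\<And>v x. wexp (word js v) x = wexp v (g x)" using weyl_point[OF jsW] by blast
      have "(\<Sum>a\<in>I. c a * wexp (word (js @ [i]) (\<mu> a)) x) = weyl_sign (word (js @ [i])) * F x" for x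
      proof -
        have "(\<Sum>a\<in>I. c a * wexp (word (js @ [i]) (\<mu> a)) x) = F (crefl i (g x))"
          by (simp add: word_append g wexp_srefl F)
        also have "\<dots> = - (\<Sum>a\<in>I. c a * wexp (word js (\<mu> a)) x)" using anti[OF i] by (simp add: F g)
        also have "\<dots> = - (weyl_sign (word js) * F x)" using snoc.IH js by simp
        also have "\<dots> = weyl_sign (word js \<circ> srefl i) * F x" using weyl_sign_srefl[OF jsW i] by simp
        also have "word js \<circ> srefl i = word (js @ [i])" by (simp add: word_append)
        finally show ?thesis .
      qed
      then show ?case by blast
    qed
    then show ?thesis using js by blast
  qed
  have average: "of_nat (card W) * F x = (\<Sum>a\<in>I. c a * alternating_sum (\<mu> a) x)" for x
  proof -
    have "(\<Sum>a\<in>I. c a * alternating_sum (\<mu> a) x)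
        = (\<Sum>w\<in>W. weyl_sign w * (\<Sum>a\<in>I. c a * wexp (w (\<mu> a)) x))"
      unfolding alternating_sum_def sum_distrib_left
      by (subst sum.swap) (simp add: mult_ac)
    also have "\<dots> = (\<Sum>w\<in>W. F x)"
      by (intro sum.cong refl) (simp add: twist mult.assoc[symmetric] weyl_sign_square)
    finally show ?thesis by simp
  qed
  have "\<exists>d. \<forall>x. alternating_sum (\<mu> a) x = d * alternating_sum rho x" if "a \<in> I" for a
    by (rule alternating_sum_below_rho) (use int below that in auto)
  then obtain d where d: "\<And>a x. a \<in> I \<Longrightarrow> alternating_sum (\<mu> a) x = d a * alternating_sum rho x"
    by metis
  have W0: "of_nat (card W) \<noteq> (0 :: complex)" using finite_weyl id_weyl by auto
  have "of_nat (card W) * F x = (\<Sum>a\<in>I. c a * d a) * alternating_sum rho x" for x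
    unfolding average sum_distrib_right by (intro sum.cong refl) (simp add: d)
  then have "F x = (\<Sum>a\<in>I. c a * d a) / of_nat (card W) * alternating_sum rho x" for x
    using W0 by (simp add: field_simps)
  then show ?thesis by blast
qed

subsection \<open>The denominator as a product\<close>

definition denominator :: "complex ^ 'n \<Rightarrow> complex" where
  "denominator x = (\<Prod>\<beta>\<in>pos_roots. 2 * sinh (cdot (cvec \<beta>) x / 2))"

lemma sinh_wexp:
  "2 * sinh (cdot (cvec \<beta>) x / 2) = wexp ((1/2) *\<^sub>R \<beta>) x + - wexp (- (1/2) *\<^sub>R \<beta>) x"
proof -
  have h: "cdot (cvec ((1/2) *\<^sub>R \<beta>)) x = cdot (cvec \<beta>) x / 2"
    "cdot (cvec (- (1/2) *\<^sub>R \<beta>)) x = - (cdot (cvec \<beta>) x / 2)"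
    by (simp_all only: cvec_scale cdot_scale_left) simp_all
  show ?thesis unfolding wexp_def h by (simp add: sinh_def scaleR_conv_of_real)
qed

text \<open>Up to signs \<open>u\<close> permutes the positive roots.\<close>

lemma sum_abs_pos_roots:
  assumes u: "u \<in> W" and i: "i \<in> {1..CARD('n)}"
  shows "(\<Sum>\<beta>\<in>pos_roots. \<bar>u \<beta> \<bullet> omega_check i\<bar>) = 2 * (rho \<bullet> omega_check i)"
proof -
  \<comment> \<open>the positive one among \<open>u \<beta>\<close> and \<open>- u \<beta>\<close>\<close>
  define b where "b \<beta> = (if u \<beta> \<in> pos_roots then u \<beta> else - u \<beta>)" for \<beta>
  obtain u' where u': "u' \<in> W" "u' \<circ> u = id" using weyl_inverse[OF u] by blast
  have inv: "u' (u v) = v" for v using u'(2) by (metis comp_apply id_apply)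
  have b_pos: "b \<beta> \<in> pos_roots" if "\<beta> \<in> pos_roots" for \<beta>
    using that weyl_root[OF u pos_root_in[OF that]] neg_pos_root_iff by (auto simp: b_def)
  have "inj_on b pos_roots"
  proof (rule inj_onI)
    fix \<beta> \<gamma> assume bc: "\<beta> \<in> pos_roots" "\<gamma> \<in> pos_roots" "b \<beta> = b \<gamma>"
    then have "u \<beta> = u \<gamma> \<or> u \<beta> = u (- \<gamma>)"
      unfolding b_def linear_neg[OF weyl_linear[OF u]] by (metis minus_minus)
    then have "\<beta> = \<gamma> \<or> \<beta> = - \<gamma>" using inv by metis
    then show "\<beta> = \<gamma>" using bc not_pos_and_neg by auto
  qed
  then have bij: "bij_betw b pos_roots pos_roots"
    using finite_pos_roots b_pos by (simp add: bij_betw_def endo_inj_surj image_subsetI)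
  have "(\<Sum>\<beta>\<in>pos_roots. \<bar>u \<beta> \<bullet> omega_check i\<bar>) = (\<Sum>\<beta>\<in>pos_roots. b \<beta> \<bullet> omega_check i)"
  proof (intro sum.cong refl)
    fix \<beta> assume "\<beta> \<in> pos_roots"
    then have "b \<beta> \<bullet> omega_check i \<ge> 0" using b_pos pos_root_nonneg i by (auto simp: nonneg_def)
    then show "\<bar>u \<beta> \<bullet> omega_check i\<bar> = b \<beta> \<bullet> omega_check i" by (auto simp: b_def split: if_splits)
  qed
  also have "\<dots> = (\<Sum>\<beta>\<in>pos_roots. \<beta> \<bullet> omega_check i)"
    by (rule sum.reindex_bij_betw[OF bij])
  also have "\<dots> = 2 * (rho \<bullet> omega_check i)"
    by (simp add: inner_sum_left[symmetric] sum_pos_roots)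
  finally show ?thesis .
qed

text \<open>Expanding the product gives exponents \<open>\<mu> X\<close>, half the sum of the positive roots in
  \<open>X\<close> minus half the sum of the others. They are weights because they differ from
  \<open>rho\<close> by roots, and by \<open>sum_abs_pos_roots\<close> their transforms have coefficients at
  most those of \<open>rho\<close>.\<close>

lemma denominator_multiple: "\<exists>C. \<forall>x. denominator x = C * alternating_sum rho x"
proof (rule antisymmetric_multiple)
  define \<mu> where "\<mu> X = (1/2) *\<^sub>R (\<Sum>\<beta>\<in>X. \<beta>) - (1/2) *\<^sub>R (\<Sum>\<beta>\<in>pos_roots - X. \<beta>)" for X
  show "denominator x = (\<Sum>X\<in>Pow pos_roots. (- 1) ^ card (pos_roots - X) * wexp (\<mu> X) x)" for x
    unfolding denominator_def sinh_wexp prod_add[OF finite_pos_roots]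
  proof (intro sum.cong refl)
    fix X
    have "wexp (\<mu> X) x = (\<Prod>\<beta>\<in>X. wexp ((1/2) *\<^sub>R \<beta>) x) * (\<Prod>\<beta>\<in>pos_roots - X. wexp (- (1/2) *\<^sub>R \<beta>) x)"
      unfolding wexp_sum[symmetric] wexp_add[symmetric]
      by (simp add: \<mu>_def scaleR_sum_right sum_negf)
    then show "(\<Prod>\<beta>\<in>X. wexp ((1/2) *\<^sub>R \<beta>) x) * (\<Prod>\<beta>\<in>pos_roots - X. - wexp (- (1/2) *\<^sub>R \<beta>) x)
        = (- 1) ^ card (pos_roots - X) * wexp (\<mu> X) x"
      by (simp add: prod_uminus mult_ac)
  qed
  show "denominator (crefl i x) = - denominator x" if i: "i \<in> {1..CARD('n)}" for i x
  proof -
    define h where "h \<beta> = 2 * sinh (cdot (cvec \<beta>) x / 2)" for \<beta> :: "real ^ 'n"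
    have "denominator (crefl i x) = (\<Prod>\<beta>\<in>pos_roots. h (srefl i \<beta>))"
      by (simp add: denominator_def h_def cdot_srefl)
    also have "\<dots> = h (- \<alpha> i) * (\<Prod>\<beta>\<in>pos_roots - {\<alpha> i}. h (srefl i \<beta>))"
      using finite_pos_roots simple_root_pos[OF i] srefl_simple[OF i] by (simp add: prod.remove)
    also have "(\<Prod>\<beta>\<in>pos_roots - {\<alpha> i}. h (srefl i \<beta>)) = (\<Prod>\<beta>\<in>pos_roots - {\<alpha> i}. h \<beta>)"
      by (rule prod.reindex_bij_betw[OF bij_srefl_pos_roots[OF i]])
    also have "h (- \<alpha> i) = - h (\<alpha> i)" by (simp add: h_def cvec_minus cdot_minus_left)
    also have "- h (\<alpha> i) * (\<Prod>\<beta>\<in>pos_roots - {\<alpha> i}. h \<beta>) = - (\<Prod>\<beta>\<in>pos_roots. h \<beta>)"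
      using finite_pos_roots simple_root_pos[OF i] by (simp add: prod.remove)
    finally show ?thesis by (simp add: denominator_def h_def)
  qed
  have split: "(\<Sum>\<beta>\<in>X. \<beta>) + (\<Sum>\<beta>\<in>pos_roots - X. \<beta>) = 2 *\<^sub>R rho" if "X \<in> Pow pos_roots" for X
    using sum.subset_diff[of X pos_roots "\<lambda>\<beta>. \<beta>"] finite_pos_roots that sum_pos_roots
    by (simp add: add.commute)
  show "integral (\<mu> X)" if X: "X \<in> Pow pos_roots" for X
  proof -
    have "\<mu> X = (1/2) *\<^sub>R ((\<Sum>\<beta>\<in>X. \<beta>) + (\<Sum>\<beta>\<in>pos_roots - X. \<beta>)) + - (\<Sum>\<beta>\<in>pos_roots - X. \<beta>)"
      by (simp add: \<mu>_def scaleR_add_right scaleR_half_double[symmetric] algebra_simps del: scaleR_half_double)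
    also have "\<dots> = rho + - (\<Sum>\<beta>\<in>pos_roots - X. \<beta>)" using split[OF X] by simp
    finally show ?thesis
      by (simp only:) (intro integral_add integral_rho integral_minus integral_sum integral_root pos_root_in, simp)
  qed
  show "nonneg (rho - w (\<mu> X))" if X: "X \<in> Pow pos_roots" and w: "w \<in> W" for X w
    unfolding nonneg_def
  proof
    fix i assume i: "i \<in> {1..CARD('n)}"
    define f where "f \<beta> = w \<beta> \<bullet> omega_check i" for \<beta>
    have "2 * (w (\<mu> X) \<bullet> omega_check i) = (\<Sum>\<beta>\<in>X. f \<beta>) - (\<Sum>\<beta>\<in>pos_roots - X. f \<beta>)"
      by (simp add: \<mu>_def f_def linear_diff[OF weyl_linear[OF w]] linear_scale[OF weyl_linear[OF w]]
          linear_sum[OF weyl_linear[OF w]] inner_diff_left inner_sum_left)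
    also have "\<dots> \<le> (\<Sum>\<beta>\<in>X. \<bar>f \<beta>\<bar>) + (\<Sum>\<beta>\<in>pos_roots - X. \<bar>f \<beta>\<bar>)"
    proof -
      have "(\<Sum>\<beta>\<in>X. f \<beta>) \<le> (\<Sum>\<beta>\<in>X. \<bar>f \<beta>\<bar>)" by (intro sum_mono abs_ge_self)
      moreover have "(\<Sum>\<beta>\<in>pos_roots - X. - f \<beta>) \<le> (\<Sum>\<beta>\<in>pos_roots - X. \<bar>f \<beta>\<bar>)"
        by (intro sum_mono abs_ge_minus_self)
      ultimately show ?thesis by (simp add: sum_negf)
    qed
    also have "\<dots> = (\<Sum>\<beta>\<in>pos_roots. \<bar>f \<beta>\<bar>)"
      using sum.subset_diff[of X pos_roots "\<lambda>\<beta>. \<bar>f \<beta>\<bar>"] finite_pos_roots X by simp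
    also have "\<dots> = 2 * (rho \<bullet> omega_check i)" unfolding f_def by (rule sum_abs_pos_roots[OF w i])
    finally show "0 \<le> (rho - w (\<mu> X)) \<bullet> omega_check i" by (simp add: inner_diff_left)
  qed
qed

lemma denominator_rho_nonzero: "s \<noteq> 0 \<Longrightarrow> denominator (cvec (s *\<^sub>R rho)) \<noteq> 0"
proof -
  assume s: "s \<noteq> 0"
  have "2 * sinh (cdot (cvec \<beta>) (cvec (s *\<^sub>R rho)) / 2) \<noteq> 0" if "\<beta> \<in> pos_roots" for \<beta>
  proof -
    have "2 * sinh (cdot (cvec \<beta>) (cvec (s *\<^sub>R rho)) / 2)
        = complex_of_real (exp (((1/2) *\<^sub>R \<beta>) \<bullet> (s *\<^sub>R rho)) - exp ((- (1/2) *\<^sub>R \<beta>) \<bullet> (s *\<^sub>R rho)))"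
      unfolding sinh_wexp wexp_cvec by simp
    moreover have "((1/2) *\<^sub>R \<beta>) \<bullet> (s *\<^sub>R rho) \<noteq> (- (1/2) *\<^sub>R \<beta>) \<bullet> (s *\<^sub>R rho)"
      using rho_pos_root[OF that] s by (simp add: inner_commute)
    ultimately show ?thesis by (simp only: of_real_eq_0_iff) simp
  qed
  then show ?thesis unfolding denominator_def by (simp add: finite_pos_roots)
qed

subsection \<open>The Jacobian of the orbit sums\<close>

text \<open>The matrix of the derivatives of the orbit sums along the simple roots.\<close>

definition orbit_jacobian :: "complex ^ 'n \<Rightarrow> complex mat" where
  "orbit_jacobian x = Matrix.mat CARD('n) CARD('n) (\<lambda>(i, j).
     \<Sum>w\<in>W. complex_of_real (w (omega (i + 1)) \<bullet> \<alpha> (j + 1)) * wexp (w (omega (i + 1))) x)"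

lemma orbit_jacobian_carrier: "orbit_jacobian x \<in> carrier_mat CARD('n) CARD('n)"
  by (simp add: orbit_jacobian_def)

text \<open>The orbit sums are invariant, so reflecting the argument only transforms the directions of differentiation: it
  multiplies the matrix from the right by the matrix \<open>B\<close> of the reflection in the basis of simple
  roots. The only nonzero entry in column \<open>m\<close> of \<open>B\<close> is \<open>- 1\<close>, and the
  complementary minor is the identity.\<close>

lemma det_orbit_jacobian_anti:
  assumes m: "m \<in> {1..CARD('n)}"
  shows "Determinant.det (orbit_jacobian (crefl m x)) = - Determinant.det (orbit_jacobian x)"
proof -
  define B where "B = Matrix.mat CARD('n) CARD('n) (\<lambda>(r, j).
     of_bool (r = j) - complex_of_real (cartan_int (\<alpha> (j + 1)) (\<alpha> m)) * of_bool (r = m - 1))"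
  have B: "B \<in> carrier_mat CARD('n) CARD('n)" by (simp add: B_def)
  have m1: "m - 1 < CARD('n)" using m by auto
  have "orbit_jacobian (crefl m x) = orbit_jacobian x * B"
  proof (rule eq_matI)
    fix i j assume "i < dim_row (orbit_jacobian x * B)" "j < dim_col (orbit_jacobian x * B)"
    then have i: "i < CARD('n)" and j: "j < CARD('n)" by (auto simp: orbit_jacobian_def B_def)
    define S where "S = (\<lambda>r. \<Sum>w\<in>W. complex_of_real (w (omega (i + 1)) \<bullet> \<alpha> r) * wexp (w (omega (i + 1))) x)"
    have "orbit_jacobian (crefl m x) $$ (i, j)
        = (\<Sum>w\<in>W. complex_of_real (srefl m ((srefl m \<circ> w) (omega (i + 1))) \<bullet> \<alpha> (j + 1))
            * wexp ((srefl m \<circ> w) (omega (i + 1))) x)"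
      using i j by (simp add: orbit_jacobian_def wexp_srefl reflection_invol)
    also have "\<dots> = (\<Sum>w\<in>W. complex_of_real (srefl m (w (omega (i + 1))) \<bullet> \<alpha> (j + 1)) * wexp (w (omega (i + 1))) x)"
      by (rule sum_weyl_left[OF srefl_weyl[OF m]])
    also have "\<dots> = S (j + 1) - complex_of_real (cartan_int (\<alpha> (j + 1)) (\<alpha> m)) * S m"
      unfolding S_def sum_distrib_left sum_subtractf[symmetric] reflection_adjoint
      by (intro sum.cong refl) (simp add: root_reflection_def inner_diff_right algebra_simps)
    also have "\<dots> = (\<Sum>r<CARD('n). S (r + 1) * B $$ (r, j))"
    proof -
      have "(\<Sum>r<CARD('n). S (r + 1) * B $$ (r, j)) = (\<Sum>r<CARD('n). (if r = j then S (j + 1) else 0)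
          - complex_of_real (cartan_int (\<alpha> (j + 1)) (\<alpha> m)) * (if r = m - 1 then S m else 0))"
        by (intro sum.cong refl) (use j m in \<open>auto simp: B_def algebra_simps\<close>)
      then show ?thesis using j m1 by (simp add: sum_subtractf sum_distrib_left[symmetric])
    qed
    also have "\<dots> = (orbit_jacobian x * B) $$ (i, j)"
      using i j by (simp add: orbit_jacobian_def B_def S_def scalar_prod_def atLeast0LessThan)
    finally show "orbit_jacobian (crefl m x) $$ (i, j) = (orbit_jacobian x * B) $$ (i, j)" .
  qed (simp_all add: orbit_jacobian_def B_def)
  moreover have "Determinant.det B = - 1"
  proof -
    have col: "B $$ (r, m - 1) = (if r = m - 1 then - 1 else 0)" if "r < CARD('n)" for r
      using that m m1 simple_norm_pos[OF m] by (auto simp: B_def cartan_int_def)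
    have del: "mat_delete B (m - 1) (m - 1) = 1\<^sub>m (CARD('n) - 1)"
      by (rule eq_matI) (auto simp: B_def mat_delete_def)
    have "Determinant.det B = (\<Sum>r<CARD('n). B $$ (r, m - 1) * cofactor B r (m - 1))"
      by (rule laplace_expansion_column[OF B m1])
    also have "\<dots> = (\<Sum>r<CARD('n). if r = m - 1 then - cofactor B (m - 1) (m - 1) else 0)"
      by (intro sum.cong refl) (use col in auto)
    also have "\<dots> = - 1" using m1 del by (simp add: cofactor_def)
    finally show ?thesis .
  qed
  ultimately show ?thesis by (simp add: det_mult[OF orbit_jacobian_carrier B])
qed

text \<open>By multilinearity the determinant is a sum over a permutation and a choice of group elements \<open>w\<^sub>1,
  \<dots>, w\<^sub>l\<close>, with exponents \<open>\<Sum>\<^sub>i w\<^sub>i \<omega>\<^sub>i\<close>. These and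
  their transforms are below \<open>rho\<close>, the sum of the \<open>\<omega>\<^sub>i\<close>, because each
  \<open>\<omega>\<^sub>i\<close> is dominant.\<close>

lemma det_orbit_jacobian_multiple:
  "\<exists>C. \<forall>x. Determinant.det (orbit_jacobian x) = C * alternating_sum rho x"
proof (rule antisymmetric_multiple)
  define I where "I = {\<pi>. \<pi> permutes {0..<CARD('n)}} \<times> ({0..<CARD('n)} \<rightarrow>\<^sub>E W)"
  \<comment> \<open>an index consists of a permutation and a family of group elements\<close>
  define c where "c a = signof (fst a) * (\<Prod>i\<in>{0..<CARD('n)}.
      complex_of_real (snd a i (omega (i + 1)) \<bullet> \<alpha> (fst a i + 1)))"
    for a :: "(nat \<Rightarrow> nat) \<times> (nat \<Rightarrow> real ^ 'n \<Rightarrow> real ^ 'n)"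
  define \<mu> where "\<mu> a = (\<Sum>i\<in>{0..<CARD('n)}. snd a i (omega (i + 1)))"
    for a :: "(nat \<Rightarrow> nat) \<times> (nat \<Rightarrow> real ^ 'n \<Rightarrow> real ^ 'n)"
  show "Determinant.det (orbit_jacobian x) = (\<Sum>a\<in>I. c a * wexp (\<mu> a) x)" for x
  proof -
    have "Determinant.det (orbit_jacobian x) = (\<Sum>\<pi> | \<pi> permutes {0..<CARD('n)}. signof \<pi> *
        (\<Prod>i\<in>{0..<CARD('n)}. \<Sum>w\<in>W. complex_of_real (w (omega (i + 1)) \<bullet> \<alpha> (\<pi> i + 1)) * wexp (w (omega (i + 1))) x))"
      unfolding det_def'[OF orbit_jacobian_carrier]
      by (intro sum.cong refl arg_cong2[where f = "(*)"] prod.cong)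
        (auto simp: orbit_jacobian_def dest: permutes_in_image)
    also have "\<dots> = (\<Sum>\<pi> | \<pi> permutes {0..<CARD('n)}. \<Sum>g\<in>{0..<CARD('n)} \<rightarrow>\<^sub>E W.
        c (\<pi>, g) * wexp (\<mu> (\<pi>, g)) x)"
    proof (intro sum.cong refl)
      fix \<pi>
      have "(\<Prod>i\<in>{0..<CARD('n)}. \<Sum>w\<in>W. complex_of_real (w (omega (i + 1)) \<bullet> \<alpha> (\<pi> i + 1)) * wexp (w (omega (i + 1))) x)
        = (\<Sum>g\<in>{0..<CARD('n)} \<rightarrow>\<^sub>E W. \<Prod>i\<in>{0..<CARD('n)}.
            complex_of_real (g i (omega (i + 1)) \<bullet> \<alpha> (\<pi> i + 1)) * wexp (g i (omega (i + 1))) x)"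
        by (rule prod_sum_PiE) (simp_all add: finite_weyl)
      then show "signof \<pi> * (\<Prod>i\<in>{0..<CARD('n)}. \<Sum>w\<in>W. complex_of_real (w (omega (i + 1)) \<bullet> \<alpha> (\<pi> i + 1)) * wexp (w (omega (i + 1))) x)
        = (\<Sum>g\<in>{0..<CARD('n)} \<rightarrow>\<^sub>E W. c (\<pi>, g) * wexp (\<mu> (\<pi>, g)) x)"
        by (simp add: sum_distrib_left c_def \<mu>_def wexp_sum prod.distrib mult_ac)
    qed
    also have "\<dots> = (\<Sum>a\<in>I. c a * wexp (\<mu> a) x)"
      unfolding I_def by (simp add: sum.cartesian_product split_def)
    finally show ?thesis .
  qed
  show "integral (\<mu> a)" if "a \<in> I" for a
    unfolding \<mu>_def
  proof (rule integral_sum)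
    fix i assume "i \<in> {0..<CARD('n)}"
    then show "integral (snd a i (omega (i + 1)))"
      using that by (intro integral_weyl[of "snd a i"] integral_omega) (auto simp: I_def)
  qed
  show "nonneg (rho - w (\<mu> a))" if a: "a \<in> I" and w: "w \<in> W" for a w
  proof -
    have "rho = (\<Sum>i\<in>{0..<CARD('n)}. omega (i + 1))"
      unfolding rho_def using sum.shift_bounds_Suc_ivl[of omega 0 "CARD('n)"]
      by (simp add: atLeastLessThanSuc_atLeastAtMost)
    then have "rho - w (\<mu> a) = (\<Sum>i\<in>{0..<CARD('n)}. omega (i + 1) - (w \<circ> snd a i) (omega (i + 1)))"
      by (simp add: \<mu>_def linear_sum[OF weyl_linear[OF w]] sum_subtractf)
    moreover have "nonneg (omega (i + 1) - (w \<circ> snd a i) (omega (i + 1)))" if "i \<in> {0..<CARD('n)}" for i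
    proof (rule dominant_weyl)
      show "w \<circ> snd a i \<in> W" using a that by (intro weyl_comp w) (auto simp: I_def)
      show "dominant (omega (i + 1))" using that by (intro dominant_omega) auto
    qed
    ultimately show ?thesis by (simp only: nonneg_sum)
  qed
qed (rule det_orbit_jacobian_anti)

text \<open>Along the ray of \<open>rho\<close> the largest exponential in row \<open>i\<close> is the one of
  \<open>\<omega>\<^sub>i\<close>. Dividing the rows by these exponentials, the matrix tends to the diagonal
  matrix of the numbers \<open>(\<omega>\<^sub>i, \<alpha>\<^sub>i)\<close> times the orders of the stabilisers.\<close>

lemma det_orbit_jacobian_nonzero: "\<exists>x. Determinant.det (orbit_jacobian x) \<noteq> 0"
proof (rule ccontr)
  assume "\<not> ?thesis"
  then have zero: "Determinant.det (orbit_jacobian x) = 0" for x by blast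
  let ?o = "\<lambda>i. omega (i + 1)" and ?cf = "\<lambda>v j. complex_of_real (v \<bullet> \<alpha> (j + 1))"
  let ?det = "\<lambda>B. \<Sum>\<pi> | \<pi> permutes {0..<CARD('n)}. signof \<pi> * (\<Prod>i=0..<CARD('n). B i (\<pi> i))"
  define stab where "stab i = {w\<in>W. w (?o i) = ?o i}" for i
  define A where "A s i j = complex_of_real (exp (- s * (rho \<bullet> ?o i))) *
      (orbit_jacobian (cvec (s *\<^sub>R rho)) $$ (i, j))" for s i j
  define E where "E i j = of_nat (card (stab i)) * ?cf (?o i) j" for i j
  have lim: "((\<lambda>s. A s i j) \<longlongrightarrow> E i j) at_top" if i: "i < CARD('n)" and j: "j < CARD('n)" for i j
  proof -
    have io: "i + 1 \<in> {1..CARD('n)}" using i by auto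
    let ?gap = "\<lambda>w. rho \<bullet> ?o i - rho \<bullet> w (?o i)"
    have "((\<lambda>s. \<Sum>w\<in>W. ?cf (w (?o i)) j * complex_of_real (exp (- s * ?gap w)))
        \<longlongrightarrow> (\<Sum>w\<in>W. ?cf (w (?o i)) j * complex_of_real (of_bool (w \<in> stab i)))) at_top"
    proof (intro tendsto_sum tendsto_mult tendsto_const tendsto_of_real)
      fix w assume w: "w \<in> W"
      show "((\<lambda>s. exp (- s * ?gap w)) \<longlongrightarrow> of_bool (w \<in> stab i)) at_top"
      proof (cases "w \<in> stab i")
        case False
        then have "?gap w > 0"
          using dominant_weyl_strict[OF dominant_omega[OF io] w] w by (simp add: stab_def)
        then have "((\<lambda>s. exp (- s * ?gap w)) \<longlongrightarrow> 0) at_top" by (rule exp_decay)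
        then show ?thesis using False by simp
      qed (simp add: stab_def)
    qed
    moreover have "(\<Sum>w\<in>W. ?cf (w (?o i)) j * complex_of_real (of_bool (w \<in> stab i))) = (\<Sum>w\<in>stab i. ?cf (?o i) j)"
      using finite_weyl by (intro sum.mono_neutral_cong_right) (auto simp: stab_def)
    moreover have "(\<Sum>w\<in>W. ?cf (w (?o i)) j * complex_of_real (exp (- s * ?gap w))) = A s i j" for s
    proof -
      have "exp (- s * ?gap w) = exp (- s * (rho \<bullet> ?o i)) * exp (w (?o i) \<bullet> (s *\<^sub>R rho))" for w
        by (simp add: exp_add[symmetric] algebra_simps inner_commute)
      then show ?thesis
        using i j by (simp add: A_def orbit_jacobian_def wexp_cvec sum_distrib_left mult_ac)
    qed
    ultimately show ?thesis by (simp only: sum_constant E_def)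
  qed
  define Em where "Em = Matrix.mat CARD('n) CARD('n) (\<lambda>(i, j). E i j)"
  have Em: "Em \<in> carrier_mat CARD('n) CARD('n)" by (simp add: Em_def)
  have "((\<lambda>s. ?det (A s)) \<longlongrightarrow> ?det E) at_top"
    by (intro tendsto_sum tendsto_mult tendsto_const tendsto_prod lim) (auto dest: permutes_in_image)
  moreover have "?det E = Determinant.det Em"
    unfolding det_def'[OF Em]
    by (intro sum.cong refl arg_cong2[where f = "(*)"] prod.cong) (auto simp: Em_def dest: permutes_in_image)
  moreover have "?det (A s) = 0" for s
  proof -
    have "?det (A s) = (\<Prod>i=0..<CARD('n). complex_of_real (exp (- s * (rho \<bullet> ?o i)))) *
          Determinant.det (orbit_jacobian (cvec (s *\<^sub>R rho)))"
      unfolding det_def'[OF orbit_jacobian_carrier] sum_distrib_left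
      by (intro sum.cong refl) (simp add: A_def prod.distrib mult_ac)
    then show ?thesis by (simp add: zero)
  qed
  ultimately have "((\<lambda>s :: real. 0 :: complex) \<longlongrightarrow> Determinant.det Em) at_top" by (simp only:)
  then have "Determinant.det Em = 0" by (simp add: tendsto_const_iff)
  moreover have "Determinant.det Em = prod_list (diag_mat Em)"
    by (rule det_upper_triangular[OF _ Em])
      (auto simp: Em_def E_def upper_triangular_def weight_simple)
  moreover have "E i i \<noteq> 0" if "i < CARD('n)" for i
  proof -
    have io: "i + 1 \<in> {1..CARD('n)}" using that by auto
    have "stab i \<noteq> {}" "finite (stab i)" using id_weyl finite_weyl by (auto simp: stab_def)
    then show ?thesis using simple_norm_pos[OF io] io by (simp add: E_def weight_simple)
  qed
  ultimately show False by (auto simp: diag_mat_def Em_def prod_list_zero_iff)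
qed

theorem det_orbit_jacobian:
  obtains C where "C \<noteq> 0" "\<And>x. Determinant.det (orbit_jacobian x) = C * denominator x"
proof -
  obtain C where C: "\<And>x. Determinant.det (orbit_jacobian x) = C * alternating_sum rho x"
    using det_orbit_jacobian_multiple by blast
  obtain D where D: "\<And>x. denominator x = D * alternating_sum rho x"
    using denominator_multiple by blast
  have "C \<noteq> 0" using det_orbit_jacobian_nonzero C by auto
  moreover have "D \<noteq> 0" using denominator_rho_nonzero[of 1] D by auto
  ultimately show ?thesis using that[of "C / D"] C D by simp
qed

end

section \<open>Orbit sums and Chevalley's theorem\<close>

context based_root_system begin

text \<open>The pairing with the sum of the positive coroots. It is a natural number for dominant weights, but by
  \<open>height_coeff\<close> also twice the sum of the coefficients; so it witnesses that the dominance order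
  on dominant weights is well-founded.\<close>

definition height :: "real ^ 'n \<Rightarrow> real" where
  "height v = (\<Sum>\<beta>\<in>pos_roots. cartan_int v \<beta>)"

lemma height_add: "height (v + w) = height v + height w"
  by (simp add: height_def cartan_int_add sum.distrib)

lemma height_diff: "height (v - w) = height v - height w"
  using height_add[of "v - w" w] by simp

lemma cartan_int_scale: "cartan_int (a *\<^sub>R v) \<beta> = a * cartan_int v \<beta>"
  by (simp add: cartan_int_def)

lemma height_simple: assumes i: "i \<in> {1..CARD('n)}" shows "height (\<alpha> i) = 2"
proof -
  have "(\<Sum>\<beta>\<in>pos_roots - {\<alpha> i}. cartan_int (\<alpha> i) \<beta>)
      = (\<Sum>\<beta>\<in>pos_roots - {\<alpha> i}. cartan_int (\<alpha> i) (srefl i \<beta>))"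
    by (rule sum.reindex_bij_betw[OF bij_srefl_pos_roots[OF i], symmetric])
  also have "\<dots> = (\<Sum>\<beta>\<in>pos_roots - {\<alpha> i}. - cartan_int (\<alpha> i) \<beta>)"
    using srefl_simple[OF i]
    by (intro sum.cong refl)
      (simp add: cartan_int_def reflection_inner reflection_adjoint[of "\<alpha> i" "\<alpha> i", symmetric])
  finally have "(\<Sum>\<beta>\<in>pos_roots - {\<alpha> i}. cartan_int (\<alpha> i) \<beta>) = 0"
    by (simp add: sum_negf)
  moreover have "cartan_int (\<alpha> i) (\<alpha> i) = 2"
    using simple_nonzero[OF i] by (simp add: cartan_int_def)
  ultimately show ?thesis
    using finite_pos_roots simple_root_pos[OF i] by (simp add: height_def sum.remove)
qed

lemma height_coeff: "height v = 2 * (\<Sum>i=1..CARD('n). v \<bullet> omega_check i)"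
proof -
  have "height (\<Sum>i\<in>A. (v \<bullet> omega_check i) *\<^sub>R \<alpha> i) = (\<Sum>i\<in>A. 2 * (v \<bullet> omega_check i))"
    if "A \<subseteq> {1..CARD('n)}" "finite A" for A
    using that(2,1)
  proof (induction A)
    case (insert i A)
    have "height ((v \<bullet> omega_check i) *\<^sub>R \<alpha> i) = 2 * (v \<bullet> omega_check i)"
      using height_simple[of i] insert.prems
      by (simp add: height_def cartan_int_scale sum_distrib_left[symmetric])
    then show ?case using insert by (simp add: height_add)
  qed (simp add: height_def cartan_int_def)
  from this[of "{1..CARD('n)}"] show ?thesis
    using simple_expansion[of v] by (simp add: sum_distrib_left)
qed

lemma height_nonneg_pos: assumes "nonneg v" "v \<noteq> 0" shows "height v > 0"
proof -
  have "\<exists>i\<in>{1..CARD('n)}. v \<bullet> omega_check i \<noteq> 0"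
    using assms(2) simple_expansion[of v] by (metis (no_types, lifting) scale_zero_left sum.neutral)
  then obtain i where i: "i \<in> {1..CARD('n)}" "v \<bullet> omega_check i \<noteq> 0" by blast
  have "(\<Sum>i=1..CARD('n). v \<bullet> omega_check i) > 0"
    using i assms(1) by (intro sum_pos2[OF _ i(1)]) (auto simp: nonneg_def order_less_le)
  then show ?thesis by (simp add: height_coeff)
qed

lemma cartan_int_dominant: "dominant v \<Longrightarrow> \<beta> \<in> pos_roots \<Longrightarrow> cartan_int v \<beta> \<ge> 0"
  using dominant_nonneg_inner pos_root_nonneg by (simp add: cartan_int_def)

lemma height_dominant: assumes "integral v" "dominant v" shows "height v \<in> \<nat>"
proof -
  have "height v \<in> \<int>" unfolding height_def
    using assms(1) integral_all_roots pos_root_in by (intro Ints_sum) blast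
  moreover have "height v \<ge> 0" unfolding height_def
    using assms(2) cartan_int_dominant by (intro sum_nonneg) blast
  ultimately show ?thesis by (simp add: Nats_altdef2)
qed

lemma height_omega_pos: assumes i: "i \<in> {1..CARD('n)}" shows "height (omega i) > 0"
  unfolding height_def
proof (rule sum_pos2[OF finite_pos_roots simple_root_pos[OF i]])
  show "0 < cartan_int (omega i) (\<alpha> i)" using i by (simp add: cartan_int_simple_weight)
qed (use cartan_int_dominant dominant_omega[OF i] in blast)

definition weyl_sum :: "real ^ 'n \<Rightarrow> complex ^ 'n \<Rightarrow> complex" where
  "weyl_sum v x = (\<Sum>w\<in>W. wexp (w v) x)"

lemma weyl_sum_weyl: "u \<in> W \<Longrightarrow> weyl_sum (u v) = weyl_sum v"
  unfolding weyl_sum_def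
  by (rule ext) (subst (2) sum_weyl_right[of u, symmetric], simp_all)

text \<open>Substitute \<open>w \<circ> w'\<close> for \<open>w'\<close>. The factor \<open>b\<close> is \<open>1\<close>
  for products of orbit sums and the inner product for their gradients.\<close>

lemma twisted_product:
  "(\<Sum>w\<in>W. \<Sum>w'\<in>W. b (w v \<bullet> w' v') * wexp (w v) x * wexp (w' v') x)
    = (\<Sum>w'\<in>W. b (v \<bullet> w' v') * weyl_sum (v + w' v') x)"
proof -
  have "(\<Sum>w\<in>W. \<Sum>w'\<in>W. b (w v \<bullet> w' v') * wexp (w v) x * wexp (w' v') x)
      = (\<Sum>w\<in>W. \<Sum>w'\<in>W. b (w v \<bullet> (w \<circ> w') v') * wexp (w v) x * wexp ((w \<circ> w') v') x)"
    by (intro sum.cong refl sum_weyl_left[symmetric])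
  also have "\<dots> = (\<Sum>w\<in>W. \<Sum>w'\<in>W. b (v \<bullet> w' v') * wexp (w (v + w' v')) x)"
    by (intro sum.cong refl) (simp add: weyl_inner linear_add[OF weyl_linear] wexp_add)
  also have "\<dots> = (\<Sum>w'\<in>W. b (v \<bullet> w' v') * weyl_sum (v + w' v') x)"
    unfolding weyl_sum_def sum_distrib_left by (rule sum.swap)
  finally show ?thesis .
qed

lemma weyl_sum_mult: "weyl_sum v x * weyl_sum v' x = (\<Sum>w'\<in>W. weyl_sum (v + w' v') x)"
  using twisted_product[of "\<lambda>_. 1" v v' x] by (simp add: weyl_sum_def sum_product)

text \<open>Chevalley's theorem for exponential invariants. If \<open>v = \<mu> + omega i\<close> is dominant, the product
  of the orbit sums of \<open>\<mu>\<close> and \<open>omega i\<close> is the sum of those of \<open>\<mu> + w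
  (omega i)\<close> for all \<open>w\<close>. The dominant representative of such a vector is either
  \<open>v\<close> itself, as it is for the identity, or of smaller height; so the orbit sum of \<open>v\<close>
  is obtained by induction on the height.\<close>

lemma weyl_sum_in_ring:
  fixes Q :: "(complex ^ 'n \<Rightarrow> complex) set"
  assumes Q: "function_ring Q"
    and gen: "\<And>i. i \<in> {1..CARD('n)} \<Longrightarrow> weyl_sum (omega i) \<in> Q"
    and v: "integral v"
  shows "weyl_sum v \<in> Q"
proof -
  note const = function_ring_const[OF Q] and add = function_ring_add[OF Q]
    and mult = function_ring_mult[OF Q] and sum = function_ring_sum[OF Q]
  have dom: "weyl_sum v \<in> Q" if "integral v" "dominant v" for v
    using that
  proof (induction "nat \<lfloor>height v\<rfloor>" arbitrary: v rule: less_induct)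
    case less
    have smaller: "weyl_sum v' \<in> Q" if "integral v'" "dominant v'" "height v' < height v" for v'
    proof (rule less.hyps)
      show "nat \<lfloor>height v'\<rfloor> < nat \<lfloor>height v\<rfloor>"
        using that(3) height_dominant[OF that(1,2)] height_dominant[OF less.prems]
        by (auto elim!: Nats_cases)
    qed (use that in auto)
    show ?case
    proof (cases "v = 0")
      case True
      have "weyl_sum v = (\<lambda>x. of_nat (card W))"
        by (rule ext) (simp add: weyl_sum_def True linear_0[OF weyl_linear] wexp_0)
      then show ?thesis using const by simp
    next
      case False
      then obtain i where i: "i \<in> {1..CARD('n)}" "v \<bullet> \<alpha> i \<noteq> 0"
        using eq_zero_if_orthogonal by blast
      define \<mu> where "\<mu> = v - omega i"
      have \<mu>_int: "integral \<mu>"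
        unfolding \<mu>_def diff_conv_add_uminus
        by (intro integral_add integral_minus integral_omega i less.prems)
      have "cartan_int v (\<alpha> i) > 0"
        using i less.prems(2) simple_norm_pos[OF i(1)] by (force simp: cartan_int_def dominant_def)
      moreover have "cartan_int v (\<alpha> i) \<in> \<int>" using less.prems(1) i by (simp add: integral_def)
      ultimately have v1: "cartan_int v (\<alpha> i) \<ge> 1" by (auto elim!: Ints_cases)
      have \<mu>_dom: "dominant \<mu>" unfolding dominant_def
      proof
        fix j assume j: "j \<in> {1..CARD('n)}"
        show "0 \<le> \<mu> \<bullet> \<alpha> j"
        proof (cases "i = j")
          case True
          then show ?thesis using v1 simple_norm_pos[OF j] i
            by (simp add: \<mu>_def inner_diff_left weight_simple cartan_int_def field_simps)
        next
          case False
          then show ?thesis using less.prems(2) i j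
            by (simp add: \<mu>_def inner_diff_left weight_simple dominant_def)
        qed
      qed
      have \<mu>_Q: "weyl_sum \<mu> \<in> Q"
        using smaller \<mu>_int \<mu>_dom height_omega_pos[OF i(1)] by (simp add: \<mu>_def height_diff)
      \<comment> \<open>the terms of the product that agree with the orbit sum of \<open>v\<close>; the identity is one of them\<close>
      define A where "A = {w\<in>W. weyl_sum (\<mu> + w (omega i)) = weyl_sum v}"
      have rest: "weyl_sum (\<mu> + w (omega i)) \<in> Q" if w: "w \<in> W - A" for w
      proof -
        \<comment> \<open>each other term is the orbit sum of a dominant vector strictly below \<open>v\<close>\<close>
        define \<nu> where "\<nu> = \<mu> + w (omega i)"
        have \<nu>_int: "integral \<nu>"
          unfolding \<nu>_def using w i by (intro integral_add \<mu>_int integral_weyl[of w] integral_omega) auto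
        obtain u where u: "u \<in> W" "dominant (u \<nu>)" by (rule dominant_representative)
        have same: "weyl_sum (u \<nu>) = weyl_sum \<nu>" by (rule weyl_sum_weyl[OF u(1)])
        have "u \<nu> \<noteq> v" using w same by (auto simp: A_def \<nu>_def)
        have "v - u \<nu> = (\<mu> - u \<mu>) + (omega i - (u \<circ> w) (omega i))"
          by (simp add: \<nu>_def \<mu>_def linear_add[OF weyl_linear[OF u(1)]])
        moreover have "nonneg \<dots>"
          using w u i by (intro nonneg_add dominant_weyl \<mu>_dom dominant_omega weyl_comp) auto
        ultimately have "nonneg (v - u \<nu>)" by simp
        then have "height (v - u \<nu>) > 0" using \<open>u \<nu> \<noteq> v\<close> by (intro height_nonneg_pos) auto
        then have "weyl_sum (u \<nu>) \<in> Q"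
          using smaller[of "u \<nu>"] u integral_weyl[OF u(1) \<nu>_int] by (simp add: height_diff)
        then show ?thesis using same by (simp add: \<nu>_def)
      qed
      have A: "finite A" "A \<subseteq> W" "A \<noteq> {}"
        using finite_weyl id_weyl by (auto simp: A_def \<mu>_def)
      have eq: "weyl_sum \<mu> x * weyl_sum (omega i) x
          = of_nat (card A) * weyl_sum v x + (\<Sum>w\<in>W - A. weyl_sum (\<mu> + w (omega i)) x)" for x
      proof -
        have "(\<Sum>w\<in>A. weyl_sum (\<mu> + w (omega i)) x) = of_nat (card A) * weyl_sum v x"
          by (simp add: A_def)
        then show ?thesis
          unfolding weyl_sum_mult using sum.subset_diff[OF A(2) finite_weyl, of "\<lambda>w. weyl_sum (\<mu> + w (omega i)) x"]
          by simp
      qed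
      have "(\<lambda>x. inverse (of_nat (card A)) *
          (weyl_sum \<mu> x * weyl_sum (omega i) x + (- 1) * (\<Sum>w\<in>W - A. weyl_sum (\<mu> + w (omega i)) x))) \<in> Q"
        by (intro mult add const sum rest \<mu>_Q gen i)
      also have "(\<lambda>x. inverse (of_nat (card A)) *
          (weyl_sum \<mu> x * weyl_sum (omega i) x + (- 1) * (\<Sum>w\<in>W - A. weyl_sum (\<mu> + w (omega i)) x))) = weyl_sum v"
        unfolding eq using A by (simp add: fun_eq_iff)
      finally show ?thesis .
    qed
  qed
  obtain u where "u \<in> W" "dominant (u v)" by (rule dominant_representative)
  then show ?thesis using dom[of "u v"] integral_weyl v weyl_sum_weyl by metis
qed

subsection \<open>Exponents of units\<close>

text \<open>The exponents of the units.\<close>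

definition rational_exponents :: "((real ^ 'n) \<times> real) set" where
  "rational_exponents = {a. \<exists>N::nat. N > 0 \<and> real N *\<^sub>R fst a \<in> weight_lattice R \<and> real N * snd a \<in> \<int>}"

lemma integral_of_nat_scale: "integral v \<Longrightarrow> integral (real N *\<^sub>R v)"
  by (auto simp: integral_def cartan_int_scale)

lemma rational_exponents_monoid: "exponent_monoid rational_exponents"
  unfolding exponent_monoid_def
proof (intro conjI ballI)
  show "0 \<in> rational_exponents"
    by (auto simp: rational_exponents_def weight_lattice_eq integral_zero intro!: exI[of _ 1])
  fix a b assume "a \<in> rational_exponents" "b \<in> rational_exponents"
  then obtain N M :: nat where
    N: "N > 0" "integral (real N *\<^sub>R fst a)" "real N * snd a \<in> \<int>" and
    M: "M > 0" "integral (real M *\<^sub>R fst b)" "real M * snd b \<in> \<int>"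
    unfolding rational_exponents_def weight_lattice_eq by auto
  have "real (N * M) *\<^sub>R fst (a + b) = real M *\<^sub>R (real N *\<^sub>R fst a) + real N *\<^sub>R (real M *\<^sub>R fst b)"
    by (simp add: scaleR_add_right mult.commute)
  then have "integral (real (N * M) *\<^sub>R fst (a + b))"
    using N M by (simp only: integral_add integral_of_nat_scale)
  moreover have "real (N * M) * snd (a + b) = real M * (real N * snd a) + real N * (real M * snd b)"
    by (simp add: algebra_simps)
  then have "real (N * M) * snd (a + b) \<in> \<int>"
    using N M by (simp only: Ints_add Ints_mult Ints_of_nat)
  ultimately show "a + b \<in> rational_exponents"
    using N(1) M(1) unfolding rational_exponents_def weight_lattice_eq by (intro CollectI exI[of _ "N * M"]) auto
qed

lemma rational_exponentsI: assumes "integral v" "q \<in> \<rat>" shows "(v, q) \<in> rational_exponents"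
proof -
  obtain a b :: int where ab: "b > 0" "q = of_int a / of_int b" using Rats_cases'[OF assms(2)] by metis
  then have "real (nat b) * q = of_int a" by simp
  then show ?thesis using assms(1) ab(1) integral_of_nat_scale[OF assms(1), of "nat b"]
    unfolding rational_exponents_def weight_lattice_eq by (intro CollectI exI[of _ "nat b"]) auto
qed

lemma rational_exponents_half: assumes "(v, q) \<in> rational_exponents" shows "((1/2) *\<^sub>R v, q) \<in> rational_exponents"
proof -
  obtain N :: nat where N: "N > 0" "integral (real N *\<^sub>R v)" "real N * q \<in> \<int>"
    using assms unfolding rational_exponents_def weight_lattice_eq by auto
  then show ?thesis unfolding rational_exponents_def weight_lattice_eq
    by (intro CollectI exI[of _ "2 * N"]) (auto simp: mult.assoc)
qed

lemma trig_unit_pexp: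
  assumes c: "c \<noteq> 0" and a: "a \<in> rational_exponents" shows "trig_unit R (\<lambda>p. c * pexp a p)"
proof -
  obtain N :: nat where N: "N > 0" "real N *\<^sub>R fst a \<in> weight_lattice R" "real N * snd a \<in> \<int>"
    using a unfolding rational_exponents_def by blast
  obtain z :: int where z: "real N * snd a = of_int z" using N(3) by (auto elim: Ints_cases)
  have "complex_of_real (snd a) = of_int z / of_nat N"
    using z N(1) by (metis nonzero_mult_div_cancel_left of_nat_0_less_iff of_real_divide of_real_of_int_eq of_real_of_nat_eq less_numeral_extra(3))
  then have "ext_pair a p = (cdot (cvec (real N *\<^sub>R fst a)) (fst p) + of_int z * snd p) / of_nat N" for p
    using N(1) by (simp add: ext_pair_def cvec_scale cdot_scale_left field_simps)
  then show ?thesis using c N unfolding trig_unit_def pexp_def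
    by (intro exI[of _ c] exI[of _ "real N *\<^sub>R fst a"] exI[of _ z] exI[of _ N]) auto
qed

end

section \<open>The Jacobian of the orbit coordinates\<close>

lemma cdot_0_right: "cdot x 0 = 0"
  by (simp add: cdot_def)

lemma det_last_row:
  fixes A :: "complex mat"
  assumes A: "A \<in> carrier_mat (Suc n) (Suc n)"
    and row: "\<And>j. j < Suc n \<Longrightarrow> A $$ (n, j) = of_bool (j = n)"
  shows "Determinant.det A = Determinant.det (mat_delete A n n)"
proof -
  have "Determinant.det A = (\<Sum>j<Suc n. A $$ (n, j) * cofactor A n j)"
    by (rule laplace_expansion_row[OF A]) simp
  also have "\<dots> = (\<Sum>j<Suc n. if j = n then cofactor A n n else 0)"
    by (intro sum.cong refl) (use row in auto)
  finally show ?thesis by (simp add: cofactor_def)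
qed

lemma det_scale_rows:
  fixes A :: "complex mat"
  assumes A: "A \<in> carrier_mat n n"
  shows "Determinant.det (Matrix.mat n n (\<lambda>(i, j). r i * A $$ (i, j))) = (\<Prod>i<n. r i) * Determinant.det A"
proof -
  have B: "Matrix.mat n n (\<lambda>(i, j). r i * A $$ (i, j)) \<in> carrier_mat n n" by simp
  show ?thesis
    unfolding det_def'[OF A] det_def'[OF B] sum_distrib_left
  proof (intro sum.cong refl)
    fix \<pi> assume "\<pi> \<in> {\<pi>. \<pi> permutes {0..<n}}"
    then have "\<pi> i < n" if "i < n" for i using that permutes_in_image[of \<pi> "{0..<n}" i] by simp
    then have "(\<Prod>i=0..<n. Matrix.mat n n (\<lambda>(i, j). r i * A $$ (i, j)) $$ (i, \<pi> i))
        = (\<Prod>i<n. r i) * (\<Prod>i=0..<n. A $$ (i, \<pi> i))"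
      by (simp add: prod.distrib atLeast0LessThan)
    then show "signof \<pi> * (\<Prod>i=0..<n. Matrix.mat n n (\<lambda>(i, j). r i * A $$ (i, j)) $$ (i, \<pi> i))
        = (\<Prod>i<n. r i) * (signof \<pi> * (\<Prod>i=0..<n. A $$ (i, \<pi> i)))" by simp
  qed
qed

lemma inv_mat_eq:
  assumes A: "A \<in> carrier_mat n n" and B: "B \<in> carrier_mat n n" and AB: "A * B = 1\<^sub>m n"
  shows "inv_mat A = B"
proof -
  have BA: "B * A = 1\<^sub>m n" by (rule mat_mult_left_right_inverse[OF A B AB])
  have "A \<in> Units (ring_mat TYPE(complex) n ())"
    using A B AB BA unfolding Units_def ring_mat_def by auto
  then obtain C where C: "mat_inverse A = Some C"
    using mat_inverse(1)[OF A, where b = "()"] by (cases "mat_inverse A") auto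
  have "C * A = 1\<^sub>m n" "C \<in> carrier_mat n n" using mat_inverse(2)[OF A C] by auto
  then have "C = C * (A * B)" using AB by simp
  also have "\<dots> = B" using \<open>C * A = 1\<^sub>m n\<close> \<open>C \<in> carrier_mat n n\<close> A B
    by (simp add: assoc_mult_mat[symmetric])
  finally show ?thesis by (simp add: inv_mat_def C)
qed

lemma inv_mat_adj:
  assumes A: "A \<in> carrier_mat n n" and d: "Determinant.det A \<noteq> 0"
  shows "inv_mat A = (1 / Determinant.det A) \<cdot>\<^sub>m adj_mat A"
proof (rule inv_mat_eq[OF A])
  show "(1 / Determinant.det A) \<cdot>\<^sub>m adj_mat A \<in> carrier_mat n n" using adj_mat[OF A] by simp
  show "A * ((1 / Determinant.det A) \<cdot>\<^sub>m adj_mat A) = 1\<^sub>m n"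
    using adj_mat[OF A] A d by (simp add: mult_smult_distrib)
      (rule eq_matI, auto)
qed

lemma inv_mat_inverse:
  assumes A: "A \<in> carrier_mat n n" and d: "Determinant.det A \<noteq> 0"
  shows "inv_mat A \<in> carrier_mat n n" "A * inv_mat A = 1\<^sub>m n" "inv_mat A * A = 1\<^sub>m n"
proof -
  show c: "inv_mat A \<in> carrier_mat n n" using inv_mat_adj[OF A d] adj_mat[OF A] by simp
  show i: "A * inv_mat A = 1\<^sub>m n"
    unfolding inv_mat_adj[OF A d] using adj_mat[OF A] A d
    by (simp add: mult_smult_distrib) (rule eq_matI, auto)
  show "inv_mat A * A = 1\<^sub>m n" by (rule mat_mult_left_right_inverse[OF A c i])
qed

lemma inv_mat_cofactor:
  assumes A: "A \<in> carrier_mat n n" and d: "Determinant.det A \<noteq> 0" and "i < n" "j < n"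
  shows "inv_mat A $$ (i, j) = cofactor A j i / Determinant.det A"
  unfolding inv_mat_adj[OF A d] using assms by (simp add: adj_mat_def)

lemma sum_1_to: "(\<Sum>i=1..n. f i) = (\<Sum>i<n. f (Suc i))"
  by (simp add: sum.shift_bounds_Suc_ivl[symmetric] atLeastLessThanSuc_atLeastAtMost[symmetric] atLeast0LessThan[symmetric])

text \<open>Rationality of the norm of the marked root makes the numbers \<open>d\<^sub>i\<close> rational, and with them
  the exponents of the last coordinate.\<close>

locale dubrovin_zhang = based_root_system R \<alpha>
  for R :: "(real ^ 'n) set" and \<alpha> :: "nat \<Rightarrow> real ^ 'n" +
  fixes k :: nat
  assumes k: "k \<in> {1..CARD('n)}" and rational_norm: "\<alpha> k \<bullet> \<alpha> k \<in> \<rat>"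
begin

abbreviation d :: "nat \<Rightarrow> real" where "d \<equiv> dz_degree \<alpha> k"
abbreviation y :: "nat \<Rightarrow> 'n ext \<Rightarrow> complex" where "y \<equiv> dz_coord R \<alpha> k"
abbreviation E :: "('n ext \<Rightarrow> complex) set" where "E \<equiv> exp_sums rational_exponents"
abbreviation Y :: "'n ext \<Rightarrow> complex mat" where "Y \<equiv> jacobian \<alpha> (dz_coord R \<alpha> k)"
abbreviation regular :: "('n ext) set" where "regular \<equiv> dz_regular R \<alpha> k"
abbreviation D :: "nat \<Rightarrow> ('n ext \<Rightarrow> complex) \<Rightarrow> 'n ext \<Rightarrow> complex" where "D \<equiv> coord_deriv \<alpha>"

lemma E_ring: "function_ring E" by (rule function_ring_exp_sums[OF rational_exponents_monoid])
lemmas E_has_deriv = exp_sums_has_deriv[OF rational_exponents_monoid]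
lemmas E_deriv = exp_sums_deriv[OF rational_exponents_monoid]

lemma d_rational: assumes i: "i \<in> {1..CARD('n)}" shows "d i \<in> \<rat>"
proof -
  have "d i = (\<Sum>j=1..CARD('n). (omega k \<bullet> \<alpha> j) * (omega i \<bullet> omega_check j))"
    unfolding dz_degree_def by (subst inner_commute) (rule inner_expansion)
  also have "\<dots> = (\<Sum>j=1..CARD('n). if j = k then (\<alpha> k \<bullet> \<alpha> k) / 2 * (omega i \<bullet> omega_check k) else 0)"
    by (intro sum.cong refl) (use k in \<open>auto simp: weight_simple\<close>)
  also have "\<dots> = (\<alpha> k \<bullet> \<alpha> k) / 2 * (omega i \<bullet> omega_check k)" using k by simp
  also have "\<dots> \<in> \<rat>"
    using rational_norm weight_coeff_rational[OF integral_omega[OF i] k] by simp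
  finally show ?thesis .
qed

lemma d_pos: "d k > 0"
proof -
  have "omega k \<noteq> 0" using weight_simple[OF k k] simple_norm_pos[OF k] by auto
  then show ?thesis by (simp add: dz_degree_def)
qed

lemma pexp_wexp: "pexp (v, q) p = wexp v (fst p) * exp (complex_of_real q * snd p)"
  by (simp add: pexp_def wexp_def ext_pair_def exp_add)

lemma orbit_sum_eq: "orbit_sum R \<alpha> i = weyl_sum (omega i)"
  by (simp add: fun_eq_iff orbit_sum_def weyl_sum_def wexp_def)

lemma y_eq: "i \<in> {1..CARD('n)} \<Longrightarrow> y i = (\<lambda>p. exp (complex_of_real (d i) * snd p) * weyl_sum (omega i) (fst p))"
  by (auto simp: dz_coord_def orbit_sum_eq)

lemma y_last: "y (Suc CARD('n)) = snd"
  by (auto simp: dz_coord_def)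

lemma y_pexp: "i \<in> {1..CARD('n)} \<Longrightarrow> y i = (\<lambda>p. \<Sum>w\<in>W. pexp (w (omega i), d i) p)"
  by (auto simp: y_eq weyl_sum_def sum_distrib_left pexp_wexp mult.commute)

lemma orbit_exponent: "i \<in> {1..CARD('n)} \<Longrightarrow> w \<in> W \<Longrightarrow> (w (omega i), d i) \<in> rational_exponents"
  by (intro rational_exponentsI integral_weyl[of w] integral_omega d_rational)

lemma pexp_E: "a \<in> rational_exponents \<Longrightarrow> pexp a \<in> E"
  using exp_sums_exp[of a rational_exponents 1] by simp

lemma y_E: "i \<in> {1..CARD('n)} \<Longrightarrow> y i \<in> E"
  unfolding y_pexp by (intro function_ring_sum[OF E_ring] pexp_E orbit_exponent)

lemma D_y: assumes i: "i \<in> {1..CARD('n)}"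
  shows "dir_deriv v (y i) p = (\<Sum>w\<in>W. ext_pair (w (omega i), d i) v * pexp (w (omega i), d i) p)"
  unfolding y_pexp[OF i] by (intro dir_deriv_eq has_dir_deriv_sum has_dir_deriv_pexp)

lemma has_deriv_y: "i \<in> {1..Suc CARD('n)} \<Longrightarrow> has_dir_deriv (y i) (dir_deriv v (y i) p) v p"
  using E_has_deriv[OF y_E, of i v p] has_dir_deriv_snd[of v p] dir_deriv_eq[OF has_dir_deriv_snd[of v p]]
  by (cases "i = Suc CARD('n)") (auto simp: y_last)

lemma ext_pair_frame: "ext_pair a (ext_frame \<alpha> j)
    = complex_of_real (if j \<le> CARD('n) then fst a \<bullet> \<alpha> j else snd a)"
  by (cases "j \<le> CARD('n)") (simp_all add: ext_pair_def ext_frame_def cdot_cvec cdot_0_right)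

lemma D_snd: "D j snd p = of_bool (j = Suc CARD('n))" if "j \<in> {1..Suc CARD('n)}"
  using dir_deriv_eq[OF has_dir_deriv_snd[of "ext_frame \<alpha> j" p]] that by (auto simp: ext_frame_def)

lemma jacobian_carrier: "jacobian \<alpha> f p \<in> carrier_mat (Suc CARD('n)) (Suc CARD('n))"
  by (simp add: jacobian_def)

lemma jacobian_index: "i < Suc CARD('n) \<Longrightarrow> j < Suc CARD('n) \<Longrightarrow>
    jacobian \<alpha> f p $$ (i, j) = D (Suc j) (f (Suc i)) p"
  by (simp add: jacobian_def)

text \<open>The last row is a unit vector and each other row is an exponential of the last coordinate times a row of the
  Jacobian of the orbit sums.\<close>

lemma det_Y: obtains C where "C \<noteq> 0"
  "\<And>p. Determinant.det (Y p) = C * pexp (0, \<Sum>i<CARD('n). d (Suc i)) p * denominator (fst p)"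
proof -
  obtain C where C: "C \<noteq> 0" "\<And>x. Determinant.det (orbit_jacobian x) = C * denominator x"
    using det_orbit_jacobian by blast
  have "Determinant.det (Y p) = C * pexp (0, \<Sum>i<CARD('n). d (Suc i)) p * denominator (fst p)" for p
  proof -
    let ?S = "Matrix.mat CARD('n) CARD('n)
        (\<lambda>(i, j). exp (complex_of_real (d (Suc i)) * snd p) * orbit_jacobian (fst p) $$ (i, j))"
    have "Determinant.det (Y p) = Determinant.det (mat_delete (Y p) CARD('n) CARD('n))"
      by (rule det_last_row[OF jacobian_carrier]) (simp add: jacobian_index y_last D_snd)
    also have "mat_delete (Y p) CARD('n) CARD('n) = ?S"
    proof (rule eq_matI)
      fix i j assume "i < dim_row ?S" "j < dim_col ?S"
      then have ij: "i < CARD('n)" "j < CARD('n)" by auto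
      then have "mat_delete (Y p) CARD('n) CARD('n) $$ (i, j) = D (Suc j) (y (Suc i)) p"
        by (simp add: mat_delete_def jacobian_def)
      also have "\<dots> = ?S $$ (i, j)"
        using ij by (simp add: D_y ext_pair_frame orbit_jacobian_def pexp_wexp sum_distrib_left mult_ac)
      finally show "mat_delete (Y p) CARD('n) CARD('n) $$ (i, j) = ?S $$ (i, j)" .
    qed (simp_all add: mat_delete_def jacobian_def)
    also have "Determinant.det \<dots> = (\<Prod>i<CARD('n). exp (complex_of_real (d (Suc i)) * snd p)) * (C * denominator (fst p))"
      by (subst det_scale_rows[OF orbit_jacobian_carrier]) (simp add: C)
    also have "(\<Prod>i<CARD('n). exp (complex_of_real (d (Suc i)) * snd p)) = pexp (0, \<Sum>i<CARD('n). d (Suc i)) p"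
      by (simp add: pexp_wexp wexp_0 exp_sum[symmetric] sum_distrib_right)
    finally show ?thesis by simp
  qed
  then show ?thesis using that C by blast
qed

lemma regular_eq: "regular = {p. denominator (fst p) \<noteq> 0}"
proof -
  obtain C where "C \<noteq> 0"
    "\<And>p. Determinant.det (Y p) = C * pexp (0, \<Sum>i<CARD('n). d (Suc i)) p * denominator (fst p)"
    using det_Y by blast
  then show ?thesis by (simp add: dz_regular_def pexp_nonzero)
qed

lemma D_y_E: "i < Suc CARD('n) \<Longrightarrow> (\<lambda>p. Y p $$ (i, j)) \<in> E" if "j < Suc CARD('n)"
proof (cases "i = CARD('n)")
  case True
  then show ?thesis using that by (simp add: jacobian_index y_last D_snd function_ring_const[OF E_ring])
next
  case False
  assume "i < Suc CARD('n)"
  then show ?thesis using that False E_deriv[OF y_E[of "Suc i"]] by (simp add: jacobian_index)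
qed

lemma det_Y_E: "(\<lambda>p. Determinant.det (Y p)) \<in> E"
  by (rule function_ring_det[OF E_ring D_y_E jacobian_carrier])

lemma open_regular: "open regular"
proof -
  have "open ((\<lambda>p. Determinant.det (Y p)) -` (- {0}))"
    by (rule open_vimage[OF _ exp_sums_continuous[OF det_Y_E]]) auto
  then show ?thesis by (simp add: dz_regular_def vimage_def)
qed

text \<open>On the real line through a point in the direction of \<open>rho\<close> each factor of the denominator has at
  most one zero, since \<open>sinh z = 0\<close> forces \<open>Re z = 0\<close> and \<open>(rho, \<beta>)
  \<noteq> 0\<close>.\<close>

lemma regular_direction:
  fixes p :: "'n ext"
  shows "filterlim (\<lambda>s. (fst p + cvec (s *\<^sub>R rho), snd p)) (at p within regular) (at_right 0)"
proof -
  define \<gamma> where "\<gamma> = (\<lambda>s. (fst p + cvec (s *\<^sub>R rho), snd p))"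
  \<comment> \<open>the only parameters at which a factor of the denominator may vanish\<close>
  define B where "B = (\<lambda>\<beta>. - Re (cdot (cvec \<beta>) (fst p)) / (rho \<bullet> \<beta>)) ` pos_roots"
  have "finite (B - {0})" unfolding B_def using finite_pos_roots by simp
  then have "\<forall>\<^sub>F s in at 0. s \<notin> B - {0}"
    using finite_imp_closed open_Compl eventually_at_topological by (metis Compl_iff DiffE insertI1)
  then have "\<forall>\<^sub>F s in at_right 0. s \<notin> B - {0}"
    using eventually_at_split by blast
  moreover have "\<forall>\<^sub>F s in at_right (0::real). s > 0" by (rule eventually_at_right_less)
  ultimately have "\<forall>\<^sub>F s in at_right 0. \<gamma> s \<in> regular \<and> \<gamma> s \<noteq> p"
  proof eventually_elim
    case (elim s)
    have "2 * sinh (cdot (cvec \<beta>) (fst (\<gamma> s)) / 2) \<noteq> 0" if b: "\<beta> \<in> pos_roots" for \<beta>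
    proof
      assume "2 * sinh (cdot (cvec \<beta>) (fst (\<gamma> s)) / 2) = 0"
      then have "exp (cdot (cvec \<beta>) (fst (\<gamma> s)) / 2) = exp (- (cdot (cvec \<beta>) (fst (\<gamma> s)) / 2))"
        by (simp add: sinh_def scaleR_conv_of_real)
      then have "norm (exp (cdot (cvec \<beta>) (fst (\<gamma> s)) / 2)) = norm (exp (- (cdot (cvec \<beta>) (fst (\<gamma> s)) / 2)))"
        by simp
      then have "Re (cdot (cvec \<beta>) (fst (\<gamma> s))) = 0" by simp
      then have "Re (cdot (cvec \<beta>) (fst p)) + s * (rho \<bullet> \<beta>) = 0"
        by (simp add: \<gamma>_def cdot_add_right cdot_cvec inner_commute)
      then have "s = - Re (cdot (cvec \<beta>) (fst p)) / (rho \<bullet> \<beta>)"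
        using rho_pos_root[OF b] by (simp add: field_simps)
      then show False using elim b by (auto simp: B_def)
    qed
    then have "\<gamma> s \<in> regular" by (simp add: regular_eq denominator_def finite_pos_roots)
    moreover have "\<gamma> s \<noteq> p"
    proof
      assume "\<gamma> s = p"
      then have "cdot (cvec rho) (cvec (s *\<^sub>R rho)) = 0"
        by (cases p) (simp add: \<gamma>_def cdot_def)
      then have "s * (rho \<bullet> rho) = 0" by (simp add: cdot_cvec)
      moreover have "rho \<noteq> 0" using rho_simple[OF k] simple_norm_pos[OF k] by auto
      ultimately show False using elim by simp
    qed
    ultimately show ?case by blast
  qed
  moreover have "(\<gamma> \<longlongrightarrow> p) (at_right 0)"
  proof -
    have "continuous_on UNIV \<gamma>"
      unfolding \<gamma>_def cvec_def by (intro continuous_intros)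
    then have "(\<gamma> \<longlongrightarrow> \<gamma> 0) (at_right 0)"
      by (metis UNIV_I continuous_on_def filterlim_at_split filterlim_mono order_refl at_within_le_at tendsto_within_subset subset_UNIV)
    then show ?thesis by (simp add: \<gamma>_def cvec_0)
  qed
  ultimately show ?thesis unfolding \<gamma>_def[symmetric] by (simp add: filterlim_at)
qed

lemma regular_dense: "at p within regular \<noteq> bot"
proof
  assume "at p within regular = bot"
  then have "filtermap (\<lambda>s. (fst p + cvec (s *\<^sub>R rho), snd p)) (at_right (0::real)) \<le> bot"
    using regular_direction[of p] by (simp add: filterlim_def)
  then have "filtermap (\<lambda>s. (fst p + cvec (s *\<^sub>R rho), snd p)) (at_right (0::real)) = bot"
    by (rule bot.extremum_uniqueI)
  then show False by (simp add: filtermap_bot_iff)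
qed

lemma eq_on_regular:
  fixes f g :: "'n ext \<Rightarrow> complex"
  assumes "continuous_on UNIV f" "continuous_on UNIV g" "\<And>p. p \<in> regular \<Longrightarrow> f p = g p"
  shows "f p = g p"
proof (rule tendsto_unique[OF regular_dense])
  show "(f \<longlongrightarrow> f p) (at p within regular)"
    using assms(1) by (meson UNIV_I continuous_on_def subset_UNIV tendsto_within_subset)
  have "(g \<longlongrightarrow> g p) (at p within regular)"
    using assms(2) by (meson UNIV_I continuous_on_def subset_UNIV tendsto_within_subset)
  then show "(f \<longlongrightarrow> g p) (at p within regular)"
    by (rule Lim_transform_within[where d = 1]) (use assms(3) in auto)
qed

end

section \<open>The Saito metric in the orbit coordinates\<close>

lemma mat_mult_entry:
  assumes "A \<in> carrier_mat n m" "B \<in> carrier_mat m q" "i < n" "j < q"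
  shows "(A * B) $$ (i, j) = (\<Sum>r<m. A $$ (i, r) * B $$ (r, j))"
  using assms by (auto simp: scalar_prod_def atLeast0LessThan intro!: sum.cong)

lemma sum_swap4:
  "(\<Sum>r\<in>P. \<Sum>s\<in>Q. \<Sum>i\<in>A. \<Sum>j\<in>B. f r s i j) = (\<Sum>i\<in>A. \<Sum>j\<in>B. \<Sum>r\<in>P. \<Sum>s\<in>Q. (f r s i j :: complex))"
proof -
  have "(\<Sum>r\<in>P. \<Sum>s\<in>Q. \<Sum>i\<in>A. \<Sum>j\<in>B. f r s i j) = (\<Sum>r\<in>P. \<Sum>i\<in>A. \<Sum>s\<in>Q. \<Sum>j\<in>B. f r s i j)"
    by (rule sum.cong[OF refl], rule sum.swap)
  also have "\<dots> = (\<Sum>i\<in>A. \<Sum>r\<in>P. \<Sum>s\<in>Q. \<Sum>j\<in>B. f r s i j)" by (rule sum.swap)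
  also have "\<dots> = (\<Sum>i\<in>A. \<Sum>r\<in>P. \<Sum>j\<in>B. \<Sum>s\<in>Q. f r s i j)"
    by (rule sum.cong[OF refl], rule sum.cong[OF refl], rule sum.swap)
  also have "\<dots> = (\<Sum>i\<in>A. \<Sum>j\<in>B. \<Sum>r\<in>P. \<Sum>s\<in>Q. f r s i j)"
    by (rule sum.cong[OF refl], rule sum.swap)
  finally show ?thesis .
qed

lemma sum_rotate:
  "(\<Sum>i\<in>A. \<Sum>j\<in>B. \<Sum>k\<in>C. f i j k) = (\<Sum>j\<in>B. \<Sum>k\<in>C. \<Sum>i\<in>A. (f i j k :: complex))"
  by (rule trans[OF sum.swap], rule sum.cong[OF refl], rule sum.swap)

text \<open>The bookkeeping of indices in \<open>lie_derivative_pairing\<close>: \<open>v\<close> is a vector field with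
  derivatives \<open>V\<close>, \<open>F\<close> and \<open>H\<close> are the gradients of two functions and
  \<open>X\<close>, \<open>Z\<close> their second derivatives. The assumptions express that \<open>v\<close>
  maps both functions to constants.\<close>

lemma contracted_lie_derivative:
  fixes g V X Z :: "nat \<Rightarrow> nat \<Rightarrow> complex" and F H v :: "nat \<Rightarrow> complex"
  assumes F: "\<And>s. (\<Sum>a\<in>I. V s a * F a) = - (\<Sum>a\<in>I. v a * X a s)"
    and H: "\<And>s. (\<Sum>a\<in>I. V s a * H a) = - (\<Sum>a\<in>I. v a * Z a s)"
  shows "(\<Sum>i\<in>I. \<Sum>j\<in>I. F i * - (\<Sum>s\<in>I. g s j * V s i + g i s * V s j) * H j)
    = (\<Sum>a\<in>I. v a * (\<Sum>s\<in>I. \<Sum>b\<in>I. g s b * (X a s * H b + F s * Z a b)))"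
proof -
  have "(\<Sum>i\<in>I. \<Sum>j\<in>I. \<Sum>s\<in>I. g s j * H j * (V s i * F i)) = (\<Sum>s\<in>I. \<Sum>j\<in>I. g s j * H j * (\<Sum>i\<in>I. V s i * F i))"
    unfolding sum_distrib_left by (rule trans[OF sum_rotate sum.swap])
  also have "\<dots> = - (\<Sum>s\<in>I. \<Sum>b\<in>I. \<Sum>a\<in>I. v a * (g s b * (X a s * H b)))"
    unfolding F sum_negf[symmetric] by (intro sum.cong refl) (simp add: sum_distrib_left mult_ac)
  also have "\<dots> = - (\<Sum>a\<in>I. v a * (\<Sum>s\<in>I. \<Sum>b\<in>I. g s b * (X a s * H b)))"
    unfolding sum_distrib_left by (rule arg_cong[OF sum_rotate[symmetric]])
  finally have 1: "(\<Sum>i\<in>I. \<Sum>j\<in>I. \<Sum>s\<in>I. g s j * H j * (V s i * F i))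
      = - (\<Sum>a\<in>I. v a * (\<Sum>s\<in>I. \<Sum>b\<in>I. g s b * (X a s * H b)))" .
  have "(\<Sum>i\<in>I. \<Sum>j\<in>I. \<Sum>s\<in>I. g i s * F i * (V s j * H j)) = (\<Sum>i\<in>I. \<Sum>s\<in>I. g i s * F i * (\<Sum>j\<in>I. V s j * H j))"
    unfolding sum_distrib_left by (rule sum.cong[OF refl], rule sum.swap)
  also have "\<dots> = - (\<Sum>s\<in>I. \<Sum>b\<in>I. \<Sum>a\<in>I. v a * (g s b * (F s * Z a b)))"
    unfolding H sum_negf[symmetric] by (intro sum.cong refl) (simp add: sum_distrib_left mult_ac)
  also have "\<dots> = - (\<Sum>a\<in>I. v a * (\<Sum>s\<in>I. \<Sum>b\<in>I. g s b * (F s * Z a b)))"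
    unfolding sum_distrib_left by (rule arg_cong[OF sum_rotate[symmetric]])
  finally have 2: "(\<Sum>i\<in>I. \<Sum>j\<in>I. \<Sum>s\<in>I. g i s * F i * (V s j * H j))
      = - (\<Sum>a\<in>I. v a * (\<Sum>s\<in>I. \<Sum>b\<in>I. g s b * (F s * Z a b)))" .
  have "(\<Sum>i\<in>I. \<Sum>j\<in>I. F i * - (\<Sum>s\<in>I. g s j * V s i + g i s * V s j) * H j)
      = - (\<Sum>i\<in>I. \<Sum>j\<in>I. \<Sum>s\<in>I. g s j * H j * (V s i * F i))
        - (\<Sum>i\<in>I. \<Sum>j\<in>I. \<Sum>s\<in>I. g i s * F i * (V s j * H j))"
    unfolding sum_negf[symmetric] sum_subtractf[symmetric]
    by (intro sum.cong refl) (simp add: sum_distrib_left sum_distrib_right sum.distrib sum_negf algebra_simps)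
  then show ?thesis unfolding 1 2 by (simp add: distrib_left sum.distrib)
qed

context dubrovin_zhang begin


text \<open>The components of the inverse of \<open>\<gamma>\<close>, see \<open>gamma_contravariant_eq\<close>: the
  coweights are dual to the simple roots.\<close>

definition gam :: "nat \<Rightarrow> nat \<Rightarrow> real" where
  "gam i j = (if i \<le> CARD('n) \<and> j \<le> CARD('n) then omega_check i \<bullet> omega_check j
     else if i = Suc CARD('n) \<and> j = Suc CARD('n) then - 1 / d k else 0)"

lemma gam_commute: "gam i j = gam j i"
  by (auto simp: gam_def inner_commute)

lemma gamma_contravariant_eq:
  assumes i: "i \<in> {1..Suc CARD('n)}" and j: "j \<in> {1..Suc CARD('n)}"
  shows "gamma_contravariant \<alpha> k i j p = complex_of_real (gam i j)"
proof -
  define A where "A = Matrix.mat (Suc CARD('n)) (Suc CARD('n))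
      (\<lambda>(a, b). gamma_form \<alpha> k (ext_frame \<alpha> (Suc a)) (ext_frame \<alpha> (Suc b)))"
  define B where "B = Matrix.mat (Suc CARD('n)) (Suc CARD('n)) (\<lambda>(a, b). complex_of_real (gam (Suc a) (Suc b)))"
  have A_entry: "A $$ (a, r) = complex_of_real (if a < CARD('n) \<and> r < CARD('n) then \<alpha> (Suc a) \<bullet> \<alpha> (Suc r)
      else if a = CARD('n) \<and> r = CARD('n) then - d k else 0)" if "a < Suc CARD('n)" "r < Suc CARD('n)" for a r
    using that by (auto simp: A_def gamma_form_def ext_frame_def cdot_cvec cdot_0_right cdot_commute[of 0])
  have "A * B = 1\<^sub>m (Suc CARD('n))"
  proof (rule eq_matI)
    fix a b assume "a < dim_row (1\<^sub>m (Suc CARD('n)))" "b < dim_col (1\<^sub>m (Suc CARD('n)) :: complex mat)"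
    then have ab: "a < Suc CARD('n)" "b < Suc CARD('n)" by auto
    have "(A * B) $$ (a, b) = (\<Sum>r<Suc CARD('n). A $$ (a, r) * complex_of_real (gam (Suc r) (Suc b)))"
      using ab by (simp add: A_def B_def scalar_prod_def atLeast0LessThan)
    also have "\<dots> = (\<Sum>r<CARD('n). A $$ (a, r) * complex_of_real (gam (Suc r) (Suc b)))
        + A $$ (a, CARD('n)) * complex_of_real (gam (Suc CARD('n)) (Suc b))" by simp
    also have "\<dots> = of_bool (a = b)"
    proof (cases "a = CARD('n)")
      case True
      then show ?thesis using ab d_pos by (auto simp: A_entry gam_def)
    next
      case False
      then have a: "a < CARD('n)" using ab by simp
      show ?thesis
      proof (cases "b = CARD('n)")
        case True then show ?thesis using a by (simp add: A_entry gam_def)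
      next
        case False
        then have b: "b < CARD('n)" using ab by simp
        have "\<alpha> (Suc a) \<bullet> omega_check (Suc b)
            = (\<Sum>r<CARD('n). (\<alpha> (Suc a) \<bullet> \<alpha> (Suc r)) * (omega_check (Suc b) \<bullet> omega_check (Suc r)))"
          by (rule trans[OF inner_expansion sum_1_to])
        then have "(\<Sum>r<CARD('n). A $$ (a, r) * complex_of_real (gam (Suc r) (Suc b)))
            = complex_of_real (\<alpha> (Suc a) \<bullet> omega_check (Suc b))"
          using a b by (simp add: A_entry gam_def inner_commute)
        then show ?thesis using a b by (simp add: A_entry simple_coweight)
      qed
    qed
    finally show "(A * B) $$ (a, b) = 1\<^sub>m (Suc CARD('n)) $$ (a, b)" using ab by simp
  qed (simp_all add: A_def B_def)
  then have "inv_mat A = B" by (intro inv_mat_eq[of _ "Suc CARD('n)"]) (simp_all add: A_def B_def)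
  then show ?thesis using i j by (auto simp: gamma_contravariant_def A_def[symmetric] B_def)
qed

lemma gam_contract:
  "(\<Sum>i\<in>{1..Suc CARD('n)}. \<Sum>j\<in>{1..Suc CARD('n)}. complex_of_real (gam i j) * ext_pair a (ext_frame \<alpha> i) * ext_pair b (ext_frame \<alpha> j))
    = complex_of_real (fst a \<bullet> fst b - snd a * snd b / d k)"
proof -
  have "fst a \<bullet> fst b = (\<Sum>i=1..CARD('n). (fst a \<bullet> \<alpha> i) *\<^sub>R omega_check i) \<bullet> (\<Sum>j=1..CARD('n). (fst b \<bullet> \<alpha> j) *\<^sub>R omega_check j)"
    using coweight_expansion[of "fst a"] coweight_expansion[of "fst b"] by simp
  also have "\<dots> = (\<Sum>i=1..CARD('n). \<Sum>j=1..CARD('n). gam i j * (fst a \<bullet> \<alpha> i) * (fst b \<bullet> \<alpha> j))"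
    unfolding inner_sum_left inner_sum_right
    by (subst sum.swap) (intro sum.cong refl, simp add: gam_def mult_ac)
  finally have main: "complex_of_real (fst a \<bullet> fst b) = (\<Sum>i=1..CARD('n). \<Sum>j=1..CARD('n).
      complex_of_real (gam i j * (fst a \<bullet> \<alpha> i) * (fst b \<bullet> \<alpha> j)))" by (simp only: of_real_sum)
  have split: "sum f {1..Suc CARD('n)} = sum f {1..CARD('n)} + f (Suc CARD('n))" for f :: "nat \<Rightarrow> complex" by simp
  have "(\<Sum>i\<in>{1..Suc CARD('n)}. \<Sum>j\<in>{1..Suc CARD('n)}. complex_of_real (gam i j) * ext_pair a (ext_frame \<alpha> i) * ext_pair b (ext_frame \<alpha> j))
    = (\<Sum>i=1..CARD('n). \<Sum>j=1..CARD('n). complex_of_real (gam i j * (fst a \<bullet> \<alpha> i) * (fst b \<bullet> \<alpha> j)))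
      + complex_of_real (- (snd a * snd b / d k))"
    unfolding split by (simp add: ext_pair_frame gam_def)
  then show ?thesis using main by simp
qed

text \<open>Rational powers of the exponential of the last coordinate are included so that the orbit sums themselves,
  \<open>exp (- d\<^sub>i x\<^sub>l\<^sub>+\<^sub>1) y\<^sub>i\<close>, belong to the ring.\<close>

inductive_set laurent :: "('n ext \<Rightarrow> complex) set" where
  laurent_const: "(\<lambda>p. a) \<in> laurent"
| laurent_y: "i \<in> {1..CARD('n)} \<Longrightarrow> y i \<in> laurent"
| laurent_exp: "q \<in> \<rat> \<Longrightarrow> (\<lambda>p. exp (complex_of_real q * snd p)) \<in> laurent"
| laurent_add: "f \<in> laurent \<Longrightarrow> g \<in> laurent \<Longrightarrow> (\<lambda>p. f p + g p) \<in> laurent"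
| laurent_mult: "f \<in> laurent \<Longrightarrow> g \<in> laurent \<Longrightarrow> (\<lambda>p. f p * g p) \<in> laurent"

lemma laurent_ring: "function_ring laurent"
  unfolding function_ring_def using laurent_const laurent_add laurent_mult by blast

lemma dz_polynomials_laurent: "f \<in> dz_polynomials R \<alpha> k \<Longrightarrow> f \<in> laurent"
proof (induction rule: dz_polynomials.induct)
  case dz_exp
  show ?case using laurent_exp[of 1] by simp
qed (auto intro: laurent.intros)

lemma exp_snd_pexp: "(\<lambda>p :: 'n ext. exp (complex_of_real q * snd p)) = pexp (0, q)"
  by (simp add: fun_eq_iff pexp_wexp wexp_0)

lemma laurent_E: "f \<in> laurent \<Longrightarrow> f \<in> E"
proof (induction rule: laurent.induct)
  case (laurent_exp q)
  show ?case unfolding exp_snd_pexp using laurent_exp by (simp only: pexp_E rational_exponentsI integral_zero laurent_exp)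
qed (auto intro: y_E function_ring_const[OF E_ring] function_ring_add[OF E_ring] function_ring_mult[OF E_ring])

text \<open>The chain rule, with partial derivatives with respect to \<open>y\<^sub>1, \<dots>,
  y\<^sub>l\<^sub>+\<^sub>1\<close> again in the ring. They are constructed along the generation of
  \<open>f\<close>.\<close>

lemma laurent_chain:
  assumes "f \<in> laurent"
  shows "\<exists>g. (\<forall>r. g r \<in> laurent) \<and>
    (\<forall>p v. has_dir_deriv f (\<Sum>r\<in>{1..Suc CARD('n)}. g r p * dir_deriv v (y r) p) v p)"
  using assms
proof (induction rule: laurent.induct)
  case (laurent_const a)
  show ?case
    by (intro exI[of _ "\<lambda>r p. 0"]) (simp add: has_dir_deriv_const laurent.laurent_const)
next
  case (laurent_y i)
  have "(\<Sum>r\<in>{1..Suc CARD('n)}. of_bool (r = i) * dir_deriv v (y r) p) = dir_deriv v (y i) p" for v p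
  proof -
    have "(\<Sum>r\<in>{1..Suc CARD('n)}. of_bool (r = i) * dir_deriv v (y r) p) = (\<Sum>r\<in>{1..Suc CARD('n)}. if r = i then dir_deriv v (y i) p else 0)"
      by (intro sum.cong refl) auto
    then show ?thesis using laurent_y by simp
  qed
  then show ?case using laurent_y has_deriv_y[of i]
    by (intro exI[of _ "\<lambda>r p. of_bool (r = i)"]) (simp add: laurent.laurent_const)
next
  case (laurent_exp q)
  define g :: "nat \<Rightarrow> 'n ext \<Rightarrow> complex" where
    "g r = (if r = Suc CARD('n) then (\<lambda>p. complex_of_real q * exp (complex_of_real q * snd p)) else (\<lambda>p. 0))" for r
  have "(\<Sum>r\<in>{1..Suc CARD('n)}. g r p * dir_deriv v (y r) p) = complex_of_real q * exp (complex_of_real q * snd p) * snd v" for v p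
  proof -
    have "(\<Sum>r\<in>{1..Suc CARD('n)}. g r p * dir_deriv v (y r) p) = (\<Sum>r\<in>{1..Suc CARD('n)}. if r = Suc CARD('n)
        then complex_of_real q * exp (complex_of_real q * snd p) * dir_deriv v snd p else 0)"
      by (intro sum.cong refl) (auto simp: g_def y_last)
    then show ?thesis using dir_deriv_eq[OF has_dir_deriv_snd[of v p]] by simp
  qed
  moreover have "has_dir_deriv (\<lambda>p. exp (complex_of_real q * snd p))
      (complex_of_real q * exp (complex_of_real q * snd p) * snd v) v p" for v p :: "'n ext"
  proof -
    have "ext_pair (0, q) v * pexp (0, q) p = complex_of_real q * exp (complex_of_real q * snd p) * snd v"
      by (simp add: pexp_wexp wexp_0 ext_pair_def cvec_0 cdot_commute[of 0] cdot_0_right mult_ac)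
    then show ?thesis using has_dir_deriv_pexp[of "(0, q)" v p] by (simp only: exp_snd_pexp)
  qed
  moreover have "g r \<in> laurent" for r
    unfolding g_def using laurent_exp by (auto intro!: laurent.intros)
  ultimately show ?case by (intro exI[of _ g]) simp
next
  case (laurent_add f h)
  obtain f' where f': "\<And>r. f' r \<in> laurent"
    "\<And>p v. has_dir_deriv f (\<Sum>r\<in>{1..Suc CARD('n)}. f' r p * dir_deriv v (y r) p) v p" using laurent_add.IH(1) by blast
  obtain h' where h': "\<And>r. h' r \<in> laurent"
    "\<And>p v. has_dir_deriv h (\<Sum>r\<in>{1..Suc CARD('n)}. h' r p * dir_deriv v (y r) p) v p" using laurent_add.IH(2) by blast
  have "(\<Sum>r\<in>{1..Suc CARD('n)}. (f' r p + h' r p) * dir_deriv v (y r) p)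
      = (\<Sum>r\<in>{1..Suc CARD('n)}. f' r p * dir_deriv v (y r) p) + (\<Sum>r\<in>{1..Suc CARD('n)}. h' r p * dir_deriv v (y r) p)" for p v
    by (simp add: distrib_right sum.distrib del: sum.cl_ivl_Suc)
  then show ?case using has_dir_deriv_add[OF f'(2) h'(2)] f'(1) h'(1)
    by (intro exI[of _ "\<lambda>r p. f' r p + h' r p"]) (simp add: laurent.laurent_add del: sum.cl_ivl_Suc)
next
  case (laurent_mult f h)
  obtain f' where f': "\<And>r. f' r \<in> laurent"
    "\<And>p v. has_dir_deriv f (\<Sum>r\<in>{1..Suc CARD('n)}. f' r p * dir_deriv v (y r) p) v p" using laurent_mult.IH(1) by blast
  obtain h' where h': "\<And>r. h' r \<in> laurent"
    "\<And>p v. has_dir_deriv h (\<Sum>r\<in>{1..Suc CARD('n)}. h' r p * dir_deriv v (y r) p) v p" using laurent_mult.IH(2) by blast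
  have "(\<Sum>r\<in>{1..Suc CARD('n)}. (f' r p * h p + h' r p * f p) * dir_deriv v (y r) p)
      = (\<Sum>r\<in>{1..Suc CARD('n)}. f' r p * dir_deriv v (y r) p) * h p + (\<Sum>r\<in>{1..Suc CARD('n)}. h' r p * dir_deriv v (y r) p) * f p" for p v
    unfolding sum_distrib_right sum.distrib[symmetric]
    by (intro sum.cong refl) (simp add: algebra_simps)
  then show ?case using has_dir_deriv_mult[OF f'(2) h'(2)] f'(1) h'(1) laurent_mult.hyps
    by (intro exI[of _ "\<lambda>r p. f' r p * h p + h' r p * f p"])
      (simp add: laurent.laurent_add laurent.laurent_mult del: sum.cl_ivl_Suc)
qed

lemma weyl_sum_laurent: assumes "integral v" shows "(\<lambda>p. weyl_sum v (fst p)) \<in> laurent"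
proof -
  have "weyl_sum v \<in> {f. (\<lambda>p. f (fst p)) \<in> laurent}"
  proof (rule weyl_sum_in_ring[OF _ _ assms])
    show "function_ring {f. (\<lambda>p. f (fst p)) \<in> laurent}"
      unfolding function_ring_def using laurent.intros by auto
    fix i assume i: "i \<in> {1..CARD('n)}"
    have "(\<lambda>p. exp (complex_of_real (- d i) * snd p) * y i p) \<in> laurent"
      using i d_rational by (intro laurent_mult laurent_exp laurent_y) auto
    moreover have "(\<lambda>p. exp (complex_of_real (- d i) * snd p) * y i p) = (\<lambda>p. weyl_sum (omega i) (fst p))"
      using i by (simp add: y_eq fun_eq_iff exp_minus)
    ultimately show "weyl_sum (omega i) \<in> {f. (\<lambda>p. f (fst p)) \<in> laurent}" by simp
  qed
  then show ?thesis by simp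
qed

text \<open>The function \<open>\<gamma>\<^sup>-\<^sup>1(df, dh)\<close>.\<close>

definition gamma_pairing :: "('n ext \<Rightarrow> complex) \<Rightarrow> ('n ext \<Rightarrow> complex) \<Rightarrow> 'n ext \<Rightarrow> complex" where
  "gamma_pairing f h p = (\<Sum>i\<in>{1..Suc CARD('n)}. \<Sum>j\<in>{1..Suc CARD('n)}. complex_of_real (gam i j) * D i f p * D j h p)"

text \<open>The points \<open>a i\<close> and \<open>b j\<close> are exponents and \<open>F i\<close>, \<open>G j\<close>
  the corresponding terms of the two functions at \<open>p\<close>; the last coordinate is covered by the
  exponent \<open>(0, 1)\<close> and the term \<open>1\<close>.\<close>

lemma gamma_pairing_expand:
  fixes A :: "'i set" and B :: "'j set" and a b F G
  assumes f: "\<And>v. dir_deriv v f p = (\<Sum>i\<in>A. ext_pair (a i) v * F i)"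
    and h: "\<And>v. dir_deriv v h p = (\<Sum>j\<in>B. ext_pair (b j) v * G j)"
  shows "gamma_pairing f h p = (\<Sum>i\<in>A. \<Sum>j\<in>B.
    complex_of_real (fst (a i) \<bullet> fst (b j) - snd (a i) * snd (b j) / d k) * F i * G j)"
proof -
  have "gamma_pairing f h p = (\<Sum>r\<in>{1..Suc CARD('n)}. \<Sum>s\<in>{1..Suc CARD('n)}. \<Sum>i\<in>A. \<Sum>j\<in>B. complex_of_real (gam r s) *
      ext_pair (a i) (ext_frame \<alpha> r) * ext_pair (b j) (ext_frame \<alpha> s) * (F i * G j))"
    unfolding gamma_pairing_def f h
    by (simp add: sum_distrib_left sum_distrib_right mult_ac del: sum.cl_ivl_Suc)
  also have "\<dots> = (\<Sum>i\<in>A. \<Sum>j\<in>B. \<Sum>r\<in>{1..Suc CARD('n)}. \<Sum>s\<in>{1..Suc CARD('n)}. complex_of_real (gam r s) *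
      ext_pair (a i) (ext_frame \<alpha> r) * ext_pair (b j) (ext_frame \<alpha> s) * (F i * G j))"
    by (rule sum_swap4)
  also have "\<dots> = (\<Sum>i\<in>A. \<Sum>j\<in>B.
    complex_of_real (fst (a i) \<bullet> fst (b j) - snd (a i) * snd (b j) / d k) * F i * G j)"
    unfolding sum_distrib_right[symmetric] gam_contract by (simp add: mult_ac)
  finally show ?thesis .
qed


text \<open>Up to a multiple of \<open>y\<^sub>i y\<^sub>j\<close> and an exponential of the last coordinate, the pairing
  of the gradients is \<open>\<Sum>\<^sub>w (\<omega>\<^sub>i, w \<omega>\<^sub>j)\<close> times the orbit sum
  of \<open>\<omega>\<^sub>i + w \<omega>\<^sub>j\<close>, to which Chevalley's theorem applies.\<close>

lemma gamma_pairing_y: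
  assumes i: "i \<in> {1..Suc CARD('n)}" and j: "j \<in> {1..Suc CARD('n)}"
  shows "gamma_pairing (y i) (y j) \<in> laurent"
proof -
  have snd_deriv: "dir_deriv v (y (Suc CARD('n))) p = (\<Sum>u\<in>{()}. ext_pair (0, 1) v * 1)" for v p
    using dir_deriv_eq[OF has_dir_deriv_snd[of v p]]
    by (simp add: y_last ext_pair_def cvec_0 cdot_commute[of 0] cdot_0_right)
  have mixed: "gamma_pairing (y i) (y (Suc CARD('n))) = (\<lambda>p. complex_of_real (- d i / d k) * y i p)"
    "gamma_pairing (y (Suc CARD('n))) (y i) = (\<lambda>p. complex_of_real (- d i / d k) * y i p)"
    if i: "i \<in> {1..CARD('n)}" for i
  proof -
    show "gamma_pairing (y i) (y (Suc CARD('n))) = (\<lambda>p. complex_of_real (- d i / d k) * y i p)"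
      by (rule ext, subst gamma_pairing_expand[OF D_y[OF i] snd_deriv])
        (simp add: y_pexp[OF i] sum_distrib_left)
    show "gamma_pairing (y (Suc CARD('n))) (y i) = (\<lambda>p. complex_of_real (- d i / d k) * y i p)"
      by (rule ext, subst gamma_pairing_expand[OF snd_deriv D_y[OF i]])
        (simp add: y_pexp[OF i] sum_distrib_left)
  qed
  consider "i = Suc CARD('n)" "j = Suc CARD('n)" | "i = Suc CARD('n)" "j \<in> {1..CARD('n)}"
    | "i \<in> {1..CARD('n)}" "j = Suc CARD('n)" | "i \<in> {1..CARD('n)}" "j \<in> {1..CARD('n)}"
    using i j by (auto simp: le_Suc_eq)
  then show ?thesis
  proof cases
    case 1
    have "gamma_pairing (y (Suc CARD('n))) (y (Suc CARD('n))) = (\<lambda>p. complex_of_real (- 1 / d k))"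
      by (rule ext, subst gamma_pairing_expand[OF snd_deriv snd_deriv]) simp
    then show ?thesis using 1 laurent_const by simp
  next
    case 2
    show ?thesis unfolding 2(1) mixed(2)[OF 2(2)] by (intro laurent_mult laurent_const laurent_y 2)
  next
    case 3
    show ?thesis unfolding 3(2) mixed(1)[OF 3(1)] by (intro laurent_mult laurent_const laurent_y 3)
  next
    case 4
    let ?x = "\<lambda>p. exp (complex_of_real (d i + d j) * snd p)"
    let ?K = "\<lambda>p. ?x p *
          (\<Sum>w\<in>W. complex_of_real (omega i \<bullet> w (omega j)) * weyl_sum (omega i + w (omega j)) (fst p))
        + complex_of_real (- (d i * d j / d k)) * (y i p * y j p)"
    have eq: "gamma_pairing (y i) (y j) p = ?K p" for p
    proof -
      have "gamma_pairing (y i) (y j) p = (\<Sum>w\<in>W. \<Sum>w'\<in>W.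
          complex_of_real (w (omega i) \<bullet> w' (omega j) - d i * d j / d k)
          * pexp (w (omega i), d i) p * pexp (w' (omega j), d j) p)"
        by (subst gamma_pairing_expand[OF D_y[OF 4(1)] D_y[OF 4(2)]]) simp
      also have "\<dots> = (\<Sum>w\<in>W. \<Sum>w'\<in>W.
          ?x p * (complex_of_real (w (omega i) \<bullet> w' (omega j)) * wexp (w (omega i)) (fst p) * wexp (w' (omega j)) (fst p))
          + complex_of_real (- (d i * d j / d k)) * (pexp (w (omega i), d i) p * pexp (w' (omega j), d j) p))"
        by (intro sum.cong refl) (simp add: pexp_wexp exp_add algebra_simps)
      also have "\<dots> = ?x p *
            (\<Sum>w\<in>W. \<Sum>w'\<in>W. complex_of_real (w (omega i) \<bullet> w' (omega j)) * wexp (w (omega i)) (fst p) * wexp (w' (omega j)) (fst p))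
          + complex_of_real (- (d i * d j / d k)) * (y i p * y j p)"
        unfolding y_pexp[OF 4(1)] y_pexp[OF 4(2)] sum_product
        by (simp only: sum.distrib sum_distrib_left)
      finally show ?thesis unfolding twisted_product .
    qed
    have "?K \<in> laurent"
    proof (intro laurent_add laurent_mult laurent_const laurent_y 4 laurent_exp
        function_ring_sum[OF laurent_ring] weyl_sum_laurent)
      show "d i + d j \<in> \<rat>" using 4 d_rational by simp
      show "integral (omega i + w (omega j))" if "w \<in> W" for w
        using that 4 by (intro integral_add integral_weyl[of w] integral_omega)
    qed
    moreover have "gamma_pairing (y i) (y j) = ?K" by (rule ext) (rule eq)
    ultimately show ?thesis by simp
  qed
qed

subsection \<open>Differentiation along the unit field\<close>

abbreviation e :: "complex \<Rightarrow> nat \<Rightarrow> 'n ext \<Rightarrow> complex" where "e c \<equiv> saito_unit_field R \<alpha> k c"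

lemma cofactor_ring:
  assumes Q: "function_ring Q"
    and f: "\<And>i j. i < Suc n \<Longrightarrow> j < Suc n \<Longrightarrow> (\<lambda>x. A x $$ (i, j)) \<in> Q"
    and A: "\<And>x. A x \<in> carrier_mat (Suc n) (Suc n)"
  shows "(\<lambda>x. cofactor (A x) a b) \<in> Q"
  unfolding cofactor_def
proof (intro function_ring_mult[OF Q] function_ring_const[OF Q] function_ring_det[OF Q, of n])
  show del: "mat_delete (A x) a b \<in> carrier_mat n n" for x using mat_delete_carrier[OF A[of x]] by simp
  show "(\<lambda>x. mat_delete (A x) a b $$ (i, j)) \<in> Q" if "i < n" "j < n" for i j
  proof -
    have "mat_delete (A x) a b $$ (i, j) = A x $$ (if i < a then i else Suc i, if j < b then j else Suc j)" for x
      using that carrier_matD[OF A[of x]] by (simp add: mat_delete_def)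
    then show ?thesis using f that by simp
  qed
qed

text \<open>By Cramer's rule, and because the regular points form an open set.\<close>

lemma inv_mat_field:
  fixes A :: "'n ext \<Rightarrow> complex mat"
  assumes f: "\<And>i j. i < Suc n \<Longrightarrow> j < Suc n \<Longrightarrow> (\<lambda>p. A p $$ (i, j)) \<in> E"
    and A: "\<And>p. A p \<in> carrier_mat (Suc n) (Suc n)"
    and reg: "\<And>p. p \<in> regular \<Longrightarrow> Determinant.det (A p) \<noteq> 0" and p: "p \<in> regular"
    and ab: "a < Suc n" "b < Suc n"
  shows "has_dir_deriv (\<lambda>p. inv_mat (A p) $$ (a, b))
    ((dir_deriv v (\<lambda>p. cofactor (A p) b a) p * Determinant.det (A p)
      - cofactor (A p) b a * dir_deriv v (\<lambda>p. Determinant.det (A p)) p)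
     / (Determinant.det (A p) * Determinant.det (A p))) v p"
proof (rule has_dir_deriv_cong_open[OF _ open_regular p])
  show "has_dir_deriv (\<lambda>p. cofactor (A p) b a / Determinant.det (A p))
    ((dir_deriv v (\<lambda>p. cofactor (A p) b a) p * Determinant.det (A p)
      - cofactor (A p) b a * dir_deriv v (\<lambda>p. Determinant.det (A p)) p)
     / (Determinant.det (A p) * Determinant.det (A p))) v p"
    by (intro has_dir_deriv_divide E_has_deriv reg p cofactor_ring[OF E_ring f A]
        function_ring_det[OF E_ring f A])
  show "cofactor (A q) b a / Determinant.det (A q) = inv_mat (A q) $$ (a, b)" if "q \<in> regular" for q
    using inv_mat_cofactor[OF A reg[OF that] ab] by simp
qed

lemma e_has_deriv:
  assumes p: "p \<in> regular" and j: "j \<in> {1..Suc CARD('n)}"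
  shows "has_dir_deriv (e c j) (dir_deriv v (e c j) p) v p"
proof -
  have "\<exists>D'. has_dir_deriv (\<lambda>p. inv_mat (Y p) $$ (j - 1, k - 1)) D' v p"
    by (rule exI, rule inv_mat_field[where n = "CARD('n)", OF D_y_E jacobian_carrier _ p])
      (use j k in \<open>auto simp: dz_regular_def\<close>)
  then obtain D' where "has_dir_deriv (\<lambda>p. inv_mat (Y p) $$ (j - 1, k - 1)) D' v p" by blast
  then have "has_dir_deriv (\<lambda>p. c * inv_mat (Y p) $$ (j - 1, k - 1))
      (0 * inv_mat (Y p) $$ (j - 1, k - 1) + D' * c) v p"
    by (intro has_dir_deriv_mult has_dir_deriv_const)
  moreover have "e c j = (\<lambda>p. c * inv_mat (Y p) $$ (j - 1, k - 1))"
    by (simp add: fun_eq_iff saito_unit_field_def coord_field_def)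
  ultimately show ?thesis using dir_deriv_eq by metis
qed

lemma e_y:
  assumes p: "p \<in> regular" and r: "r \<in> {1..Suc CARD('n)}"
  shows "(\<Sum>j\<in>{1..Suc CARD('n)}. e c j p * D j (y r) p) = c * of_bool (r = k)"
proof -
  have Yp: "Determinant.det (Y p) \<noteq> 0" using p by (simp add: dz_regular_def)
  note inv = inv_mat_inverse[OF jacobian_carrier Yp]
  have "(\<Sum>j\<in>{1..Suc CARD('n)}. e c j p * D j (y r) p)
      = (\<Sum>j<Suc CARD('n). e c (Suc j) p * D (Suc j) (y r) p)" by (rule sum_1_to)
  also have "\<dots> = c * (\<Sum>j<Suc CARD('n). Y p $$ (r - 1, j) * inv_mat (Y p) $$ (j, k - 1))"
    unfolding sum_distrib_left using r
    by (intro sum.cong refl) (cases r, simp_all add: saito_unit_field_def coord_field_def jacobian_index)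
  also have "(\<Sum>j<Suc CARD('n). Y p $$ (r - 1, j) * inv_mat (Y p) $$ (j, k - 1)) = (Y p * inv_mat (Y p)) $$ (r - 1, k - 1)"
    by (rule mat_mult_entry[OF jacobian_carrier inv(1), symmetric]) (use r k in auto)
  also have "\<dots> = of_bool (r = k)" unfolding inv(2) using r k by auto
  finally show ?thesis .
qed

text \<open>Only the partial derivative with respect to \<open>y\<^sub>k\<close> survives.\<close>

lemma e_laurent:
  assumes "f \<in> laurent"
  shows "\<exists>h\<in>laurent. \<forall>p\<in>regular. (\<Sum>j\<in>{1..Suc CARD('n)}. e c j p * D j f p) = h p"
proof -
  obtain g where g: "\<And>r. g r \<in> laurent"
    "\<And>p v. has_dir_deriv f (\<Sum>r\<in>{1..Suc CARD('n)}. g r p * dir_deriv v (y r) p) v p"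
    using laurent_chain[OF assms] by blast
  have "(\<Sum>j\<in>{1..Suc CARD('n)}. e c j p * D j f p) = c * g k p" if p: "p \<in> regular" for p
  proof -
    have "(\<Sum>j\<in>{1..Suc CARD('n)}. e c j p * D j f p)
        = (\<Sum>j\<in>{1..Suc CARD('n)}. \<Sum>r\<in>{1..Suc CARD('n)}. g r p * (e c j p * D j (y r) p))"
      unfolding dir_deriv_eq[OF g(2)] sum_distrib_left by (intro sum.cong refl) (simp add: mult_ac)
    also have "\<dots> = (\<Sum>r\<in>{1..Suc CARD('n)}. g r p * (c * of_bool (r = k)))"
      by (subst sum.swap) (intro sum.cong refl, simp only: sum_distrib_left[symmetric] e_y[OF p])
    also have "\<dots> = (\<Sum>r\<in>{1..Suc CARD('n)}. if r = k then c * g k p else 0)"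
      by (intro sum.cong refl) auto
    also have "\<dots> = c * g k p" using k by (simp del: sum.cl_ivl_Suc)
    finally show ?thesis .
  qed
  then show ?thesis using g(1) by (intro bexI[of _ "\<lambda>p. c * g k p"]) (auto intro: laurent_mult laurent_const)
qed

lemma saito_contravariant_eq:
  assumes i: "i \<in> {1..Suc CARD('n)}" and j: "j \<in> {1..Suc CARD('n)}"
  shows "saito_contravariant R \<alpha> k c i j p = - (\<Sum>s\<in>{1..Suc CARD('n)}.
    complex_of_real (gam s j) * D s (e c i) p + complex_of_real (gam i s) * D s (e c j) p)"
proof -
  have "gamma_contravariant \<alpha> k i j = (\<lambda>p. complex_of_real (gam i j))"
    using gamma_contravariant_eq[OF i j] by auto
  then have "D s (gamma_contravariant \<alpha> k i j) p = 0" for s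
    using dir_deriv_eq[OF has_dir_deriv_const] by simp
  then have "saito_contravariant R \<alpha> k c i j p = (\<Sum>s\<in>{1..Suc CARD('n)}.
      - (complex_of_real (gam s j) * D s (e c i) p + complex_of_real (gam i s) * D s (e c j) p))"
    unfolding saito_contravariant_def lie_contravariant_def
    by (intro sum.cong) (use i j in \<open>simp_all add: gamma_contravariant_eq\<close>)
  then show ?thesis by (simp only: sum_negf)
qed

text \<open>The last coordinate is no exponential sum, but its derivatives are.\<close>

definition gradient_E :: "('n ext \<Rightarrow> complex) \<Rightarrow> bool" where
  "gradient_E f \<longleftrightarrow> (\<forall>a. D a f \<in> E) \<and> (\<forall>a b. D a (D b f) = D b (D a f))"

lemma gradient_E_E: "f \<in> E \<Longrightarrow> gradient_E f"
  unfolding gradient_E_def using E_deriv dir_deriv_commute[OF rational_exponents_monoid] by blast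

lemma gradient_E_snd: "gradient_E snd"
proof -
  have "D a snd = (\<lambda>p. snd (ext_frame \<alpha> a))" for a
    by (rule ext) (rule dir_deriv_eq[OF has_dir_deriv_snd])
  moreover have "D b (\<lambda>p. c) = (\<lambda>p. 0)" for b c
    by (rule ext) (rule dir_deriv_eq[OF has_dir_deriv_const])
  ultimately show ?thesis by (simp add: gradient_E_def function_ring_const[OF E_ring])
qed

lemma gradient_E_y: "i \<in> {1..Suc CARD('n)} \<Longrightarrow> gradient_E (y i)"
  using gradient_E_E[OF y_E, of i] gradient_E_snd
  by (cases "i = Suc CARD('n)") (auto simp: y_last)

text \<open>If \<open>e\<close> maps \<open>f\<close> and \<open>h\<close> to constants, its Lie derivative annihilates
  the differentials \<open>df\<close> and \<open>dh\<close>, so that evaluating the Lie derivative of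
  \<open>\<gamma>\<^sup>-\<^sup>1\<close> on them is the same as differentiating
  \<open>\<gamma>\<^sup>-\<^sup>1(df, dh)\<close> along \<open>e\<close>.\<close>

lemma lie_derivative_pairing:
  assumes f: "gradient_E f" and h: "gradient_E h"
    and ef: "\<And>q. q \<in> regular \<Longrightarrow> (\<Sum>j\<in>{1..Suc CARD('n)}. e c j q * D j f q) = cf"
    and eh: "\<And>q. q \<in> regular \<Longrightarrow> (\<Sum>j\<in>{1..Suc CARD('n)}. e c j q * D j h q) = ch"
    and p: "p \<in> regular"
  shows "(\<Sum>i\<in>{1..Suc CARD('n)}. \<Sum>j\<in>{1..Suc CARD('n)}.
      D i f p * saito_contravariant R \<alpha> k c i j p * D j h p)
    = (\<Sum>j\<in>{1..Suc CARD('n)}. e c j p * D j (gamma_pairing f h) p)"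
proof -
  let ?I = "{1..Suc CARD('n)}" and ?g = "\<lambda>s b. complex_of_real (gam s b)"
  \<comment> \<open>differentiate the constant \<open>\<Sum>\<^sub>a e\<^sup>a \<partial>\<^sub>a f\<close>\<close>
  have trade: "(\<Sum>a\<in>?I. D s (e c a) p * D a f p) = - (\<Sum>a\<in>?I. e c a p * D a (D s f) p)"
    if f: "gradient_E f" and ef: "\<And>q. q \<in> regular \<Longrightarrow> (\<Sum>j\<in>?I. e c j q * D j f q) = cf" for f cf s
  proof -
    let ?S = "\<Sum>a\<in>?I. D s (e c a) p * D a f p + D s (D a f) p * e c a p"
    have "has_dir_deriv (\<lambda>q. \<Sum>a\<in>?I. e c a q * D a f q) ?S (ext_frame \<alpha> s) p"
      using f unfolding gradient_E_def
      by (intro has_dir_deriv_sum has_dir_deriv_mult e_has_deriv p E_has_deriv) simp_all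
    then have "has_dir_deriv (\<lambda>q. cf) ?S (ext_frame \<alpha> s) p"
      by (rule has_dir_deriv_cong_open[OF _ open_regular p]) (rule ef)
    then have "?S = 0"
      using dir_deriv_eq[OF has_dir_deriv_const, of "ext_frame \<alpha> s" cf p] by (simp only: dir_deriv_eq)
    then have "(\<Sum>a\<in>?I. D s (e c a) p * D a f p) + (\<Sum>a\<in>?I. e c a p * D s (D a f) p) = 0"
      by (simp add: sum.distrib mult.commute del: sum.cl_ivl_Suc)
    moreover have "D s (D a f) = D a (D s f)" for a using f by (simp add: gradient_E_def)
    ultimately show ?thesis by (simp add: eq_neg_iff_add_eq_0 del: sum.cl_ivl_Suc)
  qed
  have pairing_deriv: "D j (gamma_pairing f h) p
      = (\<Sum>s\<in>?I. \<Sum>b\<in>?I. ?g s b * (D j (D s f) p * D b h p + D s f p * D j (D b h) p))" (is "_ = ?R") for j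
  proof (rule dir_deriv_eq)
    have "has_dir_deriv (\<lambda>p. \<Sum>s\<in>?I. \<Sum>b\<in>?I. ?g s b * D s f p * D b h p)
      (\<Sum>s\<in>?I. \<Sum>b\<in>?I. (0 * D s f p + D j (D s f) p * ?g s b) * D b h p
        + D j (D b h) p * (?g s b * D s f p)) (ext_frame \<alpha> j) p"
      using f h unfolding gradient_E_def
      by (intro has_dir_deriv_sum has_dir_deriv_mult has_dir_deriv_const E_has_deriv) auto
    moreover have "(\<Sum>s\<in>?I. \<Sum>b\<in>?I. (0 * D s f p + D j (D s f) p * ?g s b) * D b h p
        + D j (D b h) p * (?g s b * D s f p)) = ?R"
      by (intro sum.cong refl) (simp add: algebra_simps)
    ultimately show "has_dir_deriv (gamma_pairing f h) ?R (ext_frame \<alpha> j) p"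
      unfolding gamma_pairing_def by (simp only:)
  qed
  have "(\<Sum>i\<in>?I. \<Sum>j\<in>?I. D i f p * saito_contravariant R \<alpha> k c i j p * D j h p)
      = (\<Sum>i\<in>?I. \<Sum>j\<in>?I. D i f p *
          - (\<Sum>s\<in>?I. ?g s j * D s (e c i) p + ?g i s * D s (e c j) p) * D j h p)"
    by (intro sum.cong refl) (simp only: saito_contravariant_eq)
  also have "\<dots> = (\<Sum>j\<in>?I. e c j p * D j (gamma_pairing f h) p)"
    unfolding pairing_deriv
    by (rule contracted_lie_derivative[where X = "\<lambda>j s. D j (D s f) p" and Z = "\<lambda>j b. D j (D b h) p"])
      (rule trade[OF f ef] trade[OF h eh], assumption)+
  finally show ?thesis .
qed

lemma saito_contravariant_y:
  assumes i: "i \<in> {1..Suc CARD('n)}" and j: "j \<in> {1..Suc CARD('n)}"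
  shows "\<exists>h\<in>laurent. \<forall>p\<in>regular. (\<Sum>a\<in>{1..Suc CARD('n)}. \<Sum>b\<in>{1..Suc CARD('n)}.
      D a (y i) p * saito_contravariant R \<alpha> k c a b p * D b (y j) p) = h p"
proof -
  have "gamma_pairing (y i) (y j) \<in> laurent" by (rule gamma_pairing_y[OF i j])
  then obtain h where h: "h \<in> laurent"
    "\<And>p. p \<in> regular \<Longrightarrow> (\<Sum>a\<in>{1..Suc CARD('n)}. e c a p * D a (gamma_pairing (y i) (y j)) p) = h p"
    using e_laurent by blast
  then show ?thesis
    by (intro bexI[of _ h] ballI)
      (simp only: lie_derivative_pairing[OF gradient_E_y[OF i] gradient_E_y[OF j] e_y[OF _ i] e_y[OF _ j]])
qed

end

section \<open>Flat coordinates\<close>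

lemma triple_mult_entry:
  assumes "A \<in> carrier_mat n n" "B \<in> carrier_mat n n" "C \<in> carrier_mat n n" "i < n" "j < n"
  shows "(transpose_mat A * B * C) $$ (i, j) = (\<Sum>r<n. \<Sum>s<n. A $$ (r, i) * B $$ (r, s) * C $$ (s, j))"
proof -
  have At: "transpose_mat A \<in> carrier_mat n n" using assms(1) by simp
  have "(transpose_mat A * B * C) $$ (i, j) = (\<Sum>s<n. (transpose_mat A * B) $$ (i, s) * C $$ (s, j))"
    by (rule mat_mult_entry[OF mult_carrier_mat[OF At assms(2)] assms(3-5)])
  also have "\<dots> = (\<Sum>s<n. \<Sum>r<n. A $$ (r, i) * B $$ (r, s) * C $$ (s, j))"
  proof (intro sum.cong refl)
    fix s assume "s \<in> {..<n}"
    then have "(transpose_mat A * B) $$ (i, s) = (\<Sum>r<n. A $$ (r, i) * B $$ (r, s))"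
      using mat_mult_entry[OF At assms(2,4), of s] assms(1,4) by simp
    then show "(transpose_mat A * B) $$ (i, s) * C $$ (s, j) = (\<Sum>r<n. A $$ (r, i) * B $$ (r, s) * C $$ (s, j))"
      by (simp add: sum_distrib_right)
  qed
  also have "\<dots> = (\<Sum>r<n. \<Sum>s<n. A $$ (r, i) * B $$ (r, s) * C $$ (s, j))" by (rule sum.swap)
  finally show ?thesis .
qed

lemma mat_delete_entry:
  "A \<in> carrier_mat (Suc n) (Suc n) \<Longrightarrow> i < n \<Longrightarrow> j < n \<Longrightarrow>
    mat_delete A a b $$ (i, j) = A $$ (if i < a then i else Suc i, if j < b then j else Suc j)"
  by (simp add: mat_delete_def)

locale flat_saito_metric = dubrovin_zhang R \<alpha> k
  for R :: "(real ^ 'n) set" and \<alpha> :: "nat \<Rightarrow> real ^ 'n" and k :: nat +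
  fixes c :: complex and t :: "nat \<Rightarrow> (complex ^ 'n) \<times> complex \<Rightarrow> complex"
  assumes flat: "saito_flat_coords R \<alpha> k c t"
begin

abbreviation T :: "'n ext \<Rightarrow> complex mat" where "T \<equiv> jacobian \<alpha> t"
abbreviation pullback :: "complex mat \<Rightarrow> 'n ext \<Rightarrow> complex mat" where
  "pullback P p \<equiv> transpose_mat (T p) * P * T p"
abbreviation eta :: "'n ext \<Rightarrow> complex mat" where "eta \<equiv> saito_contravariant_mat R \<alpha> k c"

lemma t_laurent: "i \<in> {1..CARD('n)} \<Longrightarrow> t i \<in> laurent"
  and t_last: "t (Suc CARD('n)) = snd"
  and det_eta: "p \<in> regular \<Longrightarrow> Determinant.det (eta p) \<noteq> 0"
  and det_T_nonzero: "p \<in> regular \<Longrightarrow> Determinant.det (T p) \<noteq> 0"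
  and e_t: "p \<in> regular \<Longrightarrow> j \<in> {1..Suc CARD('n)} \<Longrightarrow> e c j p = coord_field \<alpha> t 1 j p"
  using flat dz_polynomials_laurent unfolding saito_flat_coords_def by auto

lemma T_E: "i < Suc CARD('n) \<Longrightarrow> j < Suc CARD('n) \<Longrightarrow> (\<lambda>p. T p $$ (i, j)) \<in> E"
proof (cases "i = CARD('n)")
  case True
  assume "i < Suc CARD('n)" "j < Suc CARD('n)"
  then show ?thesis using True by (simp add: jacobian_index t_last D_snd function_ring_const[OF E_ring])
next
  case False
  assume "i < Suc CARD('n)" "j < Suc CARD('n)"
  then show ?thesis using False E_deriv[OF laurent_E[OF t_laurent[of "Suc i"]]] by (simp add: jacobian_index)
qed

lemma det_T_E: "(\<lambda>p. Determinant.det (T p)) \<in> E"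
  by (rule function_ring_det[OF E_ring T_E jacobian_carrier])

lemma t_chain:
  obtains g where "\<And>i r. i \<in> {1..Suc CARD('n)} \<Longrightarrow> g i r \<in> laurent"
    "\<And>i p v. i \<in> {1..Suc CARD('n)} \<Longrightarrow> dir_deriv v (t i) p = (\<Sum>r\<in>{1..Suc CARD('n)}. g i r p * dir_deriv v (y r) p)"
proof -
  have "\<exists>g. (\<forall>r. g r \<in> laurent) \<and>
      (\<forall>p v. dir_deriv v (t i) p = (\<Sum>r\<in>{1..Suc CARD('n)}. g r p * dir_deriv v (y r) p))"
    if i: "i \<in> {1..Suc CARD('n)}" for i
  proof (cases "i = Suc CARD('n)")
    case True
    have "(\<Sum>r\<in>{1..Suc CARD('n)}. of_bool (r = i) * dir_deriv v (y r) p) = dir_deriv v (t i) p" for v p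
    proof -
      have "(\<Sum>r\<in>{1..Suc CARD('n)}. of_bool (r = i) * dir_deriv v (y r) p)
          = (\<Sum>r\<in>{1..Suc CARD('n)}. if r = i then dir_deriv v (t i) p else 0)"
        by (intro sum.cong refl) (auto simp: True t_last y_last)
      then show ?thesis using i by (simp del: sum.cl_ivl_Suc)
    qed
    then show ?thesis
      by (intro exI[of _ "\<lambda>r p. of_bool (r = i)"]) (simp add: laurent_const del: sum.cl_ivl_Suc)
  next
    case False
    then have "t i \<in> laurent" using i t_laurent by auto
    then obtain g where "\<And>r. g r \<in> laurent"
      "\<And>p v. has_dir_deriv (t i) (\<Sum>r\<in>{1..Suc CARD('n)}. g r p * dir_deriv v (y r) p) v p"
      using laurent_chain by blast
    then show ?thesis by (intro exI[of _ g] conjI allI dir_deriv_eq) auto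
  qed
  then have "\<forall>i\<in>{1..Suc CARD('n)}. \<exists>g. (\<forall>r. g r \<in> laurent) \<and>
      (\<forall>p v. dir_deriv v (t i) p = (\<Sum>r\<in>{1..Suc CARD('n)}. g r p * dir_deriv v (y r) p))" by blast
  from bchoice[OF this] obtain g where "\<forall>i\<in>{1..Suc CARD('n)}. (\<forall>r. g i r \<in> laurent) \<and>
      (\<forall>p v. dir_deriv v (t i) p = (\<Sum>r\<in>{1..Suc CARD('n)}. g i r p * dir_deriv v (y r) p))" by blast
  then show ?thesis using that[of g] by blast
qed

lemma det_T_factor: obtains G where "G \<in> laurent" "\<And>p. Determinant.det (T p) = G p * Determinant.det (Y p)"
proof -
  obtain g where g: "\<And>i r. i \<in> {1..Suc CARD('n)} \<Longrightarrow> g i r \<in> laurent"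
    "\<And>i p v. i \<in> {1..Suc CARD('n)} \<Longrightarrow> dir_deriv v (t i) p = (\<Sum>r\<in>{1..Suc CARD('n)}. g i r p * dir_deriv v (y r) p)"
    using t_chain by blast
  define M where "M p = Matrix.mat (Suc CARD('n)) (Suc CARD('n)) (\<lambda>(i, r). g (Suc i) (Suc r) p)" for p
  have M: "M p \<in> carrier_mat (Suc CARD('n)) (Suc CARD('n))" for p by (simp add: M_def)
  have "T p = M p * Y p" for p
  proof (rule eq_matI)
    fix i j assume "i < dim_row (M p * Y p)" "j < dim_col (M p * Y p)"
    then have ij: "i < Suc CARD('n)" "j < Suc CARD('n)" using carrier_matD[OF M[of p]] carrier_matD[OF jacobian_carrier[of y p]] by auto
    have "T p $$ (i, j) = (\<Sum>r<Suc CARD('n). g (Suc i) (Suc r) p * D (Suc j) (y (Suc r)) p)"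
      unfolding jacobian_index[OF ij] using g(2)[of "Suc i"] ij sum_1_to by auto
    also have "\<dots> = (M p * Y p) $$ (i, j)"
      unfolding mat_mult_entry[OF M jacobian_carrier ij]
      by (intro sum.cong refl) (use ij in \<open>simp add: M_def jacobian_index\<close>)
    finally show "T p $$ (i, j) = (M p * Y p) $$ (i, j)" .
  qed (use carrier_matD[OF M[of p]] carrier_matD[OF jacobian_carrier[of y p]]
      carrier_matD[OF jacobian_carrier[of t p]] in auto)
  then have "Determinant.det (T p) = Determinant.det (M p) * Determinant.det (Y p)" for p
    using det_mult[OF M jacobian_carrier] by simp
  moreover have "(\<lambda>p. Determinant.det (M p)) \<in> laurent"
    by (rule function_ring_det[OF laurent_ring _ M]) (simp add: M_def g(1))
  ultimately show ?thesis using that by blast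
qed

lemma eta_carrier: "eta p \<in> carrier_mat (Suc CARD('n)) (Suc CARD('n))"
  by (simp add: saito_contravariant_mat_def)

text \<open>Flatness says that \<open>P\<close>, a multiple of the antidiagonal unit matrix, is the Gram matrix in the
  frame given by the columns of the inverse of \<open>T\<close>; transforming back gives the metric.\<close>

lemma covariant_eq:
  obtains P where "P \<in> carrier_mat (Suc CARD('n)) (Suc CARD('n))" "Determinant.det P \<noteq> 0"
    "\<And>p. p \<in> regular \<Longrightarrow> inv_mat (eta p) = pullback P p"
proof -
  obtain \<kappa> where \<kappa>: "\<kappa> \<noteq> 0" "\<And>p a b. p \<in> regular \<Longrightarrow> a \<in> {1..Suc CARD('n)} \<Longrightarrow> b \<in> {1..Suc CARD('n)} \<Longrightarrow>
      saito_form R \<alpha> k c p (\<lambda>j. coord_field \<alpha> t a j p) (\<lambda>j. coord_field \<alpha> t b j p) =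
        (if a + b = CARD('n) + 2 then \<kappa> else 0)"
    using flat unfolding saito_flat_coords_def by auto
  let ?N = "Suc CARD('n)"
  \<comment> \<open>matrix indices start from \<open>0\<close>, so the antidiagonal is \<open>a + b = l\<close>\<close>
  define P where "P = Matrix.mat ?N ?N (\<lambda>(a, b). if a + b = CARD('n) then \<kappa> else 0)"
  have P: "P \<in> carrier_mat ?N ?N" by (simp add: P_def)
  have "P * P = (\<kappa> * \<kappa>) \<cdot>\<^sub>m 1\<^sub>m ?N"
  proof (rule eq_matI)
    fix a b assume "a < dim_row ((\<kappa> * \<kappa>) \<cdot>\<^sub>m 1\<^sub>m ?N)" "b < dim_col ((\<kappa> * \<kappa>) \<cdot>\<^sub>m 1\<^sub>m ?N)"
    then have ab: "a < ?N" "b < ?N" by auto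
    have "(P * P) $$ (a, b) = (\<Sum>r<?N. P $$ (a, r) * P $$ (r, b))" by (rule mat_mult_entry[OF P P ab])
    also have "\<dots> = (\<Sum>r<?N. if r = CARD('n) - a then (if a = b then \<kappa> * \<kappa> else 0) else 0)"
      by (intro sum.cong refl) (use ab in \<open>auto simp: P_def\<close>)
    also have "\<dots> = ((\<kappa> * \<kappa>) \<cdot>\<^sub>m 1\<^sub>m ?N) $$ (a, b)" using ab by (simp add: less_Suc_eq_le del: sum.lessThan_Suc)
    finally show "(P * P) $$ (a, b) = ((\<kappa> * \<kappa>) \<cdot>\<^sub>m 1\<^sub>m ?N) $$ (a, b)" .
  qed (simp_all add: P_def)
  then have "Determinant.det P * Determinant.det P = (\<kappa> * \<kappa>) ^ ?N"
    using det_mult[OF P P] by simp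
  then have detP: "Determinant.det P \<noteq> 0" using \<kappa>(1) by auto
  have "inv_mat (eta p) = pullback P p" if p: "p \<in> regular" for p
  proof -
    let ?I = "inv_mat (T p)" and ?C = "inv_mat (eta p)"
    note Tinv = inv_mat_inverse[OF jacobian_carrier det_T_nonzero[OF p]]
    note Einv = inv_mat_inverse[OF eta_carrier det_eta[OF p]]
    have T: "T p \<in> carrier_mat ?N ?N" by (rule jacobian_carrier)
    have "transpose_mat ?I * ?C * ?I = P"
    proof (rule eq_matI)
      fix a b assume "a < dim_row P" "b < dim_col P"
      then have ab: "a < ?N" "b < ?N" using P by auto
      have "(transpose_mat ?I * ?C * ?I) $$ (a, b)
          = (\<Sum>r<?N. \<Sum>s<?N. ?I $$ (r, a) * ?C $$ (r, s) * ?I $$ (s, b))"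
        by (rule triple_mult_entry[OF Tinv(1) Einv(1) Tinv(1) ab])
      also have "\<dots> = saito_form R \<alpha> k c p (\<lambda>j. coord_field \<alpha> t (Suc a) j p) (\<lambda>j. coord_field \<alpha> t (Suc b) j p)"
        unfolding saito_form_def Suc_eq_plus1[symmetric] sum_1_to
        by (intro sum.cong refl) (use p in \<open>simp add: saito_metric_def saito_covariant_def coord_field_def mult_ac\<close>)
      also have "\<dots> = P $$ (a, b)" using \<kappa>(2)[OF p, of "Suc a" "Suc b"] ab by (simp add: P_def)
      finally show "(transpose_mat ?I * ?C * ?I) $$ (a, b) = P $$ (a, b)" .
    qed (use P Tinv(1) in auto)
    then have "pullback P p = transpose_mat (T p) * (transpose_mat ?I * ?C * ?I) * T p" by simp
    also have "\<dots> = (transpose_mat (T p) * transpose_mat ?I) * ?C * (?I * T p)"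
    proof -
      have Tt: "transpose_mat (T p) \<in> carrier_mat ?N ?N" and It: "transpose_mat ?I \<in> carrier_mat ?N ?N"
        using T Tinv(1) by auto
      note assoc = assoc_mult_mat[of _ ?N ?N _ ?N _ ?N]
      show ?thesis using Tt It T Tinv(1) Einv(1)
        by (simp add: assoc mult_carrier_mat[of _ ?N ?N])
    qed
    also have "transpose_mat (T p) * transpose_mat ?I = 1\<^sub>m ?N"
      using transpose_mult[OF Tinv(1) T] Tinv(3) by simp
    finally show ?thesis using Tinv(3) Einv(1) by simp
  qed
  then show ?thesis using that P detP by blast
qed

text \<open>The contravariant metric in the coordinates \<open>y\<close>.\<close>

lemma eta_y:
  obtains H where "\<And>p. H p \<in> carrier_mat (Suc CARD('n)) (Suc CARD('n))"
    "(\<lambda>p. Determinant.det (H p)) \<in> laurent"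
    "\<And>p. p \<in> regular \<Longrightarrow> Determinant.det (Y p) * Determinant.det (eta p) * Determinant.det (Y p) = Determinant.det (H p)"
proof -
  let ?N = "Suc CARD('n)"
  define Q where "Q i j h \<longleftrightarrow> h \<in> laurent \<and> (\<forall>p\<in>regular. (\<Sum>a\<in>{1..Suc CARD('n)}. \<Sum>b\<in>{1..Suc CARD('n)}.
      D a (y i) p * saito_contravariant R \<alpha> k c a b p * D b (y j) p) = h p)" for i j h
  have "\<exists>h. Q i j h" if "i \<in> {1..?N}" "j \<in> {1..?N}" for i j
    using saito_contravariant_y[OF that] unfolding Q_def by blast
  then obtain h where Qh: "\<And>i j. i \<in> {1..?N} \<Longrightarrow> j \<in> {1..?N} \<Longrightarrow> Q i j (h i j)" by metis
  have h: "\<And>i j. i \<in> {1..?N} \<Longrightarrow> j \<in> {1..?N} \<Longrightarrow> h i j \<in> laurent"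
    "\<And>i j p. i \<in> {1..?N} \<Longrightarrow> j \<in> {1..?N} \<Longrightarrow> p \<in> regular \<Longrightarrow> (\<Sum>a\<in>{1..?N}. \<Sum>b\<in>{1..?N}.
      D a (y i) p * saito_contravariant R \<alpha> k c a b p * D b (y j) p) = h i j p"
    using Qh unfolding Q_def by blast+
  define H where "H p = Matrix.mat ?N ?N (\<lambda>(i, j). h (Suc i) (Suc j) p)" for p
  have H: "H p \<in> carrier_mat ?N ?N" for p by (simp add: H_def)
  have Yt: "transpose_mat (Y p) \<in> carrier_mat ?N ?N" for p using jacobian_carrier by simp
  have "transpose_mat (transpose_mat (Y p)) * eta p * transpose_mat (Y p) = H p" if p: "p \<in> regular" for p
  proof (rule eq_matI)
    fix i j assume "i < dim_row (H p)" "j < dim_col (H p)"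
    then have ij: "i < ?N" "j < ?N" using carrier_matD[OF H[of p]] by auto
    have "(transpose_mat (transpose_mat (Y p)) * eta p * transpose_mat (Y p)) $$ (i, j)
        = (\<Sum>r<?N. \<Sum>s<?N. transpose_mat (Y p) $$ (r, i) * eta p $$ (r, s) * transpose_mat (Y p) $$ (s, j))"
      by (rule triple_mult_entry[OF Yt eta_carrier Yt ij])
    also have "\<dots> = (\<Sum>r<?N. \<Sum>s<?N. D (Suc r) (y (Suc i)) p * saito_contravariant R \<alpha> k c (Suc r) (Suc s) p
        * D (Suc s) (y (Suc j)) p)"
      by (intro sum.cong refl)
        (use ij carrier_matD[OF jacobian_carrier] in \<open>simp add: saito_contravariant_mat_def jacobian_index\<close>)
    also have "\<dots> = h (Suc i) (Suc j) p"
      using h(2)[OF _ _ p, of "Suc i" "Suc j"] ij unfolding sum_1_to by simp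
    also have "\<dots> = H p $$ (i, j)" using ij by (simp add: H_def)
    finally show "(transpose_mat (transpose_mat (Y p)) * eta p * transpose_mat (Y p)) $$ (i, j) = H p $$ (i, j)" .
  qed (use carrier_matD[OF H[of p]] carrier_matD[OF jacobian_carrier[of y p]] in auto)
  then have YH: "Y p * eta p * transpose_mat (Y p) = H p" if "p \<in> regular" for p using that by simp
  have det: "Determinant.det (Y p) * Determinant.det (eta p) * Determinant.det (Y p) = Determinant.det (H p)"
    if p: "p \<in> regular" for p
    unfolding YH[OF p, symmetric] det_mult[OF mult_carrier_mat[OF jacobian_carrier eta_carrier] Yt]
      det_mult[OF jacobian_carrier eta_carrier] det_transpose[OF jacobian_carrier] ..
  have "(\<lambda>p. Determinant.det (H p)) \<in> laurent"
    by (rule function_ring_det[OF laurent_ring _ H]) (simp add: H_def h(1))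
  then show ?thesis using that[OF H _ det] by blast
qed

text \<open>Comparing \<open>eta_y\<close> with \<open>covariant_eq\<close> shows that the factor \<open>G\<close> of
  \<open>det_T_factor\<close> has the exponential sum \<open>K\<close> as its inverse. This holds at regular
  points first, and then everywhere by density.\<close>

theorem det_T:
  obtains C a where "C \<noteq> 0" "a \<in> rational_exponents"
    "\<And>p. Determinant.det (T p) = C * pexp a p * denominator (fst p)"
proof -
  obtain G where G: "G \<in> laurent" "\<And>p. Determinant.det (T p) = G p * Determinant.det (Y p)"
    using det_T_factor by blast
  obtain P where P: "P \<in> carrier_mat (Suc CARD('n)) (Suc CARD('n))" "Determinant.det P \<noteq> 0"
    "\<And>p. p \<in> regular \<Longrightarrow> inv_mat (eta p) = pullback P p"
    using covariant_eq by blast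
  obtain H where H: "(\<lambda>p. Determinant.det (H p)) \<in> laurent"
    "\<And>p. p \<in> regular \<Longrightarrow> Determinant.det (Y p) * Determinant.det (eta p) * Determinant.det (Y p) = Determinant.det (H p)"
    using eta_y by metis
  \<comment> \<open>the candidate for the inverse of \<open>G\<close>\<close>
  define K where "K p = Determinant.det P * (G p * Determinant.det (H p))" for p
  have K: "K \<in> E"
    using laurent_E[OF laurent_mult[OF laurent_const laurent_mult[OF G(1) H(1)]]]
    unfolding K_def[abs_def] .
  have GK_regular: "G p * K p = 1" if p: "p \<in> regular" for p
  proof -
    have Tt: "transpose_mat (T p) \<in> carrier_mat (Suc CARD('n)) (Suc CARD('n))" using jacobian_carrier by simp
    note Einv = inv_mat_inverse[OF eta_carrier det_eta[OF p]]
    have "1 = Determinant.det (eta p * inv_mat (eta p))" unfolding Einv(2) by simp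
    also have "\<dots> = Determinant.det (eta p) * Determinant.det (inv_mat (eta p))"
      by (rule det_mult[OF eta_carrier Einv(1)])
    also have "Determinant.det (inv_mat (eta p)) = Determinant.det (T p) * Determinant.det P * Determinant.det (T p)"
      unfolding P(3)[OF p] det_mult[OF mult_carrier_mat[OF Tt P(1)] jacobian_carrier]
        det_mult[OF Tt P(1)] det_transpose[OF jacobian_carrier] ..
    finally show ?thesis unfolding K_def H(2)[OF p, symmetric] G(2) by (simp add: mult_ac)
  qed
  have cont: "continuous_on UNIV (\<lambda>p. G p * K p)"
    by (rule exp_sums_continuous[OF function_ring_mult[OF E_ring laurent_E[OF G(1)] K]])
  have GK: "G p * K p = 1" for p
    by (rule eq_on_regular[OF cont continuous_on_const GK_regular])
  obtain C a where Ca: "C \<noteq> 0" "a \<in> rational_exponents" "G = (\<lambda>p. C * pexp a p)"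
    by (rule exp_sums_unit[OF laurent_E[OF G(1)] K GK]) auto
  obtain C' where C': "C' \<noteq> 0"
    "\<And>p. Determinant.det (Y p) = C' * pexp (0, \<Sum>i<CARD('n). d (Suc i)) p * denominator (fst p)"
    using det_Y by blast
  have "(\<Sum>i<CARD('n). d (Suc i)) \<in> \<rat>" by (rule Rats_sum) (simp add: d_rational)
  then have "(0, \<Sum>i<CARD('n). d (Suc i)) \<in> rational_exponents"
    by (rule rational_exponentsI[OF integral_zero])
  then have "a + (0, \<Sum>i<CARD('n). d (Suc i)) \<in> rational_exponents"
    using Ca(2) rational_exponents_monoid unfolding exponent_monoid_def by blast
  moreover have "Determinant.det (T p) = (C * C') * pexp (a + (0, \<Sum>i<CARD('n). d (Suc i))) p * denominator (fst p)" for p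
    unfolding G(2) Ca(3) C'(2) pexp_add by (simp add: mult_ac)
  ultimately show ?thesis using that[of "C * C'"] Ca(1) C'(1) by simp
qed


subsection \<open>Restriction to a mirror\<close>

text \<open>The expansion of a real vector in simple roots extends to complex vectors because it is an identity between
  the coordinates of simple roots and coweights.\<close>

lemma cvec_expansion: "x = (\<Sum>i=1..CARD('n). cdot (cvec (omega_check i)) x *s cvec (\<alpha> i))"
proof -
  have coord: "(\<Sum>i=1..CARD('n). omega_check i $ a * \<alpha> i $ b) = of_bool (a = b)" for a b
  proof -
    have "axis a 1 $ b = (\<Sum>i=1..CARD('n). (axis a 1 \<bullet> omega_check i) *\<^sub>R \<alpha> i) $ b"
      by (rule arg_cong[where f = "\<lambda>v. v $ b", OF simple_expansion])
    also have "\<dots> = (\<Sum>i=1..CARD('n). omega_check i $ a * \<alpha> i $ b)"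
      by (simp only: sum_component vector_scaleR_component real_scaleR_def inner_axis' inner_real_def mult_1_left)
    finally show ?thesis by (cases "a = b") (simp_all add: axis_def)
  qed
  have "(\<Sum>i=1..CARD('n). cdot (cvec (omega_check i)) x *s cvec (\<alpha> i)) $ b = x $ b" for b
  proof -
    have "(\<Sum>i=1..CARD('n). cdot (cvec (omega_check i)) x *s cvec (\<alpha> i)) $ b
        = (\<Sum>i=1..CARD('n). \<Sum>a\<in>UNIV. x $ a * complex_of_real (omega_check i $ a * \<alpha> i $ b))"
      by (simp add: cdot_def cvec_def sum_distrib_left sum_distrib_right mult_ac)
    also have "\<dots> = (\<Sum>a\<in>UNIV. x $ a * complex_of_real (\<Sum>i=1..CARD('n). omega_check i $ a * \<alpha> i $ b))"
      by (subst sum.swap) (simp add: sum_distrib_left)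
    also have "\<dots> = (\<Sum>a\<in>UNIV. if a = b then x $ b else 0)"
      unfolding coord by (intro sum.cong refl) auto
    finally show ?thesis by simp
  qed
  then show ?thesis by (simp add: Finite_Cartesian_Product.vec_eq_iff)
qed

lemma ext_coord_add: "ext_coord \<alpha> j (u + v) = ext_coord \<alpha> j u + ext_coord \<alpha> j v"
  by (simp add: ext_coord_def cdot_add_right)

lemma ext_coord_frame:
  assumes "i \<in> {1..Suc CARD('n)}" "j \<in> {1..Suc CARD('n)}"
  shows "ext_coord \<alpha> j (ext_frame \<alpha> i) = of_bool (i = j)"
  using assms by (auto simp: ext_coord_def ext_frame_def cdot_cvec coweight_simple cdot_0_right le_Suc_eq)

text \<open>The tangent vector is obtained by adding to the ambient coordinate vector the multiple of \<open>\<alpha>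
  m\<close> that makes it tangent; this changes the coordinate number \<open>m\<close> only.\<close>

lemma mirror_frame_coord:
  assumes m: "m \<in> {1..CARD('n)}" and i: "i \<in> {1..Suc CARD('n)} - {m}"
    and j: "j \<in> {1..Suc CARD('n)} - {m}"
  shows "ext_coord \<alpha> j (mirror_frame \<alpha> m i) = of_bool (i = j)"
proof -
  \<comment> \<open>the coefficient that makes the coordinate vector of index \<open>i\<close> tangent to the mirror\<close>
  define s where "s = (if i \<le> CARD('n) then - (\<alpha> m \<bullet> \<alpha> i) / (\<alpha> m \<bullet> \<alpha> m) else 0)"
  define v :: "'n ext" where "v = ext_frame \<alpha> i + (complex_of_real s *s cvec (\<alpha> m), 0)"
  have v_mirror: "v \<in> mirror \<alpha> m"
    using simple_norm_pos[OF m] i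
    by (auto simp: mirror_def v_def s_def ext_frame_def cdot_add_right cdot_scale_right cdot_cvec cdot_0_right)
  have v_coord: "ext_coord \<alpha> j v = of_bool (i = j)" if "j \<in> {1..Suc CARD('n)} - {m}" for j
    using that i m ext_coord_frame[of i j]
    by (auto simp: v_def ext_coord_add) (auto simp: ext_coord_def cdot_scale_right cdot_cvec coweight_simple)
  have unique: "u = v" if u: "u \<in> mirror \<alpha> m"
    "\<forall>j\<in>{1..CARD('n) + 1} - {m}. ext_coord \<alpha> j u = of_bool (i = j)" for u
  proof -
    define x where "x = fst u - fst v"
    have coord0: "cdot (cvec (omega_check j)) x = 0" if "j \<in> {1..CARD('n)} - {m}" for j
    proof -
      have "ext_coord \<alpha> j u = ext_coord \<alpha> j v" using that u(2) v_coord[of j] by auto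
      then show ?thesis using that by (simp add: x_def cdot_diff_right ext_coord_def)
    qed
    have "x = (\<Sum>j\<in>{m}. cdot (cvec (omega_check j)) x *s cvec (\<alpha> j))"
      by (subst cvec_expansion, rule sum.mono_neutral_right) (use m coord0 in auto)
    then have xm: "x = cdot (cvec (omega_check m)) x *s cvec (\<alpha> m)" by simp
    have "cdot (cvec (\<alpha> m)) x = 0"
      using u(1) v_mirror by (simp add: x_def cdot_diff_right mirror_def)
    moreover have "cdot (cvec (\<alpha> m)) x = cdot (cvec (omega_check m)) x * complex_of_real (\<alpha> m \<bullet> \<alpha> m)"
      by (subst xm) (simp add: cdot_scale_right cdot_cvec)
    ultimately have "cdot (cvec (omega_check m)) x = 0" using simple_norm_pos[OF m] by simp
    then have "x = 0" using xm by simp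
    moreover have "snd u = snd v"
    proof -
      have "ext_coord \<alpha> (Suc CARD('n)) u = ext_coord \<alpha> (Suc CARD('n)) v"
        using u(2) v_coord[of "Suc CARD('n)"] m by auto
      then show ?thesis by (simp add: ext_coord_def)
    qed
    ultimately show ?thesis by (simp add: x_def prod_eq_iff)
  qed
  have "mirror_frame \<alpha> m i = v"
    unfolding mirror_frame_def
  proof (rule the_equality)
    show "v \<in> mirror \<alpha> m \<and> (\<forall>j\<in>{1..CARD('n) + 1} - {m}. ext_coord \<alpha> j v = of_bool (i = j))"
      using v_mirror v_coord by auto
  qed (use unique in blast)
  then show ?thesis using v_coord j by simp
qed

lemma pexp_srefl_mirror:
  assumes "p \<in> mirror \<alpha> m" shows "pexp (srefl m v, q) p = pexp (v, q) p"
  using assms by (simp add: pexp_wexp wexp_srefl crefl_def mirror_def)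

text \<open>On the mirror a weight and its reflection have the same exponential, while their pairings with \<open>\<alpha>
  m\<close> are opposite.\<close>

lemma D_y_mirror:
  assumes m: "m \<in> {1..CARD('n)}" and p: "p \<in> mirror \<alpha> m" and i: "i \<in> {1..Suc CARD('n)}"
  shows "D m (y i) p = 0"
proof (cases "i = Suc CARD('n)")
  case True then show ?thesis using m by (simp add: y_last D_snd)
next
  case False
  then have i: "i \<in> {1..CARD('n)}" using i by auto
  have "D m (y i) p = (\<Sum>w\<in>W. complex_of_real (w (omega i) \<bullet> \<alpha> m) * pexp (w (omega i), d i) p)"
    using m by (simp add: D_y[OF i] ext_pair_frame)
  also have "\<dots> = (\<Sum>w\<in>W. complex_of_real ((srefl m \<circ> w) (omega i) \<bullet> \<alpha> m) * pexp ((srefl m \<circ> w) (omega i), d i) p)"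
    by (rule sum_weyl_left[OF srefl_weyl[OF m], symmetric])
  also have "\<dots> = - (\<Sum>w\<in>W. complex_of_real (w (omega i) \<bullet> \<alpha> m) * pexp (w (omega i), d i) p)"
    unfolding sum_negf[symmetric] comp_apply pexp_srefl_mirror[OF p] reflection_adjoint srefl_simple[OF m]
    by simp
  finally show ?thesis using m by (simp add: D_y[OF i] ext_pair_frame)
qed

lemma D_t_mirror:
  assumes m: "m \<in> {1..CARD('n)}" and p: "p \<in> mirror \<alpha> m" and i: "i \<in> {1..Suc CARD('n)}"
  shows "D m (t i) p = 0"
proof -
  obtain g where "\<And>i r. i \<in> {1..Suc CARD('n)} \<Longrightarrow> g i r \<in> laurent" and
    g: "\<And>i p v. i \<in> {1..Suc CARD('n)} \<Longrightarrow> dir_deriv v (t i) p = (\<Sum>r\<in>{1..Suc CARD('n)}. g i r p * dir_deriv v (y r) p)"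
    using t_chain by blast
  show ?thesis unfolding g[OF i] by (intro sum.neutral) (use D_y_mirror[OF m p] in auto)
qed

lemma mirror_not_regular:
  assumes m: "m \<in> {1..CARD('n)}" and p: "p \<in> mirror \<alpha> m" shows "p \<notin> regular"
proof -
  have "2 * sinh (cdot (cvec (\<alpha> m)) (fst p) / 2) = 0" using p by (simp add: mirror_def)
  then have "denominator (fst p) = 0"
    unfolding denominator_def using simple_root_pos[OF m] finite_pos_roots by (intro prod_zero) auto
  then show ?thesis by (simp add: regular_eq)
qed

lemma covariant_E:
  assumes P: "P \<in> carrier_mat (Suc CARD('n)) (Suc CARD('n))" and ij: "i < Suc CARD('n)" "j < Suc CARD('n)"
  shows "(\<lambda>p. (pullback P p) $$ (i, j)) \<in> E"
  unfolding triple_mult_entry[OF jacobian_carrier P jacobian_carrier ij]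
  by (intro function_ring_sum[OF E_ring] function_ring_mult[OF E_ring] function_ring_const[OF E_ring] T_E ij) auto

lemma saito_metric_mirror:
  assumes P: "P \<in> carrier_mat (Suc CARD('n)) (Suc CARD('n))"
    and cov: "\<And>p. p \<in> regular \<Longrightarrow> inv_mat (eta p) = pullback P p"
    and p: "p \<notin> regular" and ij: "i < Suc CARD('n)" "j < Suc CARD('n)"
  shows "saito_metric R \<alpha> k c (Suc i) (Suc j) p = (pullback P p) $$ (i, j)"
proof -
  have "((\<lambda>p. (pullback P p) $$ (i, j)) \<longlongrightarrow> (pullback P p) $$ (i, j)) (at p within regular)"
    using exp_sums_continuous[OF covariant_E[OF P ij]]
    by (meson UNIV_I continuous_on_def subset_UNIV tendsto_within_subset)
  then have "(saito_covariant R \<alpha> k c (Suc i) (Suc j) \<longlongrightarrow> (pullback P p) $$ (i, j)) (at p within regular)"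
    by (rule Lim_transform_within[where d = 1]) (use cov in \<open>auto simp: saito_covariant_def\<close>)
  then have "Lim (at p within regular) (saito_covariant R \<alpha> k c (Suc i) (Suc j)) = (pullback P p) $$ (i, j)"
    by (rule tendsto_Lim[OF regular_dense])
  then show ?thesis using p by (simp add: saito_metric_def)
qed

text \<open>By \<open>D_t_mirror\<close> the row and the column of index \<open>m\<close> of the extended metric vanish on
  the mirror, so it does not matter that the tangent frame has components along \<open>\<alpha> m\<close>.\<close>

lemma gram_mirror:
  assumes P: "P \<in> carrier_mat (Suc CARD('n)) (Suc CARD('n))"
    and cov: "\<And>p. p \<in> regular \<Longrightarrow> inv_mat (eta p) = pullback P p"
    and m: "m \<in> {1..CARD('n)}" and p: "p \<in> mirror \<alpha> m"
  shows "saito_gram_mirror R \<alpha> k c m p = mat_delete (pullback P p) (m - 1) (m - 1)"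
proof -
  let ?N = "Suc CARD('n)" and ?C = "pullback P p"
  have C: "?C \<in> carrier_mat ?N ?N" using P jacobian_carrier[of t p] by auto
  have m1: "m - 1 < ?N" using m by auto
  have Tm: "T p $$ (r, m - 1) = 0" if "r < ?N" for r
  proof -
    have "T p $$ (r, m - 1) = D (Suc (m - 1)) (t (Suc r)) p" using that m1 by (rule jacobian_index)
    then show ?thesis using D_t_mirror[OF m p, of "Suc r"] that m by simp
  qed
  have Cm: "?C $$ (a, m - 1) = 0" "?C $$ (m - 1, a) = 0" if a: "a < ?N" for a
    unfolding triple_mult_entry[OF jacobian_carrier P jacobian_carrier a m1]
      triple_mult_entry[OF jacobian_carrier P jacobian_carrier m1 a]
    using Tm by (simp_all del: sum.lessThan_Suc)
  define u where "u a r = ext_coord \<alpha> (Suc r) (mirror_frame \<alpha> m (Suc a))" for a r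
  have u: "u a r = of_bool (a = r)" if "a < ?N" "r < ?N" "a \<noteq> m - 1" "r \<noteq> m - 1" for a r
    using mirror_frame_coord[OF m, of "Suc a" "Suc r"] that by (auto simp: u_def)
  have entry: "saito_form R \<alpha> k c p (\<lambda>j. ext_coord \<alpha> j (mirror_frame \<alpha> m (Suc a)))
      (\<lambda>j. ext_coord \<alpha> j (mirror_frame \<alpha> m (Suc b))) = ?C $$ (a, b)"
    if ab: "a < ?N" "b < ?N" "a \<noteq> m - 1" "b \<noteq> m - 1" for a b
  proof -
    have "saito_form R \<alpha> k c p (\<lambda>j. ext_coord \<alpha> j (mirror_frame \<alpha> m (Suc a)))
        (\<lambda>j. ext_coord \<alpha> j (mirror_frame \<alpha> m (Suc b)))
      = (\<Sum>r<?N. \<Sum>s<?N. ?C $$ (r, s) * u a r * u b s)"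
      unfolding saito_form_def Suc_eq_plus1[symmetric] sum_1_to u_def
      by (intro sum.cong refl)
        (simp add: saito_metric_mirror[OF P cov mirror_not_regular[OF m p]])
    also have "\<dots> = (\<Sum>r<?N. \<Sum>s<?N. if r = a then (if s = b then ?C $$ (a, b) else 0) else 0)"
    proof (intro sum.cong refl)
      fix r s assume "r \<in> {..<?N}" "s \<in> {..<?N}"
      then show "?C $$ (r, s) * u a r * u b s = (if r = a then (if s = b then ?C $$ (a, b) else 0) else 0)"
      proof (cases "r = m - 1 \<or> s = m - 1")
        case True
        then have "?C $$ (r, s) = 0" using Cm \<open>r \<in> {..<?N}\<close> \<open>s \<in> {..<?N}\<close> by blast
        moreover have "\<not> (r = a \<and> s = b)" using True ab by blast
        ultimately show ?thesis by (simp only: mult_zero_left) presburger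
      next
        case False
        then have "u a r = of_bool (a = r)" "u b s = of_bool (b = s)"
          using u ab \<open>r \<in> {..<?N}\<close> \<open>s \<in> {..<?N}\<close> by blast+
        then show ?thesis by (simp only: of_bool_def) simp
      qed
    qed
    also have "\<dots> = (\<Sum>r<?N. if r = a then ?C $$ (a, b) else 0)"
    proof (intro sum.cong refl)
      fix r
      show "(\<Sum>s<?N. if r = a then (if s = b then ?C $$ (a, b) else 0) else 0) = (if r = a then ?C $$ (a, b) else 0)"
        using ab by (cases "r = a") (simp_all del: sum.lessThan_Suc)
    qed
    also have "\<dots> = ?C $$ (a, b)" using ab by (simp del: sum.lessThan_Suc)
    finally show ?thesis .
  qed
  show ?thesis
  proof (rule eq_matI)
    fix i j assume "i < dim_row (mat_delete ?C (m - 1) (m - 1))" "j < dim_col (mat_delete ?C (m - 1) (m - 1))"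
    then have ij: "i < CARD('n)" "j < CARD('n)" using C by auto
    define a where "a = (if i < m - 1 then i else Suc i)"
    define b where "b = (if j < m - 1 then j else Suc j)"
    have ab: "a < ?N" "b < ?N" "a \<noteq> m - 1" "b \<noteq> m - 1" using ij by (auto simp: a_def b_def)
    have "saito_gram_mirror R \<alpha> k c m p $$ (i, j)
        = saito_form R \<alpha> k c p (\<lambda>j. ext_coord \<alpha> j (mirror_frame \<alpha> m (Suc a)))
            (\<lambda>j. ext_coord \<alpha> j (mirror_frame \<alpha> m (Suc b)))"
      using ij ab by (simp add: saito_gram_mirror_def mat_delete_def a_def b_def)
    also have "\<dots> = ?C $$ (a, b)" by (rule entry[OF ab])
    also have "\<dots> = mat_delete ?C (m - 1) (m - 1) $$ (i, j)"
      unfolding mat_delete_entry[OF C ij] a_def b_def ..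
    finally show "saito_gram_mirror R \<alpha> k c m p $$ (i, j) = mat_delete ?C (m - 1) (m - 1) $$ (i, j)" .
  qed (use carrier_matD[OF jacobian_carrier[of t p]] in \<open>simp_all add: saito_gram_mirror_def mat_delete_def\<close>)
qed

text \<open>The last row of \<open>T\<close> is a unit vector.\<close>

lemma cofactor_jacobian_minor:
  assumes m: "m \<in> {1..CARD('n)}"
  shows "cofactor (T p) 0 (m - 1) = (- 1) ^ (m - 1) * jacobian_minor \<alpha> t m p"
proof -
  obtain n' where n': "CARD('n) = Suc n'" using m by (cases "CARD('n)") auto
  let ?A = "mat_delete (T p) 0 (m - 1)"
  have A: "?A \<in> carrier_mat (Suc n') (Suc n')"
    using mat_delete_carrier[OF jacobian_carrier[of t p]] by (simp add: n')
  have entry: "?A $$ (i, j) = D (Suc (if j < m - 1 then j else Suc j)) (t (Suc (Suc i))) p"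
    if "i < CARD('n)" "j < CARD('n)" for i j
    using that by (simp add: mat_delete_def jacobian_def)
  have "Determinant.det ?A = Determinant.det (mat_delete ?A n' n')"
  proof (rule det_last_row[OF A])
    fix j assume j: "j < Suc n'"
    have "?A $$ (n', j) = D (Suc (if j < m - 1 then j else Suc j)) snd p"
      using entry[of n' j] j t_last by (simp add: n')
    also have "\<dots> = of_bool (j = n')"
      by (subst D_snd) (use j m n' in auto)
    finally show "?A $$ (n', j) = of_bool (j = n')" .
  qed
  also have "mat_delete ?A n' n' = mat_delete
      (Matrix.mat CARD('n) CARD('n) (\<lambda>(i, j). D (j + 1) (t (i + 1)) p)) 0 (m - 1)"
  proof (rule eq_matI)
    fix i j
    assume "i < dim_row (mat_delete (Matrix.mat CARD('n) CARD('n) (\<lambda>(i, j). D (j + 1) (t (i + 1)) p)) 0 (m - 1))"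
      "j < dim_col (mat_delete (Matrix.mat CARD('n) CARD('n) (\<lambda>(i, j). D (j + 1) (t (i + 1)) p)) 0 (m - 1))"
    then have ij: "i < n'" "j < n'" by (simp_all add: n' mat_delete_def)
    have "mat_delete ?A n' n' $$ (i, j) = ?A $$ (i, j)"
      using mat_delete_entry[OF A ij] ij by simp
    then show "mat_delete ?A n' n' $$ (i, j)
        = mat_delete (Matrix.mat CARD('n) CARD('n) (\<lambda>(i, j). D (j + 1) (t (i + 1)) p)) 0 (m - 1) $$ (i, j)"
      using ij entry[of i j] n' by (simp add: mat_delete_def)
  qed (use carrier_matD[OF jacobian_carrier[of t p]] n' in \<open>simp_all add: mat_delete_def\<close>)
  finally show ?thesis by (simp add: cofactor_def jacobian_minor_def)
qed

text \<open>The component \<open>m\<close> of \<open>e = \<partial>/\<partial>t\<^sub>1\<close> is a cofactor divided by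
  \<open>det T\<close>; differentiate the quotient.\<close>

lemma saito_contravariant_diagonal:
  assumes m: "m \<in> {1..Suc CARD('n)}" and p: "p \<in> regular"
  shows "saito_contravariant R \<alpha> k c m m p * (Determinant.det (T p) * Determinant.det (T p))
    = 2 * (\<Sum>s\<in>{1..Suc CARD('n)}. complex_of_real (gam m s) *
        (cofactor (T p) 0 (m - 1) * D s (\<lambda>p. Determinant.det (T p)) p
          - D s (\<lambda>p. cofactor (T p) 0 (m - 1)) p * Determinant.det (T p)))"
proof -
  have m1: "m - 1 < Suc CARD('n)" using m by auto
  have De: "D s (e c m) p = (D s (\<lambda>p. cofactor (T p) 0 (m - 1)) p * Determinant.det (T p)
      - cofactor (T p) 0 (m - 1) * D s (\<lambda>p. Determinant.det (T p)) p)
     / (Determinant.det (T p) * Determinant.det (T p))" for s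
  proof (rule dir_deriv_eq, rule has_dir_deriv_cong_open[OF _ open_regular p])
    show "has_dir_deriv (\<lambda>p. inv_mat (T p) $$ (m - 1, 0))
      ((D s (\<lambda>p. cofactor (T p) 0 (m - 1)) p * Determinant.det (T p)
      - cofactor (T p) 0 (m - 1) * D s (\<lambda>p. Determinant.det (T p)) p)
     / (Determinant.det (T p) * Determinant.det (T p))) (ext_frame \<alpha> s) p"
      by (rule inv_mat_field[OF T_E jacobian_carrier det_T_nonzero p m1]) auto
    show "inv_mat (T q) $$ (m - 1, 0) = e c m q" if "q \<in> regular" for q
      using e_t[OF that m] by (simp add: coord_field_def)
  qed
  have De': "D s (e c m) p * (Determinant.det (T p) * Determinant.det (T p))
      = D s (\<lambda>p. cofactor (T p) 0 (m - 1)) p * Determinant.det (T p)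
        - cofactor (T p) 0 (m - 1) * D s (\<lambda>p. Determinant.det (T p)) p" for s
    using De[of s] det_T_nonzero[OF p] by simp
  show ?thesis
    unfolding saito_contravariant_eq[OF m m] sum_distrib_left sum_distrib_right sum_negf[symmetric]
  proof (intro sum.cong refl)
    fix s
    have "- (complex_of_real (gam s m) * D s (e c m) p + complex_of_real (gam m s) * D s (e c m) p)
        * (Determinant.det (T p) * Determinant.det (T p))
      = - 2 * complex_of_real (gam m s) * (D s (e c m) p * (Determinant.det (T p) * Determinant.det (T p)))"
      by (simp add: gam_commute[of s m])
    also have "\<dots> = 2 * (complex_of_real (gam m s) *
        (cofactor (T p) 0 (m - 1) * D s (\<lambda>p. Determinant.det (T p)) p
          - D s (\<lambda>p. cofactor (T p) 0 (m - 1)) p * Determinant.det (T p)))"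
      unfolding De' by (simp add: algebra_simps)
    finally show "- (complex_of_real (gam s m) * D s (e c m) p + complex_of_real (gam m s) * D s (e c m) p)
        * (Determinant.det (T p) * Determinant.det (T p))
      = 2 * (complex_of_real (gam m s) *
        (cofactor (T p) 0 (m - 1) * D s (\<lambda>p. Determinant.det (T p)) p
          - D s (\<lambda>p. cofactor (T p) 0 (m - 1)) p * Determinant.det (T p)))" .
  qed
qed

text \<open>At regular points \<open>F\<close>, the minor of the metric, equals the determinant times a diagonal entry of
  the inverse matrix, which is \<open>G\<close> by \<open>saito_contravariant_diagonal\<close>. Both sides are
  exponential sums, so they agree on the mirror too, where the terms with the factor \<open>J\<close> vanish.\<close>

theorem det_gram_mirror:
  assumes m: "m \<in> {1..CARD('n)}"
  obtains C where "C \<noteq> 0" "\<And>p. p \<in> mirror \<alpha> m \<Longrightarrow>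
    Determinant.det (saito_gram_mirror R \<alpha> k c m p) = C * jacobian_minor \<alpha> t m p *
      (\<Sum>s\<in>{1..Suc CARD('n)}. complex_of_real (gam m s) * D s (\<lambda>p. Determinant.det (T p)) p)"
proof -
  let ?N = "Suc CARD('n)"
  obtain P where P: "P \<in> carrier_mat ?N ?N" "Determinant.det P \<noteq> 0"
    "\<And>p. p \<in> regular \<Longrightarrow> inv_mat (eta p) = pullback P p" using covariant_eq by blast
  define J where "J p = Determinant.det (T p)" for p
  define M where "M p = cofactor (T p) 0 (m - 1)" for p
  define F where "F p = Determinant.det (mat_delete (pullback P p) (m - 1) (m - 1))" for p
  define G where "G p = 2 * Determinant.det P * (\<Sum>s\<in>{1..?N}. complex_of_real (gam m s) * (M p * D s J p - D s M p * J p))" for p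
  have m1: "m - 1 < ?N" and mN: "m \<in> {1..?N}" using m by auto
  have C: "pullback P p \<in> carrier_mat ?N ?N" for p using P jacobian_carrier[of t p] by auto
  have J: "J \<in> E" unfolding J_def by (rule det_T_E)
  have M: "M \<in> E" unfolding M_def by (rule cofactor_ring[OF E_ring T_E jacobian_carrier])
  have F: "F \<in> E"
  proof -
    have "F = (\<lambda>p. cofactor (pullback P p) (m - 1) (m - 1))"
      by (rule ext) (simp add: F_def cofactor_def power_add[symmetric] flip: mult_2)
    moreover have "(\<lambda>p. cofactor (pullback P p) (m - 1) (m - 1)) \<in> E"
      by (rule cofactor_ring[OF E_ring covariant_E[OF P(1)] C])
    ultimately show ?thesis by (simp only:)
  qed
  have G: "G \<in> E"
  proof -
    have "(\<lambda>p. 2 * Determinant.det P * (\<Sum>s\<in>{1..?N}. complex_of_real (gam m s) * (M p * D s J p + (- 1) * (D s M p * J p)))) \<in> E"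
      by (intro function_ring_mult[OF E_ring] function_ring_add[OF E_ring] function_ring_const[OF E_ring]
          function_ring_sum[OF E_ring] E_deriv J M)
    then show ?thesis unfolding G_def by simp
  qed
  have "F p = G p" if p: "p \<in> regular" for p
  proof -
    let ?C = "pullback P p"
    have Tt: "transpose_mat (T p) \<in> carrier_mat ?N ?N" using jacobian_carrier by simp
    note Einv = inv_mat_inverse[OF eta_carrier det_eta[OF p]]
    have detC: "Determinant.det ?C = Determinant.det P * (J p * J p)"
      unfolding J_def det_mult[OF mult_carrier_mat[OF Tt P(1)] jacobian_carrier]
        det_mult[OF Tt P(1)] det_transpose[OF jacobian_carrier] by simp
    have nz: "Determinant.det ?C \<noteq> 0" unfolding detC using P(2) det_T_nonzero[OF p] by (simp add: J_def)
    have "inv_mat ?C = eta p"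
      by (rule inv_mat_eq[OF C eta_carrier]) (use Einv(3) P(3)[OF p] in simp)
    then have "eta p $$ (m - 1, m - 1) = cofactor ?C (m - 1) (m - 1) / Determinant.det ?C"
      using inv_mat_cofactor[OF C nz m1 m1] by simp
    moreover have "cofactor ?C (m - 1) (m - 1) = F p"
      by (simp add: F_def cofactor_def power_add[symmetric] flip: mult_2)
    moreover have "eta p $$ (m - 1, m - 1) = saito_contravariant R \<alpha> k c m m p"
      using m by (cases m) (simp_all add: saito_contravariant_mat_def)
    ultimately have "F p = Determinant.det P * (saito_contravariant R \<alpha> k c m m p * (J p * J p))"
      using nz unfolding detC by (auto simp: field_simps)
    then show ?thesis
      using saito_contravariant_diagonal[OF mN p] by (simp add: G_def J_def[abs_def] M_def[abs_def])
  qed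
  then have FG: "F p = G p" for p
    using eq_on_regular[OF exp_sums_continuous[OF F] exp_sums_continuous[OF G]] by blast
  have "Determinant.det (saito_gram_mirror R \<alpha> k c m p) = (2 * Determinant.det P * (- 1) ^ (m - 1)) * jacobian_minor \<alpha> t m p *
      (\<Sum>s\<in>{1..Suc CARD('n)}. complex_of_real (gam m s) * D s J p)" if p: "p \<in> mirror \<alpha> m" for p
  proof -
    have "J p = 0"
    proof -
      obtain A a where "\<And>p. Determinant.det (T p) = A * pexp a p * denominator (fst p)" using det_T by metis
      then show ?thesis using mirror_not_regular[OF m p] by (simp add: J_def regular_eq)
    qed
    have "Determinant.det (saito_gram_mirror R \<alpha> k c m p) = G p"
    proof -
      have "saito_gram_mirror R \<alpha> k c m p = mat_delete (pullback P p) (m - 1) (m - 1)"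
        by (rule gram_mirror[OF P(1) P(3) m p])
      then show ?thesis by (simp only: FG[symmetric] F_def)
    qed
    also have "\<dots> = 2 * Determinant.det P * (\<Sum>s\<in>{1..?N}. M p * (complex_of_real (gam m s) * D s J p))"
      unfolding G_def \<open>J p = 0\<close> by (simp add: mult_ac del: sum.cl_ivl_Suc)
    also have "\<dots> = 2 * Determinant.det P * (M p * (\<Sum>s\<in>{1..?N}. complex_of_real (gam m s) * D s J p))"
      by (simp only: sum_distrib_left)
    finally show ?thesis unfolding M_def cofactor_jacobian_minor[OF m] by (simp only: mult_ac)
  qed
  moreover have "2 * Determinant.det P * (- 1) ^ (m - 1) \<noteq> 0" using P(2) by simp
  ultimately show ?thesis using that unfolding J_def by blast
qed

lemma sinh_root_deriv: "has_dir_deriv (sinh_root \<beta>) (cosh (cdot (cvec \<beta>) (fst p) / 2) * cdot (cvec \<beta>) (fst v)) v p"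
proof -
  have "sinh_root \<beta> (ext_line p v z) = 2 * sinh ((cdot (cvec \<beta>) (fst p) + z * cdot (cvec \<beta>) (fst v)) / 2)" for z
    by (simp add: sinh_root_def ext_line_def cdot_add_right cdot_scale_right)
  then show ?thesis unfolding has_dir_deriv_def
    by (auto intro!: derivative_eq_intros)
qed

text \<open>With \<open>det T = A sinh_root (\<alpha> m)\<close>, the derivative on the mirror is \<open>A\<close> times
  the derivative of the second factor, whose gradient pairs to \<open>1\<close> with the coweight of index
  \<open>m\<close>.\<close>

lemma det_T_mirror:
  assumes m: "m \<in> {1..CARD('n)}"
  obtains C a where "C \<noteq> 0" "a \<in> rational_exponents"
    "\<And>p. p \<in> mirror \<alpha> m \<Longrightarrow>
      (\<Sum>s\<in>{1..Suc CARD('n)}. complex_of_real (gam m s) * D s (\<lambda>p. Determinant.det (T p)) p)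
        = C * pexp a p * (\<Prod>\<beta>\<in>pos_roots - {\<alpha> m}. sinh_root \<beta> p)"
proof -
  obtain C a where Ca: "C \<noteq> 0" "a \<in> rational_exponents"
    "\<And>p. Determinant.det (T p) = C * pexp a p * denominator (fst p)" using det_T by metis
  define A where "A p = C * pexp a p * (\<Prod>\<beta>\<in>pos_roots - {\<alpha> m}. sinh_root \<beta> p)" for p
  have sinh_E: "sinh_root \<beta> \<in> E" if b: "\<beta> \<in> pos_roots" for \<beta>
  proof -
    have half: "((1/2) *\<^sub>R v, 0) \<in> rational_exponents" if "v \<in> R" for v
      by (rule rational_exponents_half, rule rational_exponentsI) (use that integral_root in auto)
    have "\<beta> \<in> R" "- \<beta> \<in> R" using b pos_root_in neg_root by auto
    note half[OF this(1)] half[OF this(2)]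
    then have "(\<lambda>p. pexp ((1/2) *\<^sub>R \<beta>, 0) p + (- 1) * pexp ((1/2) *\<^sub>R - \<beta>, 0) p) \<in> E"
      by (intro function_ring_add[OF E_ring] function_ring_mult[OF E_ring] function_ring_const[OF E_ring] pexp_E)
    moreover have "(\<lambda>p. pexp ((1/2) *\<^sub>R \<beta>, 0) p + (- 1) * pexp ((1/2) *\<^sub>R - \<beta>, 0) p) = sinh_root \<beta>"
      by (rule ext) (simp add: sinh_root_def sinh_wexp pexp_wexp)
    ultimately show ?thesis by simp
  qed
  have A: "A \<in> E" unfolding A_def
    by (intro function_ring_mult[OF E_ring] function_ring_const[OF E_ring] function_ring_prod[OF E_ring]
        pexp_E Ca(2) sinh_E) auto
  have J: "(\<lambda>p. Determinant.det (T p)) = (\<lambda>p. A p * sinh_root (\<alpha> m) p)"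
    using finite_pos_roots simple_root_pos[OF m]
    by (simp add: fun_eq_iff Ca(3) A_def denominator_def sinh_root_def prod.remove[of pos_roots "\<alpha> m"])
  have "(\<Sum>s\<in>{1..Suc CARD('n)}. complex_of_real (gam m s) * D s (\<lambda>p. Determinant.det (T p)) p) = A p"
    if p: "p \<in> mirror \<alpha> m" for p
  proof -
    have zero: "sinh_root (\<alpha> m) p = 0" and one: "cosh (cdot (cvec (\<alpha> m)) (fst p) / 2) = 1"
      using p by (simp_all add: sinh_root_def mirror_def)
    have deriv: "D s (\<lambda>p. A p * sinh_root (\<alpha> m) p) p = cdot (cvec (\<alpha> m)) (fst (ext_frame \<alpha> s)) * A p" for s
    proof (rule dir_deriv_eq)
      have "has_dir_deriv (\<lambda>p. A p * sinh_root (\<alpha> m) p) (D s A p * sinh_root (\<alpha> m) p +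
          cosh (cdot (cvec (\<alpha> m)) (fst p) / 2) * cdot (cvec (\<alpha> m)) (fst (ext_frame \<alpha> s)) * A p) (ext_frame \<alpha> s) p"
        by (intro has_dir_deriv_mult E_has_deriv A sinh_root_deriv)
      then show "has_dir_deriv (\<lambda>p. A p * sinh_root (\<alpha> m) p)
          (cdot (cvec (\<alpha> m)) (fst (ext_frame \<alpha> s)) * A p) (ext_frame \<alpha> s) p"
        by (simp only: zero one mult_zero_right mult_1_left add_0_left)
    qed
    have "(\<Sum>s\<in>{1..Suc CARD('n)}. complex_of_real (gam m s) * cdot (cvec (\<alpha> m)) (fst (ext_frame \<alpha> s)))
        = (\<Sum>s\<in>{1..CARD('n)}. complex_of_real ((\<alpha> m \<bullet> \<alpha> s) * (omega_check m \<bullet> omega_check s)))"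
      using m by (simp add: gam_def ext_frame_def cdot_cvec cdot_0_right mult.commute)
    also have "\<dots> = complex_of_real (\<alpha> m \<bullet> omega_check m)"
      unfolding inner_expansion[of "\<alpha> m" "omega_check m"] by simp
    also have "\<dots> = 1" using simple_coweight[OF m m] by simp
    finally show ?thesis unfolding J deriv
      by (simp add: sum_distrib_right[symmetric] mult.assoc[symmetric] del: sum.cl_ivl_Suc)
  qed
  then show ?thesis using that[OF Ca(1,2)] unfolding A_def by blast
qed

end

lemma marked_index_range:
  assumes "valid_cartan_type X" "marked_index X k" shows "k \<in> {1..cartan_rank X}"
  using assms by (cases X) auto

lemma bourbaki_norm_rational: "bourbaki_norm X i \<in> \<rat>"
  by (cases X) auto

theorem theorem3p16:
  fixes R :: "(real ^ 'n) set"
    and \<alpha> :: "nat \<Rightarrow> real ^ 'n"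
    and X :: cartan_type
    and k m :: nat
    and c :: complex
    and t :: "nat \<Rightarrow> (complex ^ 'n) \<times> complex \<Rightarrow> complex"
  assumes "root_system R"
    and "irreducible_roots R"
    and "simple_roots R \<alpha>"
    and "bourbaki_simple_roots X \<alpha>"
    and "marked_index X k"
    and "c \<noteq> 0"
    and "saito_flat_coords R \<alpha> k c t"
    and "m \<in> {1..CARD('n)}"
  shows "eq_up_to_unit_on (mirror \<alpha> m) R
    (\<lambda>p. Determinant.det (saito_gram_mirror R \<alpha> k c m p))
    (\<lambda>p. jacobian_minor \<alpha> t m p * (\<Prod>\<beta>\<in>positive_roots R \<alpha> - {\<alpha> m}. sinh_root \<beta> p))"
proof -
  have X: "valid_cartan_type X" "cartan_rank X = CARD('n)"
    "\<And>i j. i \<in> {1..CARD('n)} \<Longrightarrow> j \<in> {1..CARD('n)} \<Longrightarrow> \<alpha> i \<bullet> \<alpha> j = bourbaki_gram X i j"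
    using assms(4) by (auto simp: bourbaki_simple_roots_def)
  have k: "k \<in> {1..CARD('n)}" using marked_index_range[OF X(1) assms(5)] X(2) by simp
  interpret flat_saito_metric R \<alpha> k c t
  proof
    show "\<alpha> k \<bullet> \<alpha> k \<in> \<rat>" using X(3)[OF k k] bourbaki_norm_rational by (simp add: bourbaki_gram_def)
  qed (use assms k in auto)
  obtain C where C: "C \<noteq> 0" "\<And>p. p \<in> mirror \<alpha> m \<Longrightarrow>
    Determinant.det (saito_gram_mirror R \<alpha> k c m p) = C * jacobian_minor \<alpha> t m p *
      (\<Sum>s\<in>{1..Suc CARD('n)}. complex_of_real (gam m s) * D s (\<lambda>p. Determinant.det (T p)) p)"
    using det_gram_mirror[OF assms(8)] by blast
  obtain C' a where C': "C' \<noteq> 0" "a \<in> rational_exponents"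
    "\<And>p. p \<in> mirror \<alpha> m \<Longrightarrow>
      (\<Sum>s\<in>{1..Suc CARD('n)}. complex_of_real (gam m s) * D s (\<lambda>p. Determinant.det (T p)) p)
        = C' * pexp a p * (\<Prod>\<beta>\<in>pos_roots - {\<alpha> m}. sinh_root \<beta> p)"
    using det_T_mirror[OF assms(8)] by blast
  have "trig_unit R (\<lambda>p. (C * C') * pexp a p)"
    by (rule trig_unit_pexp) (use C(1) C'(1,2) in auto)
  moreover have "Determinant.det (saito_gram_mirror R \<alpha> k c m p) = (C * C') * pexp a p *
      (jacobian_minor \<alpha> t m p * (\<Prod>\<beta>\<in>positive_roots R \<alpha> - {\<alpha> m}. sinh_root \<beta> p))"
    if "p \<in> mirror \<alpha> m" for p
    unfolding C(2)[OF that] C'(3)[OF that] by (simp only: mult_ac)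
  ultimately show ?thesis unfolding eq_up_to_unit_on_def by blast
qed

end
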